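(* Let $K$ be an $(n-1)$-dimensional PL sphere with vertex set $[m]=\{1,\dots,m\}$, where $m\le n+4$. Then every subgroup of $\mathbb{Z}_2^m$ acting freely on the real moment-angle complex $\mathbb{R}\mathcal{Z}_K$ is induced by a subtorus of $T^m$ acting freely on the moment-angle complex $\mathcal{Z}_K$.
   Context: A PL sphere is a simplicial complex that is piecewise linearly homeomorphic to the boundary of a simplex. For a simplicial complex $K$ on $[m]$ and a pair of spaces $(X,Y)$, the polyhedral product is $(\underline{X},\underline{Y})^K=\bigcup_{\sigma\in K}\{(x_1,\dots,x_m)\in X^m \mid x_i\in Y \text{ when } i\notin\sigma\}$. With $D^d=\{\mathbf{x}\in\mathbb{R}^d : \|\mathbf{x}\|\le 1\}$ and $S^{d-1}=\partial D^d$, put $\mathcal{Z}_K=(\underline{D^2},\underline{S^1})^K$ and $\mathbb{R}\mathcal{Z}_K=(\underline{D^1},\underline{S^0})^K$. The torus $T^m=(S^1)^m$ acts on $\mathcal{Z}_K$ by coordinatewise rotation of $D^2\subset\mathbb{C}$, and $\mathbb{Z}_2^m$ (with $\mathbb{Z}_2=\mathbb{Z}/2\mathbb{Z}$ identified with $S^0=\{\pm1\}$) acts on $\mathbb{R}\mathcal{Z}_K$ by coordinatewise sign changes. An $r$-dimensional subtorus $H\subset T^m$ can be written as $H=\{(e^{2\pi i(s_{11}\phi_1+\dots+s_{1r}\phi_r)},\dots,e^{2\pi i(s_{m1}\phi_1+\dots+s_{mr}\phi_r)}) \mid \phi_1,\dots,\phi_r\in\mathbb{R}\}$, where the columns of the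 integer $m\times r$ matrix $S=(s_{ij})$ form a basis of a rank $r$ direct summand of $\mathbb{Z}^m$. The subgroup of $\mathbb{Z}_2^m$ induced by $H$ is the rank $r$ subgroup spanned by the columns of the mod $2$ reduction of $S$ (equivalently, $H\cap\{\pm1\}^m$). *)

theory Defs
  imports "HOL-Analysis.Analysis" "HOL-Algebra.Generated_Groups"
begin

text \<open>Throughout, the index set \<open>[m]\<close> is the finite type \<open>'m\<close>, so \<open>m = CARD('m)\<close>.\<close>

subsection \<open>Simplicial complexes and PL spheres\<close>

definition abstract_complex :: "'m::finite set set \<Rightarrow> bool" where
  "abstract_complex K \<longleftrightarrow> {} \<in> K \<and> (\<forall>\<sigma>\<in>K. \<forall>\<tau>. \<tau> \<subseteq> \<sigma> \<longrightarrow> \<tau> \<in> K)"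

definition vertex_set :: "'m::finite set set \<Rightarrow> 'm set" where
  "vertex_set K = {i. {i} \<in> K}"

definition complex_dim :: "'m::finite set set \<Rightarrow> int" where
  "complex_dim K = int (Max (card ` K)) - 1"

definition geometric_realization :: "'m::finite set set \<Rightarrow> (real^'m) set" where
  "geometric_realization K = (\<Union>\<sigma>\<in>K. convex hull ((\<lambda>i. axis i 1) ` \<sigma>))"

definition pl_map_on :: "'a::euclidean_space set \<Rightarrow> ('a \<Rightarrow> 'b::euclidean_space) \<Rightarrow> bool" where
  "pl_map_on P f \<longleftrightarrow>
     (\<exists>\<T>. simplicial_complex \<T> \<and> \<Union>\<T> = P \<and>
          (\<forall>S\<in>\<T>. \<exists>L b. linear L \<and> (\<forall>x\<in>S. f x = L x + b)))"

text \<open>The inverse of a PL homeomorphism between compact polyhedra is automatically PL.\<close>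

definition pl_homeomorphic :: "'a::euclidean_space set \<Rightarrow> 'b::euclidean_space set \<Rightarrow> bool" where
  "pl_homeomorphic P Q \<longleftrightarrow> (\<exists>f g. homeomorphism P Q f g \<and> pl_map_on P f)"

text \<open>
  The simplex is taken in the same space \<open>real^'m\<close>. This is no restriction: a sphere of dimension
  \<open>d - 1\<close> triangulated with \<open>m\<close> vertices has \<open>d < m\<close>, and \<open>real^'m\<close> contains
  \<open>d\<close>-simplices for all \<open>d \<le> m\<close>. For \<open>d = 0\<close> the boundary is empty.
\<close>

definition pl_sphere :: "'m::finite set set \<Rightarrow> bool" where
  "pl_sphere K \<longleftrightarrow> abstract_complex K \<and>
     (\<exists>(d::nat) (\<Delta> :: (real^'m) set). int d simplex \<Delta> \<and>
        pl_homeomorphic (geometric_realization K) (rel_frontier \<Delta>))"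


subsection \<open>Polyhedral products\<close>

definition polyhedral_product :: "'a set \<Rightarrow> 'a set \<Rightarrow> 'm::finite set set \<Rightarrow> ('a^'m) set" where
  "polyhedral_product X Y K =
     (\<Union>\<sigma>\<in>K. {x. (\<forall>i. x $ i \<in> X) \<and> (\<forall>i. i \<notin> \<sigma> \<longrightarrow> x $ i \<in> Y)})"

definition moment_angle_complex :: "'m::finite set set \<Rightarrow> (complex^'m) set" where
  "moment_angle_complex K = polyhedral_product (cball 0 1) (sphere 0 1) K"

definition real_moment_angle_complex :: "'m::finite set set \<Rightarrow> (real^'m) set" where
  "real_moment_angle_complex K = polyhedral_product (cball 0 1) (sphere 0 1) K"


subsection \<open>The groups acting, and free actions\<close>

text \<open>On vectors, \<open>*\<close> and \<open>1\<close> are the componentwise product and the all-ones vector.\<close>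

definition torus_group :: "(complex^'m::finite) monoid" where
  "torus_group = \<lparr>carrier = {t. \<forall>i. t $ i \<in> sphere 0 1}, mult = (*), one = 1\<rparr>"

definition sign_group :: "(real^'m::finite) monoid" where
  "sign_group = \<lparr>carrier = {e. \<forall>i. e $ i \<in> {1, -1}}, mult = (*), one = 1\<rparr>"

definition acts_freely_on :: "('a::monoid_mult^'m::finite) set \<Rightarrow> ('a^'m) set \<Rightarrow> bool" where
  "acts_freely_on G X \<longleftrightarrow> (\<forall>g\<in>G. \<forall>x\<in>X. g * x = x \<longrightarrow> g = 1)"

lemma group_torus_group: "group (torus_group :: (complex^'m::finite) monoid)"
proof (rule groupI)
  fix x :: "complex^'m"
  assume x: "x \<in> carrier torus_group"
  have "(\<chi> i. inverse (x $ i)) \<otimes>\<^bsub>torus_group\<^esub> x = \<one>\<^bsub>torus_group\<^esub>"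
    using x unfolding torus_group_def
    by (simp add: vec_eq_iff) (metis left_inverse norm_zero zero_neq_one)
  moreover have "(\<chi> i. inverse (x $ i)) \<in> carrier torus_group"
    using x by (auto simp: torus_group_def norm_inverse)
  ultimately show "\<exists>y\<in>carrier torus_group. y \<otimes>\<^bsub>torus_group\<^esub> x = \<one>\<^bsub>torus_group\<^esub>"
    by blast
qed (auto simp: torus_group_def norm_mult mult.assoc)

lemma group_sign_group: "group (sign_group :: (real^'m::finite) monoid)"
proof (rule groupI)
  fix x y :: "real^'m"
  assume "x \<in> carrier sign_group" "y \<in> carrier sign_group"
  then show "x \<otimes>\<^bsub>sign_group\<^esub> y \<in> carrier sign_group"
    unfolding sign_group_def by simp (metis mult_1 mult_minus1 minus_minus)
next
  fix x :: "real^'m"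
  assume x: "x \<in> carrier sign_group"
  then have "x $ i * x $ i = 1" for i
    unfolding sign_group_def by simp (metis mult_1 mult_minus1 minus_minus)
  then have "x \<otimes>\<^bsub>sign_group\<^esub> x = \<one>\<^bsub>sign_group\<^esub>"
    by (simp add: sign_group_def vec_eq_iff)
  with x show "\<exists>y\<in>carrier sign_group. y \<otimes>\<^bsub>sign_group\<^esub> x = \<one>\<^bsub>sign_group\<^esub>"
    by blast
qed (auto simp: sign_group_def mult.assoc)

lemma torus_group_action:
  assumes "t \<in> carrier torus_group" "x \<in> moment_angle_complex K"
  shows "t * x \<in> moment_angle_complex K"
  using assms by (fastforce simp: torus_group_def moment_angle_complex_def
      polyhedral_product_def norm_mult)

lemma sign_group_action:
  assumes "e \<in> carrier sign_group" "x \<in> real_moment_angle_complex K"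
  shows "e * x \<in> real_moment_angle_complex K"
proof -
  have "\<bar>e $ i\<bar> = 1" for i
    using assms(1) unfolding sign_group_def by simp (metis abs_1 abs_minus_cancel)
  with assms(2) show ?thesis
    by (fastforce simp: real_moment_angle_complex_def polyhedral_product_def abs_mult)
qed


subsection \<open>Subtori and the subgroups they induce\<close>

interpretation zvec: module "(*s) :: int \<Rightarrow> int^'m::finite \<Rightarrow> int^'m"
  by unfold_locales (vector algebra_simps)+

text \<open>
  The matrix \<open>S\<close> is represented by the set \<open>B\<close> of its columns, so \<open>r = card B\<close>; the parameters
  \<open>\<phi>\<close> are indexed by the columns.
\<close>

definition direct_summand_basis :: "(int^'m::finite) set \<Rightarrow> bool" where
  "direct_summand_basis B \<longleftrightarrow> finite B \<and> zvec.independent B \<and>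
     (\<exists>M. zvec.subspace M \<and> zvec.span B \<inter> M = {0} \<and>
          {x + y | x y. x \<in> zvec.span B \<and> y \<in> M} = UNIV)"

definition subtorus_of :: "(int^'m::finite) set \<Rightarrow> (complex^'m) set" where
  "subtorus_of B =
     {\<chi> i. cis (2 * pi * (\<Sum>b\<in>B. real_of_int (b $ i) * \<phi> b)) | \<phi>. True}"

definition subtorus :: "(complex^'m::finite) set \<Rightarrow> bool" where
  "subtorus H \<longleftrightarrow> (\<exists>B. direct_summand_basis B \<and> H = subtorus_of B)"

text \<open>Reduction mod 2, with \<open>\<int>/2\<close> written multiplicatively as \<open>{1, -1}\<close>.\<close>

definition mod2_reduction :: "int^'m::finite \<Rightarrow> real^'m" where
  "mod2_reduction b = (\<chi> i. if even (b $ i) then 1 else -1)"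

definition induces :: "(complex^'m::finite) set \<Rightarrow> (real^'m) set \<Rightarrow> bool" where
  "induces H G \<longleftrightarrow> (\<exists>B. direct_summand_basis B \<and> H = subtorus_of B \<and>
     G = generate sign_group (mod2_reduction ` B))"

end

theory Submission
  imports Defs
begin

text \<open>
  Write a free subgroup of rank \<open>r\<close> as the column space of an \<open>m\<close> by \<open>r\<close> matrix over \<open>\<int>/2\<close>. Freeness
  says that the rows outside any facet span, so \<open>r \<le> m - n \<le> 4\<close>, and a lift to \<open>\<int>\<close> spans the
  wanted subtorus as soon as the rows outside each facet contain an integral basis. For \<open>r < 4\<close> every
  basis over \<open>\<int>/2\<close> lifts to an integral one, so only \<open>r = 4 = m - n\<close> needs work.

  In that case complements of facets are sent to bases of \<open>(\<int>/2)\<^sup>4\<close>. Invariance of domain shows that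
  a ridge of a sphere lies in exactly two facets; hence two vertices with the same row are
  interchangeable, and among the bases contained in a set of five rows exactly none or two come from
  facets. One fixed lift of the 15 nonzero vectors is unimodular on all but nine bases. If the lift
  failed for every choice of coordinates, some image of these nine bases under each element of
  \<open>GL\<^sub>4(\<int>/2)\<close> would come from a facet, and chasing exchanges of basis elements shows that this is
  impossible.
\<close>

section \<open>Triangulated spheres are pseudomanifolds\<close>

text \<open>Rank four is critical because of the size of 0-1 determinants. Up to order three they
  are at most 2 in absolute value, and a basis over Z/2 has odd determinant, so it lifts to
  determinant 1 or -1; in order four the value 3 occurs. The lift used here keeps the bound in order
  three and leaves nine exceptions in order four. An exception does harm only if some facet
  complement realises it, and the basis of the subgroup can still be changed by an element of
  \<open>GL_4(Z/2)\<close>. Failure of all choices is therefore studied as a combinatorial structure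
  of its own: a family of bases of which every group element hits an exceptional set. This structure
  is invariant under the group, so any basis that occurs may be taken to be 1, 2, 4, 8. Topology
  enters it only through the ridge condition, read as a count inside five-element sets. Vertices
  with equal rows must be shown interchangeable first, since otherwise the family of row sets would
  not determine which vertex sets are facet complements.\<close>

lemma convex_hull_axes:
  fixes \<sigma> :: "'m::finite set"
  shows "convex hull ((\<lambda>i. axis i 1) ` \<sigma>) =
    {x::real^'m. (\<forall>i. 0 \<le> x $ i) \<and> (\<Sum>i\<in>UNIV. x $ i) = 1 \<and> (\<forall>i. i \<notin> \<sigma> \<longrightarrow> x $ i = 0)}" (is "?H = ?R")
proof
  have "convex ?R"
    unfolding convex_def by (auto simp: sum.distrib simp flip: sum_distrib_left)
  moreover have "axis i 1 \<in> ?R" if "i \<in> \<sigma>" for i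
    using that by (auto simp: axis_def)
  ultimately show "?H \<subseteq> ?R"
    by (intro hull_minimal) auto
next
  show "?R \<subseteq> ?H"
  proof
    fix x assume x: "x \<in> ?R"
    have eq: "(\<Sum>i\<in>\<sigma>. x $ i) = 1"
      using x by (subst sum.mono_neutral_left[where T = UNIV]) auto
    have "(\<Sum>i\<in>\<sigma>. x $ i *\<^sub>R axis i 1) \<in> ?H"
      using x eq by (intro convex_sum) (auto intro: hull_inc)
    moreover have "(\<Sum>i\<in>\<sigma>. x $ i *\<^sub>R axis i 1) = x"
    proof -
      have "(\<Sum>i\<in>\<sigma>. x $ i *\<^sub>R (axis i 1 :: real^'m)) $ j = x $ j" for j
      proof -
        have "(\<Sum>i\<in>\<sigma>. x $ i *\<^sub>R (axis i 1 :: real^'m)) $ j = (\<Sum>i\<in>\<sigma>. if i = j then x $ j else 0)"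
          unfolding sum_component by (intro sum.cong) (auto simp: axis_def)
        then show ?thesis using x by (auto simp: sum.delta)
      qed
      then show ?thesis by (simp add: vec_eq_iff)
    qed
    ultimately show "x \<in> ?H" by simp
  qed
qed

lemma mem_geometric_realization:
  assumes "abstract_complex K"
  shows "x \<in> geometric_realization K \<longleftrightarrow>
    (\<forall>i. 0 \<le> x $ i) \<and> (\<Sum>i\<in>UNIV. x $ i) = 1 \<and> {i. x $ i \<noteq> 0} \<in> K" (is "?L \<longleftrightarrow> ?R")
proof
  assume ?L
  then obtain \<sigma> where \<sigma>: "\<sigma> \<in> K" "\<forall>i. 0 \<le> x $ i" "(\<Sum>i\<in>UNIV. x $ i) = 1" "\<forall>i. i \<notin> \<sigma> \<longrightarrow> x $ i = 0"
    unfolding geometric_realization_def convex_hull_axes by auto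
  then have "{i. x $ i \<noteq> 0} \<subseteq> \<sigma>" by auto
  then show ?R using \<sigma> assms unfolding abstract_complex_def by blast
next
  assume ?R
  then show ?L unfolding geometric_realization_def convex_hull_axes by blast
qed

text \<open>For a sphere, \<open>k\<close> is the dimension and the chart is projection from a point
  other than \<open>x\<close>. One chart on everything but a point replaces an atlas, and for
  \<open>k = 0\<close> it also counts the points of \<open>N\<close>.\<close>

locale punctured_euclidean =
  fixes N :: "'a::euclidean_space set" and k :: nat
  assumes puncture: "x \<in> N \<Longrightarrow> \<exists>(A::'a set) \<phi> \<psi> x'. subspace A \<and> dim A = k \<and> x' \<in> N \<and> x' \<noteq> x \<and>
      homeomorphism (N - {x'}) A \<phi> \<psi>"
begin

lemma openin_delete: "openin (top_of_set N) (N - {x'})"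
  by (metis Diff_eq open_Compl closed_singleton openin_open_Int)

text \<open>Composing with the chart around \<open>\<theta> y\<close> turns a parametrization of
  part of \<open>N\<close> into a map between subspaces, where invariance of domain is available;
  the last clause carries openness back to \<open>N\<close>.\<close>

lemma pull_back_chart:
  fixes E :: "'b::euclidean_space set"
  assumes D: "openin (top_of_set E) D" "y \<in> D"
    and cont: "continuous_on D \<theta>" and inj: "inj_on \<theta> D" and im: "\<theta> ` D \<subseteq> N"
  obtains A :: "'a set" and D' f where "subspace A" "dim A = k"
    "openin (top_of_set E) D'" "y \<in> D'" "D' \<subseteq> D" "continuous_on D' f" "inj_on f D'" "f \<in> D' \<rightarrow> A"
    "openin (top_of_set A) (f ` D') \<Longrightarrow> openin (top_of_set N) (\<theta> ` D')"
proof -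
  obtain A :: "'a set" and \<phi> \<psi> x' where A: "subspace A" "dim A = k" "x' \<noteq> \<theta> y"
    and h: "homeomorphism (N - {x'}) A \<phi> \<psi>"
    using puncture[of "\<theta> y"] D im by blast
  define D' where "D' = D \<inter> \<theta> -` (N - {x'})"
  have "openin (top_of_set D) D'"
    unfolding D'_def by (rule continuous_openin_preimage[OF cont _ openin_delete]) (use im in auto)
  then have D': "openin (top_of_set E) D'"
    using D openin_trans by blast
  have "continuous_on D' (\<phi> \<circ> \<theta>)"
    using cont h unfolding D'_def homeomorphism_def
    by (intro continuous_on_compose) (auto intro: continuous_on_subset)
  moreover have "inj_on (\<phi> \<circ> \<theta>) D'"
    using inj h unfolding D'_def homeomorphism_def inj_on_def by (metis IntE comp_apply vimageE)
  moreover have "\<phi> \<circ> \<theta> \<in> D' \<rightarrow> A"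
    using h unfolding D'_def homeomorphism_def by auto
  moreover have "openin (top_of_set N) (\<theta> ` D')" if "openin (top_of_set A) ((\<phi> \<circ> \<theta>) ` D')"
  proof -
    have "openin (top_of_set (N - {x'})) (\<psi> ` ((\<phi> \<circ> \<theta>) ` D'))"
      using that h homeomorphism_imp_open_map homeomorphism_symD by blast
    moreover have "\<psi> ` ((\<phi> \<circ> \<theta>) ` D') = \<theta> ` D'"
      using h unfolding D'_def homeomorphism_def by (force simp: image_iff)
    ultimately show ?thesis
      using openin_delete openin_trans by metis
  qed
  moreover have "y \<in> D'" "D' \<subseteq> D"
    using A D im unfolding D'_def by auto
  ultimately show ?thesis using that[OF A(1,2) D'] by blast
qed

text \<open>The dual device: coordinates on an open part of \<open>N\<close> are precomposed with
  the inverse chart. The chart omits a point different from \<open>x\<close>, so the value at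
  \<open>x\<close> survives.\<close>

lemma push_forward_coordinates:
  fixes E :: "'b::euclidean_space set"
  assumes U: "openin (top_of_set N) U" "x \<in> U"
    and cont: "continuous_on U \<eta>" and inj: "inj_on \<eta> U" and im: "\<eta> ` U \<subseteq> E"
  obtains A :: "'a set" and V f where "subspace A" "dim A = k"
    "openin (top_of_set A) V" "continuous_on V f" "inj_on f V" "f \<in> V \<rightarrow> E"
    "\<eta> x \<in> f ` V" "f ` V \<subseteq> \<eta> ` U"
proof -
  have UN: "U \<subseteq> N" using U openin_imp_subset by blast
  then obtain A :: "'a set" and \<phi> \<psi> x' where A: "subspace A" "dim A = k" "x' \<noteq> x"
    and h: "homeomorphism (N - {x'}) A \<phi> \<psi>"
    using puncture[of x] U by blast
  obtain T where T: "open T" "U = N \<inter> T" using U unfolding openin_open by blast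
  have "(N - {x'}) \<inter> U = (N - {x'}) \<inter> T" using T by blast
  then have "openin (top_of_set (N - {x'})) ((N - {x'}) \<inter> U)"
    using T openin_open by metis
  moreover have "(N - {x'}) \<inter> U = U - {x'}" using UN by blast
  ultimately have V: "openin (top_of_set A) (\<phi> ` (U - {x'}))"
    using h homeomorphism_imp_open_map by metis
  have inv: "\<psi> (\<phi> u) = u" if "u \<in> U - {x'}" for u
    using h UN that unfolding homeomorphism_def by auto
  have eq: "\<psi> ` \<phi> ` (U - {x'}) = U - {x'}"
    using inv by (force simp: image_iff)
  have sub: "\<phi> ` (U - {x'}) \<subseteq> A"
    using h UN unfolding homeomorphism_def by auto
  have "continuous_on (\<phi> ` (U - {x'})) \<psi>"
    using h sub unfolding homeomorphism_def by (auto intro: continuous_on_subset)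
  then have "continuous_on (\<phi> ` (U - {x'})) (\<eta> \<circ> \<psi>)"
    by (rule continuous_on_compose) (use cont eq in \<open>auto intro: continuous_on_subset\<close>)
  moreover have "inj_on (\<eta> \<circ> \<psi>) (\<phi> ` (U - {x'}))"
    using inj inv unfolding inj_on_def by auto
  moreover have im': "(\<eta> \<circ> \<psi>) ` \<phi> ` (U - {x'}) = \<eta> ` (U - {x'})"
    using eq by (metis image_comp)
  moreover have "\<eta> x \<in> (\<eta> \<circ> \<psi>) ` \<phi> ` (U - {x'})" "(\<eta> \<circ> \<psi>) ` \<phi> ` (U - {x'}) \<subseteq> \<eta> ` U"
    unfolding im' using U A by auto
  moreover have "\<eta> \<circ> \<psi> \<in> \<phi> ` (U - {x'}) \<rightarrow> E"
    using im im' by blast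
  ultimately show ?thesis using that[OF A(1,2) V] by blast
qed

text \<open>Openness is checked near each image point, where invariance of domain applies as long as
  the source has at least the dimension of the target.\<close>

lemma openin_chart_image:
  fixes E :: "'b::euclidean_space set"
  assumes E: "subspace E" "k \<le> dim E" and D: "openin (top_of_set E) D"
    and "continuous_on D \<theta>" "inj_on \<theta> D" "\<theta> ` D \<subseteq> N"
  shows "openin (top_of_set N) (\<theta> ` D)"
proof (subst openin_subopen, intro ballI)
  fix x assume "x \<in> \<theta> ` D"
  then obtain y where y: "y \<in> D" "x = \<theta> y" by blast
  obtain A :: "'a set" and D' f where *: "subspace A" "dim A = k"
    "openin (top_of_set E) D'" "y \<in> D'" "D' \<subseteq> D" "continuous_on D' f" "inj_on f D'" "f \<in> D' \<rightarrow> A"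
    "openin (top_of_set A) (f ` D') \<Longrightarrow> openin (top_of_set N) (\<theta> ` D')"
    using pull_back_chart[OF D y(1) assms(4-6)] by metis
  have "openin (top_of_set A) (f ` D')"
    by (rule invariance_of_domain_subspaces[OF *(3) E(1) *(1) _ *(6,8,7)]) (use * E in simp)
  then show "\<exists>T. openin (top_of_set N) T \<and> x \<in> T \<and> T \<subseteq> \<theta> ` D"
    using * y by blast
qed

lemma openin_coordinates_image:
  fixes E :: "'b::euclidean_space set"
  assumes E: "subspace E" "dim E \<le> k" and U: "openin (top_of_set N) U"
    and "continuous_on U \<eta>" "inj_on \<eta> U" "\<eta> ` U \<subseteq> E"
  shows "openin (top_of_set E) (\<eta> ` U)"
proof (subst openin_subopen, intro ballI)
  fix y assume "y \<in> \<eta> ` U"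
  then obtain x where x: "x \<in> U" "y = \<eta> x" by blast
  obtain A :: "'a set" and V f where *: "subspace A" "dim A = k"
    "openin (top_of_set A) V" "continuous_on V f" "inj_on f V" "f \<in> V \<rightarrow> E"
    "\<eta> x \<in> f ` V" "f ` V \<subseteq> \<eta> ` U"
    using push_forward_coordinates[OF U x(1) assms(4-6)] by metis
  have "openin (top_of_set E) (f ` V)"
    by (rule invariance_of_domain_subspaces[OF *(3,1) E(1) _ *(4,6,5)]) (use * E in simp)
  then show "\<exists>T. openin (top_of_set E) T \<and> y \<in> T \<and> T \<subseteq> \<eta> ` U"
    using * x by blast
qed

lemma dim_le_of_chart:
  fixes E :: "'b::euclidean_space set"
  assumes E: "subspace E" and D: "openin (top_of_set E) D" "D \<noteq> {}"
    and "continuous_on D \<theta>" "inj_on \<theta> D" "\<theta> ` D \<subseteq> N"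
  shows "dim E \<le> k"
proof -
  obtain y where y: "y \<in> D" using D by blast
  obtain A :: "'a set" and D' f where *: "subspace A" "dim A = k"
    "openin (top_of_set E) D'" "y \<in> D'" "continuous_on D' f" "inj_on f D'" "f \<in> D' \<rightarrow> A"
    using pull_back_chart[OF D(1) y assms(4-6)] by metis
  then show ?thesis
    using invariance_of_dimension_subspaces[OF *(3) E *(1,5,7,6)] by auto
qed

lemma le_dim_of_coordinates:
  fixes E :: "'b::euclidean_space set"
  assumes E: "subspace E" and U: "openin (top_of_set N) U" "U \<noteq> {}"
    and "continuous_on U \<eta>" "inj_on \<eta> U" "\<eta> ` U \<subseteq> E"
  shows "k \<le> dim E"
proof -
  obtain x where x: "x \<in> U" using U by blast
  obtain A :: "'a set" and V f where *: "subspace A" "dim A = k"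
    "openin (top_of_set A) V" "continuous_on V f" "inj_on f V" "f \<in> V \<rightarrow> E" "\<eta> x \<in> f ` V"
    using push_forward_coordinates[OF U(1) x assms(4-6)] by metis
  then have "V \<noteq> {}" by blast
  then show ?thesis
    using invariance_of_dimension_subspaces[OF *(3,1) E *(4,6,5)] * by simp
qed

end

text \<open>The boundary of a \<open>d\<close>-simplex minus a point is homeomorphic to a subspace
  of dimension \<open>d - 1\<close>, and the homeomorphism with \<open>N\<close> transports this
  chart.\<close>

lemma punctured_euclidean_rel_frontier_simplex:
  fixes N \<Delta> :: "'a::euclidean_space set"
  assumes \<Delta>: "int d simplex \<Delta>" and h: "homeomorphism N (rel_frontier \<Delta>) f g"
  shows "punctured_euclidean N (d - 1)"
proof
  fix x assume x: "x \<in> N"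
  have poly: "polytope \<Delta>" using \<Delta> simplex_imp_polytope by blast
  have bc: "bounded \<Delta>" "convex \<Delta>"
    using poly polytope_imp_bounded polytope_imp_convex by auto
  have ad: "aff_dim \<Delta> = int d" using \<Delta> aff_dim_simplex by blast
  have fx: "f x \<in> rel_frontier \<Delta>" using h x unfolding homeomorphism_def by blast
  \<comment> \<open>A single point has empty relative frontier, which contradicts \<open>fx\<close>;
    so the natural number \<open>d - 1\<close> is not truncated.\<close>
  have d: "d \<ge> 1"
  proof (rule ccontr)
    assume "\<not> d \<ge> 1"
    then have "aff_dim \<Delta> = 0" using ad by simp
    then obtain a where "\<Delta> = {a}" using aff_dim_eq_0 by blast
    then show False using fx by (simp add: rel_frontier_def)
  qed
  \<comment> \<open>The relative frontier of a bounded set is never a single point, so there is a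
    point to delete that differs from \<open>f x\<close>.\<close>
  obtain z where z: "z \<in> rel_frontier \<Delta>" "z \<noteq> f x"
    using rel_frontier_not_sing[OF bc(1), of "f x"] fx by blast
  have "d - 1 \<le> dim (UNIV :: 'a set)"
    using aff_dim_le_DIM[of \<Delta>] ad by simp
  then obtain A :: "'a set" where A: "subspace A" "dim A = d - 1"
    using choose_subspace_of_subspace[of "d - 1" "UNIV :: 'a set"] by auto
  have "rel_frontier \<Delta> - {z} homeomorphic A"
    by (rule homeomorphic_punctured_sphere_affine_gen)
      (use bc z A ad d in \<open>auto simp: subspace_imp_affine aff_dim_subspace\<close>)
  then obtain \<phi> \<psi> where 1: "homeomorphism (rel_frontier \<Delta> - {z}) A \<phi> \<psi>"
    unfolding homeomorphic_def by blast
  have "homeomorphism (N - {g z}) (rel_frontier \<Delta> - {z}) f g"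
  proof (rule homeomorphism_of_subsets[OF h])
    have "inj_on f N" using h by (metis homeomorphism_def inj_on_inverseI)
    then have "f ` (N - {g z}) = f ` N - {f (g z)}"
      using h z by (subst inj_on_image_set_diff[of f N]) (auto simp: homeomorphism_def)
    then show "f ` (N - {g z}) = rel_frontier \<Delta> - {z}"
      using h z unfolding homeomorphism_def by auto
  qed auto
  then have "homeomorphism (N - {g z}) A (\<phi> \<circ> f) (g \<circ> \<psi>)"
    using homeomorphism_compose 1 by blast
  moreover have "g z \<in> N" "g z \<noteq> x"
    using h z unfolding homeomorphism_def by auto
  ultimately show "\<exists>(A::'a set) \<phi> \<psi> x'. subspace A \<and> dim A = d - 1 \<and> x' \<in> N \<and> x' \<noteq> x \<and>
      homeomorphism (N - {x'}) A \<phi> \<psi>"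
    using A by blast
qed

section \<open>Homogeneous and affine coordinates on the geometric realization\<close>

definition coordinate_subspace :: "'m::finite set \<Rightarrow> (real^'m) set" where
  "coordinate_subspace S = {y. \<forall>i. i \<notin> S \<longrightarrow> y $ i = 0}"

lemma subspace_coordinate_subspace: "subspace (coordinate_subspace S)"
  unfolding coordinate_subspace_def subspace_def by auto

lemma dim_coordinate_subspace: "dim (coordinate_subspace S) = card S"
  unfolding coordinate_subspace_def using dim_substandard_cart[of S, where 'a = real]
  by (simp add: dim_vec_eq)

text \<open>Central projection to the hyperplane of coordinate sum 1. It maps nonzero nonnegative
  vectors supported on a face into the simplex of that face.\<close>

definition normalized :: "real^'m::finite \<Rightarrow> real^'m" where
  "normalized z = (1 / (\<Sum>i\<in>UNIV. z $ i)) *\<^sub>R z"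

lemma normalized_nth: "normalized z $ i = z $ i / (\<Sum>i\<in>UNIV. z $ i)"
  by (simp add: normalized_def)

lemma sum_nth_pos:
  fixes z :: "real^'m::finite"
  assumes "\<forall>i. 0 \<le> z $ i" "0 < z $ t"
  shows "0 < (\<Sum>i\<in>UNIV. z $ i)"
  using assms by (intro sum_pos2[of _ t]) auto

definition pos_part :: "'m set \<Rightarrow> (real^'m::finite) set" where
  "pos_part S = {y. \<forall>i\<in>S. 0 < y $ i}"

lemma open_pos_part: "open (pos_part S)"
proof -
  have "pos_part S = (\<Inter>i\<in>S. {y. 0 < y $ i})" unfolding pos_part_def by auto
  moreover have "open {y::real^'a. 0 < y $ i}" for i
    by (intro open_Collect_less continuous_intros)
  ultimately show ?thesis by (auto intro!: open_INT)
qed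

text \<open>The passage from homogeneous to affine coordinates on the part where coordinate
  \<open>t\<close> does not vanish; it undoes \<open>normalized\<close> on vectors whose coordinate
  \<open>t\<close> is 1.\<close>

definition affine_coordinates :: "'m \<Rightarrow> 'm set \<Rightarrow> real^'m::finite \<Rightarrow> real^'m" where
  "affine_coordinates t S x = (\<chi> i. if i \<in> S then x $ i / x $ t else 0)"

lemma continuous_on_affine_coordinates:
  "(\<And>x. x \<in> U \<Longrightarrow> x $ t \<noteq> 0) \<Longrightarrow> continuous_on U (affine_coordinates t S)"
  unfolding affine_coordinates_def
proof (rule continuous_on_vec_lambda)
  fix i assume "\<And>x. x \<in> U \<Longrightarrow> x $ t \<noteq> 0"
  then show "continuous_on U (\<lambda>x. if i \<in> S then x $ i / x $ t else 0)"
    by (cases "i \<in> S") (auto intro!: continuous_intros)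
qed

lemma continuous_on_normalized:
  assumes "continuous_on D z" "\<And>y. y \<in> D \<Longrightarrow> 0 < (\<Sum>i\<in>UNIV. z y $ i)"
  shows "continuous_on D (\<lambda>y. normalized (z y))"
  unfolding normalized_def using assms by (intro continuous_intros) force+

lemma inj_on_normalized:
  assumes inj: "inj_on z D" and z: "\<And>y. y \<in> D \<Longrightarrow> z y $ t = 1" "\<And>y. y \<in> D \<Longrightarrow> 0 < (\<Sum>i\<in>UNIV. z y $ i)"
  shows "inj_on (\<lambda>y. normalized (z y)) D"
proof (rule inj_onI)
  fix x y assume x: "x \<in> D" and y: "y \<in> D" and eq: "normalized (z x) = normalized (z y)"
  have r: "normalized (z u) $ i / normalized (z u) $ t = z u $ i" if "u \<in> D" for u i
    using z[OF that] by (simp add: normalized_nth)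
  have "z x $ i = z y $ i" for i using r[OF x, of i] r[OF y, of i] eq by simp
  then show "x = y" using inj x y by (simp add: inj_on_def vec_eq_iff)
qed

locale complex_euclidean = punctured_euclidean "geometric_realization K" k
  for K :: "'m::finite set set" and k :: nat +
  assumes complex: "abstract_complex K"
begin

abbreviation "N \<equiv> geometric_realization K"

lemmas mem_N = mem_geometric_realization[OF complex]

lemma normalized_mem:
  assumes "\<forall>i. 0 \<le> z $ i" "0 < z $ t" "\<sigma> \<in> K" "{i. z $ i \<noteq> 0} \<subseteq> \<sigma>"
  shows "normalized z \<in> N"
proof -
  have s: "0 < (\<Sum>i\<in>UNIV. z $ i)" using sum_nth_pos assms by blast
  have "{i. normalized z $ i \<noteq> 0} \<subseteq> \<sigma>"
    using assms by (auto simp: normalized_nth)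
  then have "{i. normalized z $ i \<noteq> 0} \<in> K" using assms complex unfolding abstract_complex_def by blast
  then show ?thesis
    unfolding mem_N using s assms by (auto simp: normalized_nth simp flip: sum_divide_distrib)
qed

lemma inj_on_affine_coordinates:
  assumes "\<And>x. x \<in> U \<Longrightarrow> x \<in> N \<and> 0 < x $ t \<and> {i. x $ i \<noteq> 0} \<subseteq> insert t S" "t \<notin> S"
  shows "inj_on (affine_coordinates t S) U"
proof (rule inj_onI)
  fix x y assume x: "x \<in> U" and y: "y \<in> U" and eq: "affine_coordinates t S x = affine_coordinates t S y"
  have rat: "u $ i = u $ t * (if i = t then 1 else affine_coordinates t S u $ i)" if "u \<in> U" for u i
    using assms(1)[OF that] assms(2) by (auto simp: affine_coordinates_def)
  \<comment> \<open>Ratios determine a point up to scale, and the scale is fixed by the coordinate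
    sum 1: \<open>c\<close> is the sum of the ratios, so coordinate \<open>t\<close> is its
    inverse.\<close>
  define c where "c = (\<Sum>i\<in>UNIV. if i = t then 1 else affine_coordinates t S x $ i)"
  have sum: "u $ t * c = 1" if "u \<in> U" "affine_coordinates t S u = affine_coordinates t S x" for u
  proof -
    have "(\<Sum>i\<in>UNIV. u $ i) = u $ t * c"
      unfolding c_def sum_distrib_left
      by (rule sum.cong[OF refl], rule trans[OF rat[OF that(1)]]) (simp add: that(2))
    then show ?thesis using assms(1)[OF that(1)] mem_N by simp
  qed
  have "x $ t * c = y $ t * c" "c \<noteq> 0" using sum[OF x] sum[OF y] eq by auto
  then have "x $ t = y $ t" by simp
  then have "x $ i = y $ i" for i by (subst rat[OF x], subst rat[OF y]) (simp add: eq)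
  then show "x = y" by (simp add: vec_eq_iff)
qed

lemma openin_N_pos_part: "openin (top_of_set N) (N \<inter> pos_part S)"
  using open_pos_part openin_open_Int by blast

text \<open>By maximality, the points of \<open>N\<close> positive on \<open>\<sigma>\<close> are
  supported exactly on \<open>\<sigma>\<close>, so the open cell of \<open>\<sigma>\<close> is open
  in \<open>N\<close>. Comparing dimensions in both directions gives the size.\<close>

lemma card_maximal_face:
  assumes \<sigma>: "\<sigma> \<in> K" "\<sigma> \<noteq> {}" and max: "\<And>\<rho>. \<rho> \<in> K \<Longrightarrow> \<sigma> \<subseteq> \<rho> \<Longrightarrow> \<rho> = \<sigma>"
  shows "card \<sigma> = k + 1"
proof -
  obtain t where t: "t \<in> \<sigma>" using \<sigma> by blast
  \<comment> \<open>Coordinate \<open>t\<close> is scaled to 1, so the remaining vertices give the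
    dimension, one less than \<open>card \<sigma>\<close>.\<close>
  define S where "S = \<sigma> - {t}"
  have S: "t \<notin> S" "\<sigma> = insert t S" using t S_def by auto
  let ?E = "coordinate_subspace S"
  let ?D = "?E \<inter> pos_part S"
  define z where "z = (\<lambda>y::real^'m. \<chi> i. if i = t then 1 else y $ i)"
  have zt: "z y $ t = 1" for y unfolding z_def by simp
  have zin: "\<forall>i. 0 \<le> z y $ i" "{i. z y $ i \<noteq> 0} \<subseteq> \<sigma>" "normalized (z y) \<in> N" if "y \<in> ?D" for y
  proof -
    have "0 \<le> z y $ i" "z y $ i \<noteq> 0 \<Longrightarrow> i \<in> \<sigma>" for i
      using that S unfolding z_def coordinate_subspace_def pos_part_def
      by (cases "i \<in> S"; force simp: less_imp_le)+
    then show *: "\<forall>i. 0 \<le> z y $ i" "{i. z y $ i \<noteq> 0} \<subseteq> \<sigma>" by auto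
    show "normalized (z y) \<in> N"
      by (rule normalized_mem[where t = t, OF *(1) _ \<sigma>(1) *(2)]) (simp add: zt)
  qed
  have spos: "0 < (\<Sum>i\<in>UNIV. z y $ i)" if "y \<in> ?D" for y
    using sum_nth_pos[of "z y" t] zin[OF that] zt by simp
  have "dim ?E \<le> k"
  proof (rule dim_le_of_chart[OF subspace_coordinate_subspace])
    show "openin (top_of_set ?E) ?D" using open_pos_part openin_open_Int by blast
    have "(\<chi> i. if i \<in> S then 1 else 0) \<in> ?D"
      unfolding coordinate_subspace_def pos_part_def by auto
    then show "?D \<noteq> {}" by blast
    have "continuous_on ?D z"
      unfolding z_def
    proof (rule continuous_on_vec_lambda)
      show "continuous_on ?D (\<lambda>y. if i = t then 1 else y $ i)" for i
        by (cases "i = t") (auto intro!: continuous_intros)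
    qed
    then show "continuous_on ?D (\<lambda>y. normalized (z y))"
      using spos by (intro continuous_on_normalized) auto
    have "inj_on z ?D"
    proof (rule inj_onI)
      fix x y assume x: "x \<in> ?D" and y: "y \<in> ?D" and eq: "z x = z y"
      have "x $ i = y $ i" if "i \<noteq> t" for i
        using arg_cong[OF eq, of "\<lambda>u. u $ i"] that unfolding z_def by simp
      moreover have "x $ t = y $ t" using x y S unfolding coordinate_subspace_def by auto
      ultimately show "x = y" by (metis vec_eq_iff)
    qed
    then show "inj_on (\<lambda>y. normalized (z y)) ?D"
      using spos zt by (intro inj_on_normalized[where t = t]) auto
    show "(\<lambda>y. normalized (z y)) ` ?D \<subseteq> N" using zin by auto
  qed
  moreover have "k \<le> dim ?E"
  proof (rule le_dim_of_coordinates[OF subspace_coordinate_subspace openin_N_pos_part])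
    let ?U = "N \<inter> pos_part \<sigma>"
    have U: "x \<in> N \<and> 0 < x $ t \<and> {i. x $ i \<noteq> 0} \<subseteq> insert t S" if "x \<in> ?U" for x
    proof -
      have "\<sigma> \<subseteq> {i. x $ i \<noteq> 0}" using that unfolding pos_part_def by force
      then have "{i. x $ i \<noteq> 0} = \<sigma>" using max that mem_N by blast
      then show ?thesis using that t S unfolding pos_part_def by auto
    qed
    have "(\<chi> i. if i \<in> S then 1 else 0) \<in> ?D" (is "?y \<in> _")
      unfolding coordinate_subspace_def pos_part_def by auto
    then have "normalized (z ?y) \<in> N" "0 < (\<Sum>i\<in>UNIV. z ?y $ i)" using zin spos by blast+
    moreover have "z ?y $ i = 1" if "i \<in> \<sigma>" for i using that S unfolding z_def by auto
    ultimately have "normalized (z ?y) \<in> ?U"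
      unfolding pos_part_def by (simp add: normalized_nth)
    then show "?U \<noteq> {}" by blast
    show "continuous_on ?U (affine_coordinates t S)"
      using U by (intro continuous_on_affine_coordinates) force
    show "inj_on (affine_coordinates t S) ?U"
      using U S by (intro inj_on_affine_coordinates) auto
    show "affine_coordinates t S ` ?U \<subseteq> ?E"
      unfolding affine_coordinates_def coordinate_subspace_def by auto
  qed
  moreover have "card \<sigma> = card S + 1" using S by simp
  ultimately show ?thesis by (simp add: dim_coordinate_subspace)
qed

text \<open>A maximal face above a nonempty face is a facet by the dimension count. The vertex
  \<open>v\<close> takes care of the empty face.\<close>

lemma face_le_facet:
  assumes "\<sigma> \<in> K" "{v} \<in> K"
  obtains \<rho> where "\<rho> \<in> K" "\<sigma> \<subseteq> \<rho>" "card \<rho> = k + 1"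
proof -
  have ex: "\<exists>\<rho>\<in>K. \<sigma>' \<subseteq> \<rho> \<and> card \<rho> = k + 1" if ne: "\<sigma>' \<in> K" "\<sigma>' \<noteq> {}" for \<sigma>'
  proof -
    have "finite K" by simp
    then obtain \<rho> where \<rho>: "\<rho> \<in> K" "\<sigma>' \<subseteq> \<rho>" "\<forall>\<pi>\<in>K. \<rho> \<subseteq> \<pi> \<longrightarrow> \<rho> = \<pi>"
      using finite_has_maximal2[of K \<sigma>'] ne by blast
    then have "card \<rho> = k + 1" using ne by (intro card_maximal_face) auto
    then show ?thesis using \<rho> by blast
  qed
  show ?thesis
  proof (cases "\<sigma> = {}")
    case True
    then show ?thesis using ex[of "{v}"] assms that by blast
  next
    case False
    then show ?thesis using ex[of \<sigma>] assms that by blast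
  qed
qed

lemma segment_to_vertex_mem:
  fixes x :: "real^'m"
  assumes "x \<in> N" "{i. x $ i \<noteq> 0} = \<tau>" "insert u \<tau> \<in> K" "0 < e" "e < 1"
  shows "x + e *\<^sub>R (axis u 1 - x) \<in> N"
proof -
  let ?p = "x + e *\<^sub>R (axis u 1 - x)"
  have nn: "\<forall>i. 0 \<le> x $ i" and s: "(\<Sum>i\<in>UNIV. x $ i) = 1" using assms mem_N by auto
  have p: "?p $ i = (1 - e) * x $ i + e * (if i = u then 1 else 0)" for i
    by (simp add: axis_def algebra_simps)
  have "(\<Sum>i\<in>UNIV. ?p $ i) = 1"
    unfolding p sum.distrib sum_distrib_left[symmetric] s by simp
  moreover have "\<forall>i. 0 \<le> ?p $ i" unfolding p using nn assms by simp
  moreover have "{i. ?p $ i \<noteq> 0} \<subseteq> insert u \<tau>" using assms(2) unfolding p by auto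
  ultimately show ?thesis
    using mem_N assms(3) complex unfolding abstract_complex_def by blast
qed

lemma card_face_le:
  assumes "\<rho> \<in> K"
  shows "card \<rho> \<le> k + 1"
proof (cases "\<rho> = {}")
  case False
  then obtain v where "v \<in> \<rho>" by blast
  then have "{v} \<in> K" using assms complex unfolding abstract_complex_def by blast
  then obtain \<pi> where "\<rho> \<subseteq> \<pi>" "card \<pi> = k + 1"
    using face_le_facet[OF assms] by metis
  then show ?thesis by (metis card_mono finite)
qed simp

lemma barycenter_mem:
  assumes "\<tau> \<in> K" "\<tau> \<noteq> {}"
  obtains x where "x \<in> N" "{i. x $ i \<noteq> 0} = \<tau>" "\<And>i j. i \<in> \<tau> \<Longrightarrow> j \<in> \<tau> \<Longrightarrow> x $ i = x $ j"
proof -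
  let ?x = "(\<chi> i. if i \<in> \<tau> then 1 / card \<tau> else 0) :: real^'m"
  have c: "card \<tau> > 0" using assms by (simp add: card_gt_0_iff)
  have "{i. ?x $ i \<noteq> 0} = \<tau>" using c by auto
  moreover have "(\<Sum>i\<in>UNIV. ?x $ i) = 1"
    using c assms(2) by (simp add: sum.If_cases)
  ultimately show ?thesis using that[of ?x] assms mem_N by auto
qed

text \<open>By invariance of domain two of the facets at a ridge already cover a neighbourhood of its
  interior points, and a single one cannot do so.\<close>

lemma ridge_le_two:
  assumes \<tau>: "\<tau> \<in> K" "card \<tau> = k" "\<tau> \<noteq> {}"
    and uvw: "distinct [u, v, w]" "u \<notin> \<tau>" "v \<notin> \<tau>" "w \<notin> \<tau>"
      "insert u \<tau> \<in> K" "insert v \<tau> \<in> K" "insert w \<tau> \<in> K"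
  shows False
proof -
  obtain t where t: "t \<in> \<tau>" using \<tau> by blast
  define S where "S = insert v (\<tau> - {t})"
  have "Suc (card (\<tau> - {t})) = k" using t \<tau> by (metis card_Suc_Diff1 finite)
  then have S: "t \<notin> S" "card S = k" "w \<notin> S" "u \<notin> S" "t \<noteq> v" "t \<noteq> w" "t \<noteq> u"
    using t uvw unfolding S_def by auto
  let ?E = "coordinate_subspace S"
  let ?D = "?E \<inter> pos_part (\<tau> - {t})"
  \<comment> \<open>Folding: coordinate \<open>v\<close> of \<open>y\<close> may have either sign;
    its positive part is kept at \<open>v\<close> and its negative part moves to \<open>w\<close>.
    So a flat neighbourhood of the ridge is bent onto the two facets.\<close>
  define z where "z = (\<lambda>y::real^'m. \<chi> i. if i = t then 1 else if i = v then max (y $ v) 0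
    else if i = w then max (- y $ v) 0 else y $ i)"
  have zt: "z y $ t = 1" for y unfolding z_def by simp
  have nn: "\<forall>i. 0 \<le> z y $ i" and zN: "normalized (z y) \<in> N" if "y \<in> ?D" for y
  proof -
    have "0 \<le> z y $ i" for i
      using that unfolding z_def coordinate_subspace_def pos_part_def S_def
      by (cases "i \<in> \<tau>"; force simp: less_imp_le)
    then show nn: "\<forall>i. 0 \<le> z y $ i" by blast
    define x where "x = (if 0 \<le> y $ v then v else w)"
    have "z y $ i \<noteq> 0 \<Longrightarrow> i \<in> insert x \<tau>" for i
      using that uvw t unfolding z_def coordinate_subspace_def pos_part_def S_def x_def
      by (auto split: if_splits)
    then have "{i. z y $ i \<noteq> 0} \<subseteq> insert x \<tau>" by blast
    moreover have "insert x \<tau> \<in> K" using uvw x_def by auto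
    ultimately show "normalized (z y) \<in> N"
      using normalized_mem[where t = t, OF nn] zt by auto
  qed
  have spos: "0 < (\<Sum>i\<in>UNIV. z y $ i)" if "y \<in> ?D" for y
    using sum_nth_pos[of "z y" t] nn[OF that] zt by simp
  have op: "openin (top_of_set N) ((\<lambda>y. normalized (z y)) ` ?D)"
  proof (rule openin_chart_image[OF subspace_coordinate_subspace])
    show "k \<le> dim ?E" using S by (simp add: dim_coordinate_subspace)
    show "openin (top_of_set ?E) ?D" using open_pos_part openin_open_Int by blast
    have "continuous_on ?D z"
      unfolding z_def
    proof (rule continuous_on_vec_lambda)
      show "continuous_on ?D (\<lambda>y. if i = t then 1 else if i = v then max (y $ v) 0
          else if i = w then max (- y $ v) 0 else y $ i)" for i
        by (cases "i = t"; cases "i = v"; cases "i = w") (auto intro!: continuous_intros)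
    qed
    then show "continuous_on ?D (\<lambda>y. normalized (z y))"
      using spos by (intro continuous_on_normalized) auto
    have "inj_on z ?D"
    proof (rule inj_onI)
      fix x y assume x: "x \<in> ?D" and y: "y \<in> ?D" and eq: "z x = z y"
      have eq': "z x $ i = z y $ i" for i using eq by simp
      have "max (x $ v) 0 = max (y $ v) 0" "max (- x $ v) 0 = max (- y $ v) 0"
        using eq'[of v] eq'[of w] S uvw unfolding z_def by auto
      then have "x $ v = y $ v" by (auto simp: max_def split: if_splits)
      moreover have "x $ i = y $ i" if "i \<noteq> t" "i \<noteq> v" "i \<noteq> w" for i
        using eq'[of i] that unfolding z_def by simp
      moreover have "x $ t = y $ t" "x $ w = y $ w"
        using x y S unfolding coordinate_subspace_def by auto
      ultimately show "x = y" by (metis vec_eq_iff)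
    qed
    then show "inj_on (\<lambda>y. normalized (z y)) ?D"
      using spos zt by (intro inj_on_normalized[where t = t]) auto
    show "(\<lambda>y. normalized (z y)) ` ?D \<subseteq> N" using zN by auto
  qed
  obtain x0 where x0: "x0 \<in> N" "{i. x0 $ i \<noteq> 0} = \<tau>"
      "\<And>i j. i \<in> \<tau> \<Longrightarrow> j \<in> \<tau> \<Longrightarrow> x0 $ i = x0 $ j"
    using barycenter_mem[OF \<tau>(1,3)] by blast
  define y0 where "y0 = ((\<chi> i. if i \<in> \<tau> - {t} then 1 else 0) :: real^'m)"
  have y0: "y0 \<in> ?D"
    unfolding y0_def coordinate_subspace_def pos_part_def S_def by auto
  have "normalized (z y0) = x0"
  proof -
    have z0: "z y0 $ i = (if i \<in> \<tau> then 1 else 0)" for i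
      using t uvw S unfolding z_def y0_def by auto
    have "x0 $ i = x0 $ t * z y0 $ i" for i
      unfolding z0 using x0(2) x0(3)[OF _ t] by auto
    moreover from this have "(\<Sum>i\<in>UNIV. x0 $ i) = x0 $ t * (\<Sum>i\<in>UNIV. z y0 $ i)"
      unfolding sum_distrib_left by (rule sum.cong[OF refl])
    then have "x0 $ t * (\<Sum>i\<in>UNIV. z y0 $ i) = 1" using x0(1) mem_N by simp
    then have "x0 $ t = 1 / (\<Sum>i\<in>UNIV. z y0 $ i)" using spos[OF y0] by (simp add: field_simps)
    ultimately show ?thesis by (simp add: vec_eq_iff normalized_nth)
  qed
  then have "x0 \<in> (\<lambda>y. normalized (z y)) ` ?D" using y0 by blast
  then obtain r where r: "0 < r" "\<And>x. x \<in> N \<Longrightarrow> dist x x0 < r \<Longrightarrow> x \<in> (\<lambda>y. normalized (z y)) ` ?D"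
    using op unfolding openin_euclidean_subtopology_iff by (metis dist_commute)
  \<comment> \<open>A step towards the third vertex \<open>u\<close>, short enough to stay in the
    \<open>r\<close>-ball and strictly inside the segment.\<close>
  define e where "e = min (1/2) (r / (2 * (1 + norm (axis u 1 - x0))))"
  have "0 < 2 * (1 + norm (axis u 1 - x0))" by (intro mult_pos_pos add_pos_nonneg) auto
  then have "0 < e" unfolding e_def using r(1) by simp
  moreover have "e \<le> 1/2" unfolding e_def by (rule min.cobounded1)
  ultimately have e: "0 < e" "e < 1" by auto
  let ?p = "x0 + e *\<^sub>R (axis u 1 - x0)"
  have "e * norm (axis u 1 - x0) \<le> r / (2 * (1 + norm (axis u 1 - x0))) * norm (axis u 1 - x0)"
    unfolding e_def by (intro mult_right_mono) auto
  also have "\<dots> < r"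
  proof -
    have "norm (axis u 1 - x0) / (2 * (1 + norm (axis u 1 - x0))) < 1"
      by (subst divide_less_eq_1_pos) (auto intro!: add_pos_nonneg simp: add_strict_increasing)
    then have "r * (norm (axis u 1 - x0) / (2 * (1 + norm (axis u 1 - x0)))) < r * 1"
      using r(1) by (intro mult_strict_left_mono)
    then show ?thesis by simp
  qed
  finally have "dist ?p x0 < r" using e by (simp add: dist_norm)
  moreover have "?p \<in> N" using segment_to_vertex_mem[OF x0(1,2) uvw(5) e] .
  ultimately obtain y where y: "y \<in> ?D" "?p = normalized (z y)" using r(2) by blast
  \<comment> \<open>The shifted point has coordinate \<open>e\<close> at \<open>u\<close>, whereas
    everything in the image of the folded chart vanishes there.\<close>
  have "x0 $ u = 0" using x0(2) uvw by blast
  then have "?p $ u = e" by (simp add: axis_def)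
  moreover have "normalized (z y) $ u = 0"
    using y S uvw unfolding normalized_nth z_def coordinate_subspace_def by auto
  ultimately show False using y e by simp
qed

lemma ridge_ge_two:
  assumes \<tau>: "\<tau> \<in> K" "card \<tau> = k" "\<tau> \<noteq> {}"
    and v: "v \<notin> \<tau>" and only: "\<And>w. w \<notin> \<tau> \<Longrightarrow> insert w \<tau> \<in> K \<Longrightarrow> w = v"
  shows False
proof -
  obtain t where t: "t \<in> \<tau>" using \<tau> by blast
  define S where "S = insert v (\<tau> - {t})"
  have "Suc (card (\<tau> - {t})) = k" using t \<tau> by (metis card_Suc_Diff1 finite)
  then have S: "t \<notin> S" "card S = k" "v \<in> S" "insert t S = insert v \<tau>"
    using t v unfolding S_def by auto
  let ?E = "coordinate_subspace S"
  let ?U = "N \<inter> pos_part \<tau>"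
  have U: "x \<in> N \<and> 0 < x $ t \<and> {i. x $ i \<noteq> 0} \<subseteq> insert t S" if x: "x \<in> ?U" for x
  proof -
    have sub: "\<tau> \<subseteq> {i. x $ i \<noteq> 0}" using x unfolding pos_part_def by force
    have suppK: "{i. x $ i \<noteq> 0} \<in> K" using x mem_N by blast
    have "w = v" if "x $ w \<noteq> 0" "w \<notin> \<tau>" for w
    proof -
      have "insert w \<tau> \<subseteq> {i. x $ i \<noteq> 0}" using that sub by blast
      then have "insert w \<tau> \<in> K" using suppK complex unfolding abstract_complex_def by blast
      then show ?thesis using only that by blast
    qed
    then show ?thesis using x t S unfolding pos_part_def by auto
  qed
  have op: "openin (top_of_set ?E) (affine_coordinates t S ` ?U)"
  proof (rule openin_coordinates_image[OF subspace_coordinate_subspace _ openin_N_pos_part])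
    show "dim ?E \<le> k" using S by (simp add: dim_coordinate_subspace)
    show "continuous_on ?U (affine_coordinates t S)"
      using U by (intro continuous_on_affine_coordinates) force
    show "inj_on (affine_coordinates t S) ?U"
      using U S by (intro inj_on_affine_coordinates) auto
    show "affine_coordinates t S ` ?U \<subseteq> ?E"
      unfolding affine_coordinates_def coordinate_subspace_def by auto
  qed
  obtain x0 where x0: "x0 \<in> N" "{i. x0 $ i \<noteq> 0} = \<tau>"
    by (rule barycenter_mem[OF \<tau>(1,3)])
  have "\<forall>i. 0 \<le> x0 $ i" using x0 mem_N by blast
  moreover have "x0 $ i \<noteq> 0" if "i \<in> \<tau>" for i using that x0(2) by blast
  ultimately have "x0 \<in> ?U" using x0(1) unfolding pos_part_def by (simp add: less_le)
  then have "affine_coordinates t S x0 \<in> affine_coordinates t S ` ?U" (is "?y \<in> _") by blast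
  then obtain r where r: "0 < r" "\<And>y. y \<in> ?E \<Longrightarrow> dist y ?y < r \<Longrightarrow> y \<in> affine_coordinates t S ` ?U"
    using op unfolding openin_euclidean_subtopology_iff by (metis dist_commute)
  \<comment> \<open>With a single facet the ridge is the wall where coordinate \<open>v\<close> is
    0. An open image would continue past the wall, but points of \<open>N\<close> have nonnegative
    coordinates.\<close>
  let ?z = "?y - (r / 2) *\<^sub>R axis v 1"
  have "?z \<in> ?E" using S unfolding affine_coordinates_def coordinate_subspace_def by (auto simp: axis_def)
  moreover have "dist ?z ?y < r" using r by (simp add: dist_norm)
  ultimately obtain x where x: "x \<in> ?U" "?z = affine_coordinates t S x" using r(2) by blast
  have "x0 $ v = 0" using x0(2) v by blast
  then have "?z $ v = - r / 2" using S unfolding affine_coordinates_def by (simp add: axis_def)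
  moreover have "affine_coordinates t S x $ v \<ge> 0"
    using S U[OF x(1)] mem_N unfolding affine_coordinates_def by auto
  ultimately show False using x r by simp
qed

text \<open>The case of the empty ridge, where there is no vertex \<open>t\<close> to normalise at:
  the vertices are then the points of \<open>N\<close>, and a punctured 0-sphere is one
  point.\<close>

lemma card_zero_dim:
  assumes "k = 0" "{v} \<in> K"
  shows "card {w. {w} \<in> K} = 2"
proof -
  have mem: "x \<in> N \<longleftrightarrow> (\<exists>w. {w} \<in> K \<and> x = axis w 1)" for x
  proof
    assume x: "x \<in> N"
    let ?s = "{i. x $ i \<noteq> 0}"
    have s: "(\<Sum>i\<in>UNIV. x $ i) = 1" "?s \<in> K" using x mem_N by auto
    have "?s \<noteq> {}"
    proof
      assume "?s = {}"
      then have "x $ i = 0" for i by blast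
      then show False using s(1) by simp
    qed
    moreover have "card ?s \<le> 1" using card_face_le[OF s(2)] assms by simp
    ultimately have "card ?s = 1" by (simp add: card_gt_0_iff le_antisym Suc_le_eq del: Collect_empty_eq)
    then obtain w where w: "?s = {w}" by (rule card_1_singletonE)
    then have z: "x $ i = 0" if "i \<noteq> w" for i using that by blast
    have "(\<Sum>i\<in>UNIV. x $ i) = x $ w"
      using z by (subst sum.remove[of _ w]) auto
    then have "x = axis w 1" using s z by (auto simp: vec_eq_iff axis_def)
    then show "\<exists>w. {w} \<in> K \<and> x = axis w 1" using s w by auto
  next
    assume "\<exists>w. {w} \<in> K \<and> x = axis w 1"
    then obtain w where w: "{w} \<in> K" "x = axis w 1" by blast
    have "{i. x $ i \<noteq> 0} = {w}" using w by (auto simp: axis_def)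
    then show "x \<in> N" using w unfolding mem_N by (auto simp: axis_def)
  qed
  then have N: "N = (\<lambda>w. axis w 1) ` {w. {w} \<in> K}" by blast
  have "axis v 1 \<in> N" using mem assms by blast
  then obtain A :: "(real^'m) set" and \<phi> \<psi> x' where A: "subspace A" "dim A = 0" "x' \<in> N"
    "homeomorphism (N - {x'}) A \<phi> \<psi>"
    using puncture assms by metis
  then have "A = {0}" by (metis dim_eq_0 subspace_0 subset_singletonD empty_iff)
  then have "N - {x'} = {\<psi> 0}" using A unfolding homeomorphism_def by auto
  then have "N = {x', \<psi> 0}" "\<psi> 0 \<noteq> x'" using A by blast+
  then have "card N = 2" by simp
  moreover have "inj (\<lambda>w. axis w (1::real) :: real^'m)" by (auto intro!: injI simp: axis_eq_axis)
  ultimately show ?thesis unfolding N by (metis card_image inj_on_subset subset_UNIV)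
qed

lemma card_ridge:
  assumes \<tau>: "\<tau> \<in> K" "card \<tau> = k" and ver: "{x} \<in> K"
  shows "card {v. v \<notin> \<tau> \<and> insert v \<tau> \<in> K} = 2" (is "card ?L = 2")
proof (cases "\<tau> = {}")
  case True
  then show ?thesis using card_zero_dim[OF _ ver] \<tau> by simp
next
  case False
  obtain \<rho> where \<rho>: "\<rho> \<in> K" "\<tau> \<subseteq> \<rho>" "card \<rho> = k + 1"
    using face_le_facet[OF \<tau>(1) ver] .
  then have "\<rho> \<noteq> \<tau>" using \<tau> by auto
  then obtain v where v: "v \<in> \<rho>" "v \<notin> \<tau>" using \<rho> by blast
  then have "insert v \<tau> \<subseteq> \<rho>" using \<rho> by blast
  then have "insert v \<tau> \<in> K" using \<rho> complex unfolding abstract_complex_def by blast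
  then have v': "v \<in> ?L" using v by blast
  then obtain w where w: "w \<in> ?L" "w \<noteq> v" using ridge_ge_two[OF \<tau> False v(2)] by blast
  have "?L = {v, w}"
  proof (rule ccontr)
    assume "?L \<noteq> {v, w}"
    then obtain u where "u \<in> ?L" "u \<noteq> v" "u \<noteq> w" using v' w by blast
    then show False using ridge_le_two[OF \<tau> False, of u v w] v' w by auto
  qed
  then show ?thesis using w by simp
qed

end

section \<open>Linear algebra over the field with two elements\<close>

text \<open>Vectors of \<open>(\<int>/2)\<^sup>4\<close> are coded by the numbers below 16, with \<^term>\<open>xor\<close> as addition.\<close>

definition dot :: "nat \<Rightarrow> nat \<Rightarrow> bool" where
  "dot w v \<longleftrightarrow> ((bit w 0 \<and> bit v 0) \<noteq> (bit w 1 \<and> bit v 1)) \<noteq> ((bit w 2 \<and> bit v 2) \<noteq> (bit w 3 \<and> bit v 3))"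

lemma dot_xor_left: "dot (xor w w') v \<longleftrightarrow> dot w v \<noteq> dot w' v"
  unfolding dot_def bit_xor_iff by argo

lemma dot_xor_right: "dot w (xor v v') \<longleftrightarrow> dot w v \<noteq> dot w v'"
  unfolding dot_def bit_xor_iff by argo

lemma xor_less_16: "xor a b < 16" if "a < 16" "b < 16" for a b :: nat
proof -
  have "x < 16 \<longleftrightarrow> take_bit 4 x = x" for x :: nat by (simp add: take_bit_nat_eq_self_iff)
  then show ?thesis using that by (simp add: take_bit_xor)
qed

lemma less_16_cases:
  fixes v :: nat
  assumes "v < 16"
  shows "v \<in> {0,1,2,3,4,5,6,7,8,9,10,11,12,13,14,15}"
  using assms by (simp add: numeral_eq_Suc less_Suc_eq)

lemma xor_eq_0_iff_nat: "xor a b = 0 \<longleftrightarrow> a = b" for a b :: nat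
proof
  assume "xor a b = 0"
  then have "xor (xor a b) b = b" by simp
  then show "a = b" by (simp add: xor.assoc)
qed simp

lemma xor_eq_iff_nat: "a = xor c d \<longleftrightarrow> xor a c = d" for a c d :: nat
proof -
  have "a = xor c d \<longleftrightarrow> xor a (xor c d) = 0" by (rule xor_eq_0_iff_nat[symmetric])
  also have "\<dots> \<longleftrightarrow> xor (xor a c) d = 0" by (simp only: xor.assoc)
  finally show ?thesis by (simp only: xor_eq_0_iff_nat)
qed

text \<open>Pigeonhole: 16 vectors \<open>w\<close> have only 8 possible value triples, and the sum
  of two vectors with equal values annihilates all three.\<close>

lemma annihilator_of_three: "\<exists>w<16. w \<noteq> 0 \<and> \<not> dot w x \<and> \<not> dot w y \<and> \<not> dot w z"
proof -
  let ?f = "\<lambda>w. (dot w x, dot w y, dot w z)"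
  have "card (?f ` {..<16::nat}) \<le> card (UNIV :: (bool \<times> bool \<times> bool) set)"
    by (intro card_mono) auto
  also have "\<dots> = 8" by (simp flip: UNIV_Times_UNIV add: card_cartesian_product card_UNIV_bool)
  finally have "\<not> inj_on ?f {..<16}" using card_image[of ?f "{..<16}"] by auto
  then obtain u v where uv: "u < 16" "v < 16" "u \<noteq> v" "?f u = ?f v"
    unfolding inj_on_def by auto
  then have "\<not> dot (xor u v) x" "\<not> dot (xor u v) y" "\<not> dot (xor u v) z"
    by (auto simp: dot_xor_left)
  then show ?thesis using uv xor_less_16 xor_eq_0_iff_nat by metis
qed

text \<open>Every functional is represented by a vector, which supplies transposes of linear
  maps.\<close>

lemma additive_eq_dot:
  assumes add: "\<And>x y. x < 16 \<Longrightarrow> y < 16 \<Longrightarrow> f (xor x y) \<longleftrightarrow> f x \<noteq> f y"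
  obtains w where "w < 16" "\<And>v. v < 16 \<Longrightarrow> f v \<longleftrightarrow> dot w v"
proof -
  \<comment> \<open>The bits of \<open>w\<close> are the values of \<open>f\<close> on the standard
    basis 1, 2, 4, 8.\<close>
  define w :: nat where "w = (if f 1 then 1 else 0) + (if f 2 then 2 else 0) + (if f 4 then 4 else 0) + (if f 8 then 8 else 0)"
  have bits: "bit w 0 = f 1" "bit w 1 = f 2" "bit w 2 = f 4" "bit w 3 = f 8"
    unfolding w_def by (auto simp: bit_iff_odd)
  have "w < 16" unfolding w_def by auto
  have f0: "\<not> f 0" using add[of 0 0] by simp
  have f3: "f 3 = (f 1 \<noteq> f 2)" and f5: "f 5 = (f 1 \<noteq> f 4)" and f6: "f 6 = (f 2 \<noteq> f 4)"
    using add[of 1 2] add[of 1 4] add[of 2 4] by simp_all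
  have f7: "f 7 = (f 3 \<noteq> f 4)" using add[of 3 4] by simp
  have f8: "f 9 = (f 1 \<noteq> f 8)" "f 10 = (f 2 \<noteq> f 8)" "f 11 = (f 3 \<noteq> f 8)" "f 12 = (f 4 \<noteq> f 8)"
    "f 13 = (f 5 \<noteq> f 8)" "f 14 = (f 6 \<noteq> f 8)" "f 15 = (f 7 \<noteq> f 8)"
    using add[of 1 8] add[of 2 8] add[of 3 8] add[of 4 8] add[of 5 8] add[of 6 8] add[of 7 8] by simp_all
  have "f v \<longleftrightarrow> dot w v" if "v < 16" for v
    using less_16_cases[OF that] unfolding dot_def bits insert_iff
    by (elim disjE; simp add: bit_iff_odd f0 f8 f7 f3 f5 f6; blast)
  then show ?thesis using that \<open>w < 16\<close> by blast
qed

section \<open>The general linear group of rank four over the field with two elements\<close>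

definition linear_auto :: "(nat \<Rightarrow> nat) \<Rightarrow> bool" where
  "linear_auto M \<longleftrightarrow> bij_betw M {..<16} {..<16} \<and> (\<forall>x<16. \<forall>y<16. M (xor x y) = xor (M x) (M y))"

lemma linear_autoD:
  assumes "linear_auto M"
  shows "x < 16 \<Longrightarrow> M x < 16" "x < 16 \<Longrightarrow> y < 16 \<Longrightarrow> M (xor x y) = xor (M x) (M y)"
    "x < 16 \<Longrightarrow> y < 16 \<Longrightarrow> M x = M y \<longleftrightarrow> x = y"
  using assms unfolding linear_auto_def bij_betw_def inj_on_def by auto

lemma linear_auto_0: "linear_auto M \<Longrightarrow> M 0 = 0"
  using linear_autoD(2)[of M 0 0] by simp

lemma linear_auto_comp:
  assumes "linear_auto M" "linear_auto N"
  shows "linear_auto (M \<circ> N)"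
  using assms linear_autoD(1)[OF assms(2)] unfolding linear_auto_def
  by (auto intro: bij_betw_trans)

lemma linear_auto_inv:
  assumes M: "linear_auto M"
  shows "linear_auto (inv_into {..<16} M)" (is "linear_auto ?N")
    "x < 16 \<Longrightarrow> M (inv_into {..<16} M x) = x" "x < 16 \<Longrightarrow> inv_into {..<16} M (M x) = x"
proof -
  have bij: "bij_betw M {..<16} {..<16}" using M unfolding linear_auto_def by blast
  show 1: "M (?N x) = x" if "x < 16" for x
    using bij that by (simp add: bij_betw_inv_into_right)
  show 2: "?N (M x) = x" if "x < 16" for x
    using bij that by (simp add: bij_betw_inv_into_left)
  have bN: "bij_betw ?N {..<16} {..<16}" using bij bij_betw_inv_into by blast
  then have lt: "?N x < 16" if "x < 16" for x using that unfolding bij_betw_def by auto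
  have "?N (xor x y) = xor (?N x) (?N y)" if "x < 16" "y < 16" for x y
    using 1 2 lt that linear_autoD(2)[OF M, of "?N x" "?N y"] xor_less_16 by metis
  then show "linear_auto ?N" using bN unfolding linear_auto_def by blast
qed

text \<open>Here \<open>w'\<close> is the transpose of \<open>N\<close> applied to \<open>w\<close>.
  It is used to see that recoding all rows by an automorphism leaves the column space
  unchanged.\<close>

lemma dot_linear_auto:
  assumes N: "linear_auto N" and w: "w < 16"
  obtains w' where "w' < 16" "\<And>v. v < 16 \<Longrightarrow> dot w (N v) \<longleftrightarrow> dot w' v"
proof (rule additive_eq_dot)
  show "dot w (N (xor x y)) \<longleftrightarrow> dot w (N x) \<noteq> dot w (N y)" if "x < 16" "y < 16" for x y
    by (simp only: linear_autoD(2)[OF N that] dot_xor_right)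
qed (erule that, blast)

text \<open>The endomorphism taking 1, 2, 4, 8 to \<open>a\<close>, \<open>b\<close>,
  \<open>c\<close>, \<open>d\<close>.\<close>

definition linear_extension :: "nat \<Rightarrow> nat \<Rightarrow> nat \<Rightarrow> nat \<Rightarrow> nat \<Rightarrow> nat" where
  "linear_extension a b c d x = xor (xor (if bit x 0 then a else 0) (if bit x 1 then b else 0))
     (xor (if bit x 2 then c else 0) (if bit x 3 then d else 0))"

text \<open>For four distinct vectors this is linear independence.\<close>

definition independent4 :: "nat set \<Rightarrow> bool" where
  "independent4 X \<longleftrightarrow> X \<subseteq> {0<..<16} \<and> (\<forall>x\<in>X. \<forall>y\<in>X. \<forall>z\<in>X. xor x y \<noteq> z) \<and>
     (\<forall>x\<in>X. \<forall>y\<in>X. \<forall>z\<in>X. \<forall>u\<in>X. distinct [x, y, z, u] \<longrightarrow> xor x y \<noteq> xor z u)"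

text \<open>For distinct nonzero vectors only relations with three or four terms are possible. As
  equations between numerals they are decided by simplification.\<close>

definition dependent4 :: "nat \<Rightarrow> nat \<Rightarrow> nat \<Rightarrow> nat \<Rightarrow> bool" where
  "dependent4 a b c d \<longleftrightarrow> xor a b = c \<or> xor a b = d \<or> xor a c = d \<or> xor b c = d \<or> xor a b = xor c d"

definition basis4 :: "nat \<Rightarrow> nat \<Rightarrow> nat \<Rightarrow> nat \<Rightarrow> bool" where
  "basis4 a b c d \<longleftrightarrow> a < 16 \<and> b < 16 \<and> c < 16 \<and> d < 16 \<and> a \<noteq> 0 \<and> b \<noteq> 0 \<and> c \<noteq> 0 \<and> d \<noteq> 0 \<and>
     distinct [a, b, c, d] \<and> \<not> dependent4 a b c d"

lemma linear_extension_linear_auto: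
  assumes "basis4 a b c d"
  shows "linear_auto (linear_extension a b c d)" (is "linear_auto ?M")
proof -
  have lt: "a < 16" "b < 16" "c < 16" "d < 16" and nz: "a \<noteq> 0" "b \<noteq> 0" "c \<noteq> 0" "d \<noteq> 0"
    and dist: "distinct [a, b, c, d]"
    and t: "xor a b \<noteq> c" "xor a b \<noteq> d" "xor a c \<noteq> d" "xor b c \<noteq> d" "xor a b \<noteq> xor c d"
    using assms unfolding basis4_def dependent4_def by auto
  have M: "?M x < 16" for x
    unfolding linear_extension_def using lt by (auto intro!: xor_less_16)
  have if_xor: "(if p \<noteq> q then e else 0) = xor (if p then e else 0) (if q then e else 0)" for p q and e :: nat
    by auto
  have add: "?M (xor x y) = xor (?M x) (?M y)" for x y
    unfolding linear_extension_def bit_xor_iff if_xor by (simp only: xor.assoc xor.commute xor.left_commute)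
  \<comment> \<open>These are all sums of at least two of the four vectors, hence, with the vectors
    themselves, all images of nonzero vectors; none of them vanishes.\<close>
  have sums: "xor a b \<noteq> 0" "xor a c \<noteq> 0" "xor a d \<noteq> 0" "xor b c \<noteq> 0" "xor b d \<noteq> 0" "xor c d \<noteq> 0"
    "xor (xor a b) c \<noteq> 0" "xor (xor a b) d \<noteq> 0" "xor a (xor c d) \<noteq> 0" "xor b (xor c d) \<noteq> 0"
    "xor (xor a b) (xor c d) \<noteq> 0"
    using t dist unfolding xor_eq_0_iff_nat by (auto simp: xor_eq_iff_nat)
  have ker: "x = 0" if "x < 16" "linear_extension a b c d x = 0" for x
    using less_16_cases[OF that(1)] that(2) unfolding linear_extension_def insert_iff
    by (elim disjE; simp add: bit_iff_odd nz sums)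
  have "inj_on ?M {..<16}"
  proof (rule inj_onI)
    fix x y :: nat assume xy: "x \<in> {..<16}" "y \<in> {..<16}" "?M x = ?M y"
    then have "?M (xor x y) = 0" using add by simp
    then show "x = y" using ker xy xor_less_16 xor_eq_0_iff_nat by (metis lessThan_iff)
  qed
  moreover have "?M ` {..<16} \<subseteq> {..<16}" using M by auto
  ultimately have "bij_betw ?M {..<16} {..<16}"
    by (simp add: bij_betw_def endo_inj_surj)
  then show ?thesis using add unfolding linear_auto_def by blast
qed

lemma independent4_basis4:
  assumes ind: "independent4 {a, b, c, d}" and dist: "distinct [a, b, c, d]"
  shows "basis4 a b c d"
proof -
  let ?X = "{a, b, c, d}"
  have X: "a \<in> ?X" "b \<in> ?X" "c \<in> ?X" "d \<in> ?X" by simp_all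
  then have "\<not> dependent4 a b c d"
    using ind dist unfolding independent4_def dependent4_def by blast
  moreover have "?X \<subseteq> {0<..<16}" using ind unfolding independent4_def by blast
  ultimately show ?thesis using dist unfolding basis4_def by auto
qed

lemma linear_extension_axes:
  "linear_extension a b c d 1 = a" "linear_extension a b c d 2 = b"
  "linear_extension a b c d 4 = c" "linear_extension a b c d 8 = d"
  by (simp_all add: linear_extension_def bit_iff_odd)

section \<open>The exchange argument\<close>

text \<open>The bases on which the determinant of the integral lift chosen below is \<open>\<plusminus>3\<close>.\<close>

definition bad_sets :: "nat set set" where
  "bad_sets = {{3,5,11,12}, {3,6,11,12}, {3,7,9,12}, {3,7,10,12}, {3,7,11,13}, {3,7,11,14},
     {5,6,11,12}, {7,9,10,12}, {7,11,13,14}}"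

text \<open>\<open>P\<close> stands for the rows that occur, \<open>C\<close> for the sets of rows outside the facets.\<close>

locale obstructed =
  fixes C :: "nat set set" and P :: "nat set"
  assumes present: "X \<in> C \<Longrightarrow> X \<subseteq> P"
    and card4: "X \<in> C \<Longrightarrow> card X = 4"
    and independent: "X \<in> C \<Longrightarrow> independent4 X"
    and five: "Q \<subseteq> P \<Longrightarrow> card Q = 5 \<Longrightarrow> card {v \<in> Q. Q - {v} \<in> C} \<in> {0, 2}"
    and P16: "P \<subseteq> {..<16}"
    and bad: "linear_auto M \<Longrightarrow> \<exists>X\<in>bad_sets. M ` X \<in> C"

lemma independent4_image:
  assumes M: "linear_auto M" and ind: "independent4 Y"
  shows "independent4 (M ` Y)"
  unfolding independent4_def
proof (intro conjI ballI impI)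
  have in16: "\<And>y. y \<in> Y \<Longrightarrow> y < 16" using ind unfolding independent4_def by auto
  have "0 \<notin> M ` Y"
    using linear_autoD(3)[OF M, of _ 0] linear_auto_0[OF M] in16 ind unfolding independent4_def by force
  then show "M ` Y \<subseteq> {0<..<16}" using linear_autoD(1)[OF M] in16 by (auto intro: gr0I)
next
  have in16: "\<And>y. y \<in> Y \<Longrightarrow> y < 16" using ind unfolding independent4_def by auto
  fix x y z assume "x \<in> M ` Y" "y \<in> M ` Y" "z \<in> M ` Y"
  then obtain x' y' z' where *: "x' \<in> Y" "y' \<in> Y" "z' \<in> Y" "x = M x'" "y = M y'" "z = M z'"
    by blast
  then have "xor x' y' \<noteq> z'" using ind unfolding independent4_def by blast
  moreover have "x' < 16" "y' < 16" "z' < 16" using * in16 by auto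
  ultimately show "xor x y \<noteq> z"
    unfolding *(4-6) by (simp flip: linear_autoD(2)[OF M] add: linear_autoD(3)[OF M] xor_less_16)
next
  have in16: "\<And>y. y \<in> Y \<Longrightarrow> y < 16" using ind unfolding independent4_def by auto
  fix x y z u assume h: "x \<in> M ` Y" "y \<in> M ` Y" "z \<in> M ` Y" "u \<in> M ` Y" "distinct [x, y, z, u]"
  then obtain x' y' z' u' where *: "x' \<in> Y" "y' \<in> Y" "z' \<in> Y" "u' \<in> Y"
      "x = M x'" "y = M y'" "z = M z'" "u = M u'"
    by blast
  have "distinct [x', y', z', u']" using * h(5) by auto
  then have "xor x' y' \<noteq> xor z' u'" using * ind unfolding independent4_def by blast
  moreover have "x' < 16" "y' < 16" "z' < 16" "u' < 16" using * in16 by auto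
  ultimately show "xor x y \<noteq> xor z u"
    unfolding *(5-8) by (simp flip: linear_autoD(2)[OF M] add: linear_autoD(3)[OF M] xor_less_16)
qed

text \<open>This symmetry allows every basis in \<open>C\<close> to be moved to standard
  position.\<close>

lemma obstructed_image:
  assumes "obstructed C P" and M: "linear_auto M"
  shows "obstructed ((`) M ` C) (M ` P)"
proof -
  interpret obstructed C P by fact
  have inj: "inj_on M {..<16}" using M unfolding linear_auto_def bij_betw_def by blast
  have sub: "X \<subseteq> {..<16}" if "X \<in> C" for X using present[OF that] P16 by blast
  have iff: "M ` X \<in> (`) M ` C \<longleftrightarrow> X \<in> C" if X: "X \<subseteq> {..<16}" for X
    using inj_on_image_eq_iff[OF inj X] sub by blast
  show ?thesis
  proof
    fix X assume "X \<in> (`) M ` C"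
    then obtain Y where Y: "Y \<in> C" "X = M ` Y" by blast
    note Y16 = sub[OF Y(1)]
    show "X \<subseteq> M ` P" using Y present by blast
    show "card X = 4" using card4[OF Y(1)] card_image[OF inj_on_subset[OF inj Y16]] Y by simp
    show "independent4 X" using independent4_image[OF M independent[OF Y(1)]] Y by simp
  next
    fix Q assume Q: "Q \<subseteq> M ` P" "card Q = 5"
    then obtain R where R: "R \<subseteq> P" "Q = M ` R" by (metis subset_imageE)
    have R16: "R \<subseteq> {..<16}" using R P16 by blast
    have cR: "card R = 5" using Q R card_image[OF inj_on_subset[OF inj R16]] by simp
    have om: "Q - {M v} \<in> (`) M ` C \<longleftrightarrow> R - {v} \<in> C" if "v \<in> R" for v
    proof -
      have "Q - {M v} = M ` (R - {v})"
        using inj_on_image_set_diff[OF inj, of R "{v}"] R R16 that by auto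
      moreover have "R - {v} \<subseteq> {..<16}" using R16 by blast
      ultimately show ?thesis using iff by simp
    qed
    have "{v \<in> Q. Q - {v} \<in> (`) M ` C} = M ` {v \<in> R. R - {v} \<in> C}"
      unfolding set_eq_iff using om R(2) by blast
    moreover have "card (M ` {v \<in> R. R - {v} \<in> C}) = card {v \<in> R. R - {v} \<in> C}"
      using R16 by (intro card_image inj_on_subset[OF inj]) auto
    ultimately show "card {v \<in> Q. Q - {v} \<in> (`) M ` C} \<in> {0, 2}" using five[OF R(1) cR] by simp
  next
    show "M ` P \<subseteq> {..<16}" using P16 linear_autoD(1)[OF M] by auto
  next
    fix N assume N: "linear_auto N"
    let ?I = "inv_into {..<16} M"
    \<comment> \<open>The condition for \<open>N\<close> on the image is the condition for the
      inverse of \<open>M\<close> composed with \<open>N\<close> on \<open>C\<close>.\<close>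
    have "linear_auto (?I \<circ> N)" using linear_auto_comp linear_auto_inv(1)[OF M] N by blast
    then obtain X where X: "X \<in> bad_sets" "(?I \<circ> N) ` X \<in> C" using bad by blast
    have X16: "X \<subseteq> {..<16}" using X(1) unfolding bad_sets_def by auto
    have "M ` ((?I \<circ> N) ` X) = N ` X"
      unfolding image_image
    proof (rule image_cong[OF refl])
      fix x assume "x \<in> X"
      then have "N x < 16" using X16 linear_autoD(1)[OF N] by auto
      then show "M ((?I \<circ> N) x) = N x" using linear_auto_inv(2)[OF M] by simp
    qed
    then show "\<exists>X\<in>bad_sets. N ` X \<in> (`) M ` C" using X by (metis image_eqI)
  qed
qed

section \<open>The exchange conditions as propositional clauses\<close>

context obstructed
begin

text \<open>Splits "none or two" into clauses: three members never occur together, and one member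
  forces another. Permuting the five names gives all cases.\<close>

lemma five_clauses:
  assumes "distinct [a, b, c, d, e]"
  shows "\<not> ({b,c,d,e} \<in> C \<and> {a,c,d,e} \<in> C \<and> {a,b,d,e} \<in> C)"
    and "a \<in> P \<Longrightarrow> {b,c,d,e} \<in> C \<Longrightarrow> {a,c,d,e} \<in> C \<or> {a,b,d,e} \<in> C \<or> {a,b,c,e} \<in> C \<or> {a,b,c,d} \<in> C"
proof -
  define p q r s t where "p \<longleftrightarrow> {b,c,d,e} \<in> C" and "q \<longleftrightarrow> {a,c,d,e} \<in> C" and "r \<longleftrightarrow> {a,b,d,e} \<in> C"
    and "s \<longleftrightarrow> {a,b,c,e} \<in> C" and "t \<longleftrightarrow> {a,b,c,d} \<in> C"
  note defs = this
  have "\<not> (p \<and> q \<and> r) \<and> (a \<in> P \<longrightarrow> p \<longrightarrow> q \<or> r \<or> s \<or> t)"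
  proof (cases "{a,b,c,d,e} \<subseteq> P")
    case True
    let ?Q = "{a,b,c,d,e}"
    have om: "?Q - {a} = {b,c,d,e}" "?Q - {b} = {a,c,d,e}" "?Q - {c} = {a,b,d,e}" "?Q - {d} = {a,b,c,e}" "?Q - {e} = {a,b,c,d}"
      using assms(1) by auto
    define F where "F v \<longleftrightarrow> ?Q - {v} \<in> C" for v
    have F: "F a = p" "F b = q" "F c = r" "F d = s" "F e = t"
      unfolding F_def defs using om by simp_all
    have "card ?Q = 5" using assms(1) by simp
    then have "card {v \<in> ?Q. F v} \<in> {0, 2}" using five True unfolding F_def by blast
    moreover have "card {v \<in> ?Q. F v} = (\<Sum>v\<in>?Q. if F v then 1 else 0)"
      by (simp only: card_eq_sum sum.inter_filter[of ?Q] finite.intros)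
    moreover have "\<dots> = (if p then 1 else 0) + ((if q then 1 else 0) + ((if r then 1 else 0) +
        ((if s then 1 else 0) + (if t then 1 else 0))))"
      using assms(1) by (simp add: F)
    ultimately show ?thesis
      by (cases p; cases q; cases r; cases s; cases t; simp)
  next
    case False
    \<comment> \<open>Either premise already puts all five elements into \<open>P\<close>: the
      members of \<open>C\<close> in it, and \<open>a\<close> where it is assumed, cover the whole
      set.\<close>
    have "p \<Longrightarrow> {b,c,d,e} \<subseteq> P" "q \<Longrightarrow> {a,c,d,e} \<subseteq> P"
      unfolding defs using present by blast+
    then show ?thesis using False by blast
  qed
  then show "\<not> ({b,c,d,e} \<in> C \<and> {a,c,d,e} \<in> C \<and> {a,b,d,e} \<in> C)"
    "a \<in> P \<Longrightarrow> {b,c,d,e} \<in> C \<Longrightarrow> {a,c,d,e} \<in> C \<or> {a,b,d,e} \<in> C \<or> {a,b,c,e} \<in> C \<or> {a,b,c,d} \<in> C"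
    unfolding defs by blast+
qed

end

text \<open>A test on tuples, so that the side conditions of a long list of instances are discharged
  in one evaluation.\<close>

fun distinct5 :: "nat \<times> nat \<times> nat \<times> nat \<times> nat \<Rightarrow> bool" where
  "distinct5 (a, b, c, d, e) \<longleftrightarrow> distinct [a, b, c, d, e]"

fun basis_tuple :: "nat \<times> nat \<times> nat \<times> nat \<Rightarrow> bool" where
  "basis_tuple (a, b, c, d) \<longleftrightarrow> basis4 a b c d"

lemma obstructed_pullback:
  assumes ob: "obstructed C P" and M: "linear_auto M"
  obtains C' P' where "obstructed C' P'" "\<And>Y. Y \<subseteq> {..<16} \<Longrightarrow> M ` Y \<in> C \<Longrightarrow> Y \<in> C'"
proof -
  let ?N = "inv_into {..<16} M"
  have "Y \<in> (`) ?N ` C" if Y: "Y \<subseteq> {..<16}" "M ` Y \<in> C" for Y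
  proof -
    have "?N ` M ` Y = Y"
      unfolding image_image using linear_auto_inv(3)[OF M] Y(1) by (auto intro!: image_eqI)
    then show ?thesis using Y(2) by (metis image_eqI)
  qed
  then show ?thesis using that obstructed_image[OF ob linear_auto_inv(1)[OF M]] by blast
qed

context obstructed
begin

lemma at_most_two_list:
  assumes "list_all distinct5 xs"
  shows "list_all (\<lambda>(a, b, c, d, e). \<not> ({b,c,d,e} \<in> C \<and> {a,c,d,e} \<in> C \<and> {a,b,d,e} \<in> C)) xs"
proof -
  have "\<not> ({b,c,d,e} \<in> C \<and> {a,c,d,e} \<in> C \<and> {a,b,d,e} \<in> C)" if "distinct [a, b, c, d, e]" for a b c d e
    by (rule five_clauses(1)[OF that])
  then show ?thesis using assms unfolding list_all_iff by fastforce
qed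

text \<open>Members of \<open>C\<close> are independent, so each alternative may carry a test for
  dependence; on numerals the test evaluates and removes the alternatives that cannot occur.\<close>

lemma exchange_list:
  assumes "list_all distinct5 xs"
  shows "list_all (\<lambda>(a, b, c, d, e). a \<in> P \<longrightarrow> {b,c,d,e} \<in> C \<longrightarrow>
    (\<not> dependent4 a c d e \<and> {a,c,d,e} \<in> C) \<or> (\<not> dependent4 a b d e \<and> {a,b,d,e} \<in> C) \<or>
    (\<not> dependent4 a b c e \<and> {a,b,c,e} \<in> C) \<or> (\<not> dependent4 a b c d \<and> {a,b,c,d} \<in> C)) xs"
    (is "list_all (\<lambda>(a, b, c, d, e). ?L a b c d e) xs")
proof -
  have dep: "(\<not> dependent4 a b c d \<and> {a,b,c,d} \<in> C) = ({a,b,c,d} \<in> C)" if "distinct [a, b, c, d]" for a b c d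
    using independent4_basis4[OF independent that] unfolding basis4_def by blast
  have "?L a b c d e" if dist: "distinct [a, b, c, d, e]" for a b c d e
  proof -
    have "distinct [a,c,d,e]" "distinct [a,b,d,e]" "distinct [a,b,c,e]" "distinct [a,b,c,d]"
      using dist by auto
    then show ?thesis using five_clauses(2)[OF dist] by (simp only: dep) blast
  qed
  then have "case x of (a, b, c, d, e) \<Rightarrow> ?L a b c d e" if "distinct5 x" for x
    using that by (cases x) (simp only: prod.case distinct5.simps)
  then show ?thesis using assms unfolding list_all_iff by blast
qed

text \<open>The nine alternatives are the images of the members of \<open>bad_sets\<close>, in the
  order of their definition, under the automorphism taking 1, 2, 4, 8 to \<open>a\<close>,
  \<open>b\<close>, \<open>c\<close>, \<open>d\<close>.\<close>

lemma bad_list: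
  assumes "list_all basis_tuple xs"
  shows "list_all (\<lambda>(a, b, c, d).
    {xor a b, xor a c, xor (xor a b) d, xor c d} \<in> C \<or> {xor a b, xor b c, xor (xor a b) d, xor c d} \<in> C \<or>
    {xor a b, xor (xor a b) c, xor a d, xor c d} \<in> C \<or> {xor a b, xor (xor a b) c, xor b d, xor c d} \<in> C \<or>
    {xor a b, xor (xor a b) c, xor (xor a b) d, xor a (xor c d)} \<in> C \<or>
    {xor a b, xor (xor a b) c, xor (xor a b) d, xor b (xor c d)} \<in> C \<or>
    {xor a c, xor b c, xor (xor a b) d, xor c d} \<in> C \<or> {xor (xor a b) c, xor a d, xor b d, xor c d} \<in> C \<or>
    {xor (xor a b) c, xor (xor a b) d, xor a (xor c d), xor b (xor c d)} \<in> C) xs"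
    (is "list_all (\<lambda>(a, b, c, d). ?D a b c d) xs")
proof -
  have D: "?D a b c d" if "basis4 a b c d" for a b c d
    using bad[OF linear_extension_linear_auto[OF that]] unfolding bad_sets_def
    by (simp add: linear_extension_def bit_iff_odd)
  show ?thesis
    unfolding list_all_iff
  proof (intro ballI)
    fix x assume "x \<in> set xs"
    moreover obtain a b c d where "x = (a, b, c, d)" by (cases x)
    ultimately show "case x of (a, b, c, d) \<Rightarrow> ?D a b c d"
      using D[of a b c d] assms unfolding list_all_iff by fastforce
  qed
qed

text \<open>The element whose presence among the rows is asserted comes first in each tuple.\<close>

lemma present_list: "list_all (\<lambda>(a, b, c, d). {a,b,c,d} \<in> C \<longrightarrow> a \<in> P) xs"
  using present unfolding list_all_iff by auto

end

text \<open>Let \<open>a, b, c, d\<close> be a basis in \<open>C\<close>. For every row \<open>e\<close> that is a sum of at least two of these vectors,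
  exactly one of the summands can be exchanged for \<open>e\<close> within \<open>C\<close>. Certain combinations of such
  exchanges are impossible, each by a finite case analysis; the listed instances of the assumptions
  are those used in refutations found by a SAT solver.\<close>

lemma no_exchange_pattern1_std:
  assumes "obstructed C P"
  shows "\<not> ({1,2,4,8} \<in> C \<and> {3,2,4,8} \<in> C \<and> {1,7,4,8} \<in> C \<and> {1,2,6,8} \<in> C)"
proof
  interpret obstructed C P by fact
  \<comment> \<open>Here 3 = 1+2 takes the place of 1, 7 = 1+2+4 that of 2, and 6 = 2+4 that of
    4.\<close>
  assume hyp: "{1,2,4,8} \<in> C \<and> {3,2,4,8} \<in> C \<and> {1,7,4,8} \<in> C \<and> {1,2,6,8} \<in> C"
  have "list_all distinct5
    [(3,2,1,4,8), (5,3,2,4,8), (6,3,2,7,8), (6,4,2,1,8), (6,5,2,1,8), (7,2,1,4,8), (7,4,2,1,8), (7,5,3,1,8),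
    (7,6,3,2,8), (7,6,5,4,8), (9,8,1,2,4), (10,2,1,4,9), (10,9,2,1,4), (11,2,1,4,8), (11,8,2,1,4),
    (11,9,3,1,4), (11,10,1,4,9), (14,11,1,4,8)]"
    by simp
  note at_most_two = at_most_two_list[OF this]
  have "list_all distinct5
    [(2,1,4,9,11), (2,4,8,9,10), (2,4,8,9,11), (3,1,4,7,8), (3,1,4,8,11), (4,1,3,6,8), (4,8,10,11,14),
    (5,1,2,4,8), (5,1,3,6,8), (5,3,4,6,8), (6,1,3,7,8), (6,1,4,7,8), (7,1,2,5,8), (7,1,2,6,8), (7,2,3,4,8),
    (7,2,4,5,8), (8,1,3,4,11), (8,1,4,6,14), (9,1,3,4,10), (9,4,8,10,11), (11,1,2,4,9)]"
    by simp
  note exchange = exchange_list[OF this]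
  have "list_all basis_tuple
    [(9,12,7,13), (11,13,2,3), (12,14,3,6), (12,15,2,6), (13,14,2,6)]"
    by (simp add: basis4_def dependent4_def)
  note bad = bad_list[OF this]
  note present = present_list[of "
    [(2,1,6,8), (3,2,4,8), (4,1,7,8), (5,1,2,8), (5,1,2,10), (5,1,3,8), (5,1,3,9), (5,1,3,10), (5,1,3,11),
    (5,1,6,9), (5,1,6,15), (5,1,8,10), (5,1,8,11), (5,1,9,10), (5,1,9,15), (5,2,3,8), (5,2,4,10), (5,2,4,13),
    (5,2,4,15), (5,2,6,8), (5,3,4,12), (5,3,4,13), (5,3,4,14), (5,3,4,15), (5,4,6,10), (5,4,6,12),
    (5,4,10,12), (5,4,12,15), (5,4,13,14), (5,4,13,15), (5,8,10,11), (5,8,10,14), (6,1,2,8), (7,1,4,8),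
    (8,1,2,6), (9,1,2,4), (11,1,4,8)]"]
  \<comment> \<open>Equal sets of numerals must become the same propositional atom, so elements are
    put in a fixed order and numerals in a fixed form.\<close>
  note [simp] = insert_commute numeral_2_eq_2[symmetric]
  note at_most_two = at_most_two[simplified]
  note exchange = exchange[unfolded dependent4_def, simplified]
  note bad = bad[simplified]
  note present = present[simplified]
  show False using hyp[simplified] at_most_two exchange bad present by sat
qed

text \<open>An automorphism carries 1, 2, 4, 8 to any given basis and the obstruction is invariant,
  so the refutation in standard position serves all coordinates.\<close>

lemma no_exchange_pattern1_list:
  assumes ob: "obstructed C P" and xs: "list_all basis_tuple xs"
  shows "list_all (\<lambda>(a, b, c, d). \<not> ({a, b, c, d} \<in> C \<and> {xor a b, b, c, d} \<in> C \<and> {a, xor (xor a b) c, c, d} \<in> C \<and> {a, b, xor b c, d} \<in> C)) xs"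
proof -
  have "\<not> ({a, b, c, d} \<in> C \<and> {xor a b, b, c, d} \<in> C \<and> {a, xor (xor a b) c, c, d} \<in> C \<and> {a, b, xor b c, d} \<in> C)" if basis: "basis4 a b c d" for a b c d
  proof
    let ?M = "linear_extension a b c d"
    assume h: "{a, b, c, d} \<in> C \<and> {xor a b, b, c, d} \<in> C \<and> {a, xor (xor a b) c, c, d} \<in> C \<and> {a, b, xor b c, d} \<in> C"
    obtain C' P' where C': "obstructed C' P'" "\<And>Y. Y \<subseteq> {..<16} \<Longrightarrow> ?M ` Y \<in> C \<Longrightarrow> Y \<in> C'"
      using obstructed_pullback[OF ob linear_extension_linear_auto[OF basis]] by metis
    have "{1,2,4,8} \<in> C' \<and> {3,2,4,8} \<in> C' \<and> {1,7,4,8} \<in> C' \<and> {1,2,6,8} \<in> C'"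
      using h by (intro conjI C'(2)) (simp_all add: linear_extension_def bit_iff_odd)
    then show False using no_exchange_pattern1_std[OF C'(1)] by blast
  qed
  then show ?thesis using xs unfolding list_all_iff by fastforce
qed

text \<open>Now 1+2 takes the place of 1, 1+2+4 that of 4, and the sum of all four that of 8.
  Instances of the first pattern in many other bases serve as further clauses.\<close>

lemma no_exchange_pattern2_std:
  assumes "obstructed C P"
  shows "\<not> ({1,2,4,8} \<in> C \<and> {3,2,4,8} \<in> C \<and> {1,2,7,8} \<in> C \<and> {1,2,4,15} \<in> C)"
proof
  interpret obstructed C P by fact
  assume hyp: "{1,2,4,8} \<in> C \<and> {3,2,4,8} \<in> C \<and> {1,2,7,8} \<in> C \<and> {1,2,4,15} \<in> C"
  have "list_all distinct5
    [(3,2,1,4,8), (3,2,1,7,15), (5,3,2,4,8), (5,3,2,4,9), (5,3,2,4,11), (5,3,2,4,15), (5,4,1,2,8),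
    (5,4,1,2,9), (5,4,1,2,15), (5,4,3,2,8), (5,4,3,2,9), (5,4,3,2,11), (5,4,3,8,10), (6,4,2,1,8),
    (6,5,1,13,15), (6,5,2,1,8), (6,5,2,1,9), (7,2,1,4,13), (7,4,1,2,8), (7,4,1,2,13), (7,4,1,8,10),
    (7,4,2,1,8), (7,4,2,8,9), (7,5,2,1,8), (7,5,2,1,15), (8,4,3,6,9), (8,5,3,4,10), (8,6,1,11,15),
    (8,6,5,2,9), (9,3,1,7,11), (9,3,2,4,8), (9,4,2,1,15), (9,5,4,2,8), (9,6,1,4,10), (9,8,1,2,5), (9,8,1,2,6),
    (9,8,3,2,4), (9,8,5,4,11), (10,3,1,4,12), (10,3,2,4,11), (10,4,1,2,15), (10,5,3,4,8), (10,7,1,3,15),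
    (10,7,3,1,15), (10,8,2,4,5), (10,9,4,2,5), (10,9,5,2,4), (10,9,8,4,15), (11,2,1,4,8), (11,2,1,8,12),
    (11,5,1,2,15), (11,5,1,7,8), (11,7,1,2,15), (11,7,2,1,15), (11,7,3,1,15), (11,8,1,2,4), (11,8,1,2,12),
    (11,8,1,12,14), (11,8,2,1,4), (11,8,3,2,6), (11,8,4,2,5), (11,8,5,9,15), (11,8,7,1,5), (11,9,2,4,5),
    (11,9,2,8,12), (11,9,3,1,4), (11,9,6,1,4), (11,9,6,4,5), (11,10,1,2,4), (11,10,1,2,5), (11,10,3,2,4),
    (12,4,1,9,11), (12,4,3,9,11), (12,5,1,2,8), (12,5,1,8,10), (12,5,3,2,8), (12,5,4,2,15), (12,5,4,13,15),
    (12,6,2,1,9), (12,7,1,2,8), (12,7,2,1,8), (12,7,2,4,13), (12,7,3,5,8), (12,8,1,2,5), (12,8,3,5,7),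
    (12,8,4,5,11), (12,8,5,1,2), (12,8,7,1,2), (12,9,1,4,14), (12,9,4,1,2), (12,10,2,4,15), (12,10,4,2,15),
    (12,10,6,1,15), (12,11,1,2,4), (12,11,2,1,4), (12,11,2,5,8), (12,11,2,5,10), (12,11,2,5,15),
    (12,11,4,1,2), (12,11,5,1,2), (12,11,5,2,8), (12,11,5,2,15), (12,11,7,1,15), (12,11,8,1,14),
    (12,11,8,2,13), (13,3,1,5,10), (13,3,1,7,15), (13,3,2,4,8), (13,3,2,7,11), (13,4,3,2,8), (13,5,4,12,15),
    (13,6,5,1,15), (13,8,1,2,4), (13,8,5,1,2), (13,9,6,1,2), (13,11,2,1,4), (13,11,4,1,2), (13,12,1,2,5),
    (13,12,8,3,10), (13,12,10,3,8), (14,3,1,5,9), (14,3,2,4,11), (14,4,3,2,11), (14,7,1,3,11), (14,8,2,1,4),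
    (14,8,2,1,5), (14,8,4,1,2), (14,8,5,1,2), (14,9,5,2,4), (14,10,4,1,2), (14,10,4,2,5), (14,10,5,1,2),
    (14,11,1,2,4), (14,11,1,4,12), (14,11,4,1,2), (14,11,8,2,15), (14,12,2,1,4), (14,12,7,10,15),
    (14,12,9,4,11), (14,13,1,2,5), (14,13,2,1,5), (14,13,2,4,5), (14,13,8,4,15), (15,3,2,4,10), (15,3,2,5,11),
    (15,4,2,9,12), (15,4,3,8,10), (15,5,2,8,12), (15,5,3,9,11), (15,6,5,1,13), (15,8,1,2,4), (15,8,2,1,4),
    (15,8,2,4,5), (15,8,3,4,10), (15,8,4,1,2), (15,8,5,2,11), (15,8,5,2,12), (15,9,1,2,5), (15,9,2,1,4),
    (15,9,2,1,5), (15,9,2,4,14), (15,9,4,1,2), (15,9,4,2,12), (15,9,5,1,2), (15,9,7,1,2), (15,10,1,2,4),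
    (15,10,1,3,4), (15,10,4,1,2), (15,10,5,1,9), (15,10,7,1,2), (15,10,7,1,3), (15,10,9,4,8), (15,11,3,2,5),
    (15,11,5,1,2), (15,11,7,1,2), (15,12,1,2,4), (15,12,2,1,4), (15,12,5,1,7), (15,12,8,2,11), (15,12,9,1,11),
    (15,13,2,1,4), (15,13,2,1,5), (15,13,7,4,5), (15,13,10,4,8), (15,14,5,2,4), (15,14,13,4,8)]"
    by simp
  note at_most_two = at_most_two_list[OF this]
  have "list_all distinct5
    [(1,2,3,11,15), (1,2,4,5,11), (1,2,4,5,12), (1,2,4,5,13), (1,2,4,5,14), (1,2,5,8,9), (1,2,5,10,11),
    (1,2,6,7,9), (1,2,6,8,9), (1,2,8,9,15), (1,2,8,14,15), (1,2,10,14,15), (1,2,11,14,15), (1,3,4,5,10),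
    (1,4,5,6,8), (1,4,7,8,13), (1,4,7,10,15), (1,4,7,11,13), (1,4,8,9,11), (1,4,8,9,14), (1,4,8,9,15),
    (1,4,8,10,11), (1,4,8,14,15), (1,4,11,12,13), (1,4,12,13,15), (1,4,12,14,15), (1,5,6,10,13),
    (1,5,6,12,13), (1,5,7,11,15), (1,5,9,14,15), (1,5,13,14,15), (1,7,10,11,15), (1,8,10,11,15),
    (1,8,10,12,15), (1,8,12,13,15), (1,9,11,12,15), (1,9,12,13,15), (2,1,3,4,9), (2,1,3,4,10), (2,1,3,5,8),
    (2,1,3,5,10), (2,1,3,5,11), (2,1,3,8,13), (2,1,3,8,15), (2,1,3,11,12), (2,1,3,11,15), (2,1,4,6,9),
    (2,1,4,9,11), (2,1,5,7,11), (2,1,5,8,15), (2,1,5,9,11), (2,1,5,11,12), (2,1,7,9,11), (2,1,7,12,14),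
    (2,1,8,10,15), (2,1,8,11,13), (2,1,8,12,14), (2,1,8,13,15), (2,1,9,10,15), (2,1,9,11,12), (2,1,9,11,15),
    (2,1,9,13,15), (2,3,5,13,15), (2,4,5,7,8), (2,4,5,7,11), (2,4,5,7,12), (2,4,5,7,15), (2,4,5,8,10),
    (2,4,5,8,15), (2,4,5,12,15), (2,4,5,13,15), (2,4,6,8,9), (2,4,8,9,10), (2,4,8,10,15), (2,4,8,13,15),
    (2,4,9,11,12), (2,4,9,11,14), (2,4,11,12,14), (2,5,7,8,12), (2,5,8,9,10), (2,5,8,9,11), (2,5,12,13,14),
    (2,8,9,11,14), (2,8,9,13,15), (2,8,10,11,12), (2,8,10,14,15), (2,8,12,14,15), (2,11,12,14,15),
    (3,1,2,4,9), (3,1,2,5,11), (3,1,2,11,14), (3,1,4,7,10), (3,1,4,8,11), (3,1,4,9,10), (3,1,5,9,11),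
    (3,1,7,8,11), (3,2,6,8,9), (3,4,5,6,9), (3,4,5,7,15), (3,4,5,10,12), (3,4,5,13,15), (3,4,10,11,12),
    (3,5,8,10,12), (3,7,11,13,15), (3,8,12,13,15), (3,9,11,12,15), (4,1,2,5,9), (4,1,2,5,10), (4,1,2,5,11),
    (4,1,2,5,14), (4,1,2,9,13), (4,1,3,7,8), (4,1,3,8,15), (4,1,5,7,12), (4,1,5,8,11), (4,1,8,10,14),
    (4,1,8,11,15), (4,1,8,12,15), (4,1,9,11,12), (4,1,11,12,15), (4,2,5,6,11), (4,2,5,8,11), (4,2,6,8,9),
    (4,2,6,9,10), (4,2,7,8,11), (4,2,7,12,15), (4,2,8,9,13), (4,2,8,11,12), (4,2,8,11,15), (4,2,8,12,15),
    (4,2,10,11,15), (4,3,5,7,8), (4,3,5,7,13), (4,5,8,11,15), (4,8,9,11,15), (4,8,10,11,14), (4,8,10,14,15),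
    (5,1,2,4,8), (5,1,2,4,9), (5,1,2,4,12), (5,1,2,4,14), (5,1,2,4,15), (5,1,2,7,8), (5,1,2,7,15),
    (5,1,2,8,12), (5,1,2,9,12), (5,1,2,9,13), (5,1,2,11,14), (5,1,3,4,10), (5,1,4,8,14), (5,1,8,10,15),
    (5,1,9,11,15), (5,2,3,6,9), (5,2,3,7,8), (5,2,4,9,12), (5,2,4,11,14), (5,2,4,12,15), (5,2,7,12,15),
    (5,2,8,12,13), (5,2,10,11,14), (5,3,8,10,15), (5,3,8,13,15), (5,3,9,11,14), (5,4,6,8,11), (5,4,8,13,15),
    (5,4,10,11,12), (5,6,12,13,15), (5,8,9,10,15), (5,8,10,12,15), (6,1,2,4,8), (6,1,2,4,14), (6,1,2,4,15),
    (6,1,2,7,8), (6,2,3,5,11), (6,2,4,5,9), (6,2,4,8,9), (6,2,9,10,12), (6,5,10,12,13), (7,1,2,5,11),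
    (7,1,2,5,12), (7,1,2,11,12), (7,1,3,8,15), (7,1,4,11,12), (7,1,5,8,15), (7,1,8,12,14), (7,1,9,10,14),
    (7,1,9,11,14), (7,1,9,11,15), (7,2,3,4,8), (7,2,3,10,15), (7,2,4,5,11), (7,2,4,5,13), (7,2,4,5,15),
    (7,2,5,8,12), (7,2,6,8,15), (7,2,8,12,15), (7,3,4,5,12), (7,3,9,11,14), (7,4,5,11,12), (7,4,8,10,15),
    (7,10,11,12,15), (8,1,2,5,9), (8,1,2,5,10), (8,1,2,5,11), (8,1,2,5,13), (8,1,2,5,15), (8,1,2,6,14),
    (8,1,2,9,13), (8,1,2,11,15), (8,1,3,4,11), (8,1,3,4,12), (8,1,3,5,11), (8,1,3,7,11), (8,1,3,11,15),
    (8,1,4,6,14), (8,1,4,6,15), (8,1,4,7,12), (8,1,4,7,15), (8,1,4,9,11), (8,1,4,12,15), (8,1,7,9,12),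
    (8,1,7,11,14), (8,2,3,5,13), (8,2,4,5,10), (8,2,4,5,11), (8,2,4,5,13), (8,2,4,5,15), (8,2,4,7,12),
    (8,2,4,7,15), (8,2,4,9,12), (8,2,4,14,15), (8,2,5,10,11), (8,2,6,7,9), (8,3,4,5,11), (8,3,4,5,13),
    (8,3,5,7,15), (8,3,5,12,13), (8,3,10,11,12), (8,3,10,11,15), (8,4,5,10,13), (8,4,6,7,15), (8,4,7,9,15),
    (8,4,7,10,15), (8,5,7,11,15), (8,5,11,12,15), (9,1,2,4,8), (9,1,2,4,10), (9,1,2,4,13), (9,1,2,4,14),
    (9,1,2,5,8), (9,1,2,5,10), (9,1,2,6,8), (9,1,2,6,15), (9,1,2,7,8), (9,1,2,8,12), (9,1,2,11,12),
    (9,1,4,6,15), (9,1,5,6,12), (9,1,7,8,11), (9,2,3,4,10), (9,2,3,4,11), (9,2,4,5,11), (9,2,4,5,12),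
    (9,2,4,11,14), (9,2,5,11,15), (9,2,6,7,14), (9,3,4,8,10), (9,4,5,11,12), (9,4,8,10,15), (10,1,2,4,8),
    (10,1,2,4,9), (10,1,2,4,11), (10,1,2,5,8), (10,1,2,5,15), (10,1,2,7,8), (10,1,3,11,15), (10,1,4,6,12),
    (10,2,3,4,8), (10,2,3,11,15), (10,2,4,5,15), (10,2,4,9,12), (10,2,5,8,9), (10,2,8,12,15), (10,3,4,9,15),
    (10,4,5,8,15), (10,4,5,12,15), (11,1,2,4,9), (11,1,2,4,12), (11,1,2,4,15), (11,1,2,5,9), (11,1,2,5,10),
    (11,1,2,5,14), (11,1,2,5,15), (11,1,2,7,8), (11,1,2,7,12), (11,1,2,9,12), (11,1,4,6,15), (11,1,4,10,12),
    (11,1,5,7,15), (11,1,7,8,13), (11,2,3,4,8), (11,2,3,7,8), (11,2,4,5,9), (11,2,4,5,14), (11,2,4,5,15),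
    (11,2,4,7,12), (11,2,4,8,9), (11,2,4,12,13), (11,2,6,8,9), (11,2,9,12,15), (11,3,4,5,8), (11,3,4,5,15),
    (11,3,5,8,15), (11,4,5,9,14), (11,4,5,12,14), (11,4,5,12,15), (11,4,6,8,9), (11,4,7,13,15), (11,5,7,8,12),
    (11,5,7,12,15), (12,1,2,4,8), (12,1,2,4,13), (12,1,2,4,14), (12,1,2,5,8), (12,1,2,5,9), (12,1,2,7,11),
    (12,1,2,7,15), (12,1,2,11,15), (12,1,3,4,15), (12,1,3,11,15), (12,1,4,8,10), (12,1,4,13,15),
    (12,1,6,13,15), (12,1,7,8,11), (12,1,7,9,11), (12,2,3,8,15), (12,2,4,5,9), (12,2,4,5,10), (12,2,4,7,11),
    (12,2,4,11,14), (12,2,5,8,11), (12,2,5,14,15), (12,2,7,8,11), (12,2,8,11,14), (12,3,4,13,15),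
    (12,3,5,8,15), (12,3,5,10,13), (12,4,5,8,11), (12,4,5,9,11), (12,4,5,9,15), (12,4,7,13,15), (12,4,8,9,15),
    (12,4,8,11,14), (13,1,2,4,9), (13,1,2,4,15), (13,1,2,6,15), (13,1,2,7,11), (13,1,2,8,12), (13,1,2,9,12),
    (13,1,5,8,15), (13,2,4,5,8), (13,2,4,5,15), (13,3,4,5,10), (13,3,4,8,10), (13,3,4,8,14), (13,3,5,7,8),
    (13,3,5,7,15), (13,4,5,7,8), (14,1,2,4,10), (14,1,2,4,15), (14,1,2,8,12), (14,1,2,11,15), (14,1,4,9,11),
    (14,1,11,12,15), (14,2,3,8,12), (14,2,4,5,11), (14,2,4,5,12), (14,2,4,5,15), (14,2,4,9,12), (14,3,4,9,11),
    (14,4,5,9,15), (14,4,5,13,15), (14,4,8,9,11), (14,7,8,9,11), (14,7,9,11,15), (14,8,10,12,15),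
    (15,1,2,5,8), (15,1,2,7,8), (15,1,2,8,14), (15,1,2,9,13), (15,1,4,6,9), (15,1,4,7,11), (15,1,4,8,10),
    (15,1,4,8,14), (15,1,4,9,10), (15,1,4,9,11), (15,1,5,6,10), (15,1,5,8,10), (15,1,7,8,11), (15,1,7,8,13),
    (15,1,7,10,14), (15,1,7,11,14), (15,2,3,4,11), (15,2,4,5,8), (15,2,4,5,9), (15,2,4,5,10), (15,2,4,7,11),
    (15,2,4,7,13), (15,2,4,8,9), (15,2,4,8,13), (15,2,4,10,11), (15,2,4,11,12), (15,2,5,12,13), (15,2,6,8,9),
    (15,2,8,9,13), (15,2,8,12,13), (15,2,9,12,13), (15,3,4,8,10), (15,3,4,10,12), (15,3,5,8,10),
    (15,3,8,10,12), (15,3,10,11,12), (15,4,7,10,11), (15,4,8,9,11), (15,6,8,9,11), (15,7,8,11,14),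
    (15,7,8,12,14)]"
    by simp
  note exchange = exchange_list[OF this]
  have "list_all basis_tuple
    [(1,3,6,9), (1,3,6,10), (1,9,10,12), (2,5,6,12), (2,8,1,5), (2,10,9,12), (2,15,1,5), (3,6,7,13),
    (3,9,1,5), (3,10,2,6), (3,11,9,12), (3,12,5,7), (3,12,6,7), (3,12,10,11), (3,13,2,6), (3,14,1,5),
    (3,15,8,9), (4,6,7,10), (5,7,3,10), (5,10,2,6), (5,12,4,6), (5,13,2,3), (5,13,6,7), (5,14,1,3),
    (6,7,5,10), (6,9,1,5), (6,9,3,7), (6,12,4,5), (6,13,1,3), (6,13,10,14), (7,9,5,6), (9,13,3,11),
    (10,12,4,13), (10,13,1,3), (10,14,3,11), (10,14,5,12), (14,15,6,10)]"
    by (simp add: basis4_def dependent4_def)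
  note bad = bad_list[OF this]
  have "list_all basis_tuple
    [(1,2,8,4), (1,2,10,7), (1,2,15,4), (1,3,8,12), (1,3,15,8), (1,4,2,9), (1,4,2,14), (1,4,9,15), (1,5,8,15),
    (1,5,10,2), (1,5,11,2), (1,5,15,8), (1,7,2,8), (1,7,2,15), (1,7,8,2), (1,8,2,4), (1,8,2,5), (1,8,4,2),
    (1,8,6,2), (1,8,6,4), (1,8,12,2), (1,9,2,5), (1,9,11,14), (1,9,15,2), (1,15,2,4), (2,3,11,12),
    (2,3,11,15), (2,3,15,8), (2,5,11,4), (2,5,12,4), (2,6,15,8), (2,7,8,1), (2,8,4,1), (2,8,5,1), (2,9,5,4),
    (2,9,8,14), (2,11,4,5), (2,12,4,5), (2,13,8,9), (2,13,9,1), (3,2,10,7), (3,7,8,13), (4,1,8,2), (4,1,9,10),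
    (4,1,10,9), (4,1,12,2), (4,1,15,2), (4,2,8,1), (4,3,11,2), (4,3,15,13), (4,5,7,8), (4,5,7,15), (4,5,8,15),
    (4,5,9,2), (4,5,15,8), (4,6,9,8), (4,7,8,5), (4,8,9,2), (4,13,15,8), (4,15,7,5), (5,1,10,2), (5,2,8,1),
    (5,2,8,3), (5,2,11,8), (5,4,8,10), (5,4,10,8), (5,7,8,1), (5,7,12,15), (5,8,12,2), (6,1,9,2), (7,3,8,2),
    (7,5,8,4), (7,9,11,8), (8,4,11,9), (8,7,12,14), (8,13,15,4), (9,7,15,11), (9,11,15,1), (9,12,10,2),
    (11,7,15,13), (11,7,15,14), (12,8,15,9), (14,9,15,11)]"
    by (simp add: basis4_def dependent4_def)
  note pattern1 = no_exchange_pattern1_list[OF assms this]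
  note present = present_list[of "
    [(1,2,4,15), (2,1,4,15), (3,2,4,8), (4,1,2,15), (5,1,6,8), (5,1,6,14), (5,1,8,14), (5,3,4,8), (5,4,8,11),
    (6,2,5,8), (6,2,5,13), (6,2,8,13), (6,3,4,8), (6,3,4,11), (6,4,8,11), (7,1,2,8), (8,1,2,7), (9,1,2,4),
    (9,1,2,6), (9,4,8,15), (9,8,11,15), (10,1,6,8), (10,1,6,14), (10,1,8,14), (10,2,6,11), (10,2,6,13),
    (10,2,11,13), (10,4,8,11), (10,4,11,12), (10,7,8,11), (10,7,8,12), (10,8,11,12), (11,2,4,8), (11,4,5,12),
    (11,4,6,10), (11,4,6,12), (11,4,7,10), (11,4,7,13), (11,4,9,12), (11,4,10,12), (11,4,10,13), (11,6,10,15),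
    (11,6,12,15), (11,7,10,15), (11,7,13,15), (11,7,14,15), (11,9,14,15), (11,10,12,15), (11,10,13,15),
    (12,4,5,11), (12,4,5,14), (12,4,6,11), (12,4,6,13), (12,4,7,10), (12,4,7,13), (12,4,10,13), (12,4,11,13),
    (12,4,11,14), (12,6,8,11), (12,6,8,13), (12,7,8,9), (12,7,8,10), (12,7,8,13), (12,7,8,14), (12,8,9,14),
    (12,8,10,13), (12,8,11,13), (13,1,9,14), (13,1,9,15), (13,2,3,9), (13,2,3,10), (13,2,9,10), (13,3,4,12),
    (13,3,4,15), (13,4,12,15), (13,7,9,15), (13,7,14,15), (13,9,14,15), (14,1,3,9), (14,1,3,10), (14,1,9,10),
    (14,2,10,13), (14,2,10,15), (14,3,4,12), (14,3,4,15), (14,4,12,15), (14,7,10,15), (14,7,13,15),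
    (14,10,13,15), (15,1,2,4)]"]
  note [simp] = insert_commute numeral_2_eq_2[symmetric]
  note at_most_two = at_most_two[simplified]
  note exchange = exchange[unfolded dependent4_def, simplified]
  note bad = bad[simplified]
  note pattern1 = pattern1[simplified]
  note present = present[simplified]
  show False using hyp[simplified] at_most_two exchange bad pattern1 present by sat
qed

lemma no_exchange_pattern2_list:
  assumes ob: "obstructed C P" and xs: "list_all basis_tuple xs"
  shows "list_all (\<lambda>(a, b, c, d). \<not> ({a, b, c, d} \<in> C \<and> {xor a b, b, c, d} \<in> C \<and> {a, b, xor (xor a b) c, d} \<in> C \<and> {a, b, c, xor (xor a b) (xor c d)} \<in> C)) xs"
proof -
  have "\<not> ({a, b, c, d} \<in> C \<and> {xor a b, b, c, d} \<in> C \<and> {a, b, xor (xor a b) c, d} \<in> C \<and> {a, b, c, xor (xor a b) (xor c d)} \<in> C)" if basis: "basis4 a b c d" for a b c d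
  proof
    let ?M = "linear_extension a b c d"
    assume h: "{a, b, c, d} \<in> C \<and> {xor a b, b, c, d} \<in> C \<and> {a, b, xor (xor a b) c, d} \<in> C \<and> {a, b, c, xor (xor a b) (xor c d)} \<in> C"
    obtain C' P' where C': "obstructed C' P'" "\<And>Y. Y \<subseteq> {..<16} \<Longrightarrow> ?M ` Y \<in> C \<Longrightarrow> Y \<in> C'"
      using obstructed_pullback[OF ob linear_extension_linear_auto[OF basis]] by metis
    have "{1,2,4,8} \<in> C' \<and> {3,2,4,8} \<in> C' \<and> {1,2,7,8} \<in> C' \<and> {1,2,4,15} \<in> C'"
      using h by (intro conjI C'(2)) (simp_all add: linear_extension_def bit_iff_odd)
    then show False using no_exchange_pattern2_std[OF C'(1)] by blast
  qed
  then show ?thesis using xs unfolding list_all_iff by fastforce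
qed

text \<open>In arbitrary coordinates this excludes every place for the sum of a basis in
  \<open>C\<close>; by the exchange condition such a sum is then never a row.\<close>

lemma no_exchange_pattern3_std:
  assumes "obstructed C P"
  shows "\<not> ({1,2,4,8} \<in> C \<and> {15,2,4,8} \<in> C)"
proof
  interpret obstructed C P by fact
  assume hyp: "{1,2,4,8} \<in> C \<and> {15,2,4,8} \<in> C"
  have "list_all distinct5
    [(9,8,1,2,4), (12,8,4,1,2), (12,8,5,1,2), (12,9,4,1,2), (12,9,5,2,4), (14,2,1,4,9), (14,2,1,5,8),
    (14,4,1,2,9), (14,4,2,1,8), (14,4,2,5,8), (14,4,2,8,9), (14,4,2,8,15), (14,8,2,1,4), (14,8,2,1,5),
    (14,8,2,4,5), (14,8,2,4,9), (14,8,4,2,9), (15,2,1,4,8), (15,4,1,2,8), (15,5,2,4,8), (15,5,4,2,14),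
    (15,7,4,2,14), (15,8,1,2,4), (15,8,5,2,4), (15,9,2,4,8), (15,9,4,2,8), (15,11,8,2,14), (15,13,8,4,14),
    (15,14,5,2,4), (15,14,9,2,8), (15,14,9,4,8)]"
    by simp
  note at_most_two = at_most_two_list[OF this]
  have "list_all distinct5
    [(1,2,4,5,12), (1,2,4,14,15), (1,2,6,8,9), (1,2,8,9,12), (1,2,8,9,14), (1,2,8,14,15), (1,4,5,8,14),
    (1,4,6,8,9), (1,4,8,9,14), (1,8,10,11,14), (1,8,10,14,15), (2,1,4,6,15), (2,1,4,9,14), (2,1,4,12,14),
    (2,1,8,12,14), (2,4,8,9,14), (2,4,9,11,14), (2,5,7,14,15), (2,5,8,14,15), (4,1,2,5,12), (4,1,2,6,15),
    (4,1,2,9,14), (4,1,5,8,14), (4,1,5,8,15), (4,1,8,10,14), (4,1,9,11,15), (4,2,8,9,14), (4,2,9,13,14),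
    (4,8,10,14,15), (5,1,2,4,8), (5,1,2,4,14), (5,1,8,10,15), (5,2,4,8,15), (5,2,4,14,15), (6,1,2,4,8),
    (6,1,2,9,14), (6,1,4,9,14), (7,2,4,5,14), (8,1,2,9,14), (8,1,2,9,15), (8,1,4,9,14), (8,1,4,9,15),
    (8,2,5,14,15), (8,2,6,9,14), (8,4,6,9,14), (9,1,2,4,8), (9,1,2,5,12), (9,1,2,6,15), (9,1,4,6,15),
    (9,2,4,5,8), (9,2,4,8,15), (9,2,7,8,14), (9,2,8,14,15), (9,4,7,8,14), (9,4,8,14,15), (10,2,4,8,15),
    (10,5,8,14,15), (11,2,8,9,14), (12,1,2,4,8), (13,4,8,9,14), (14,1,2,4,8), (14,2,4,8,15), (15,1,2,4,14),
    (15,1,2,6,8), (15,1,2,8,14), (15,1,4,6,8), (15,2,4,11,14), (15,2,4,13,14), (15,2,7,8,14), (15,5,7,8,14)]"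
    by simp
  note exchange = exchange_list[OF this]
  have "list_all basis_tuple
    [(3,4,1,9), (3,7,2,10), (3,8,1,5), (3,11,2,6), (4,13,1,3), (5,7,4,8), (5,8,1,3), (5,11,2,6), (5,13,4,6),
    (7,10,1,3), (7,11,4,5), (7,12,4,5), (7,13,2,3), (7,15,4,6), (8,9,3,5), (9,11,3,6), (10,11,6,8),
    (10,12,7,8), (11,13,2,3), (11,15,6,8), (12,13,7,9)]"
    by (simp add: basis4_def dependent4_def)
  note bad = bad_list[OF this]
  have "list_all basis_tuple
    [(1,5,12,2), (1,12,9,2), (2,6,15,1), (4,5,12,2), (4,6,9,1), (5,4,8,2), (8,6,9,2), (8,6,9,4)]"
    by (simp add: basis4_def dependent4_def)
  note pattern1 = no_exchange_pattern1_list[OF assms this]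
  have "list_all basis_tuple
    [(1,5,14,8), (1,14,5,8), (1,14,9,2), (1,14,9,4), (2,4,8,1), (2,8,4,1), (2,8,4,15), (4,2,8,1), (4,5,14,8),
    (4,8,2,1), (5,14,1,8), (8,2,4,15), (8,4,2,1), (8,9,14,2), (8,9,14,4), (9,1,14,2), (9,1,14,4)]"
    by (simp add: basis4_def dependent4_def)
  note pattern2 = no_exchange_pattern2_list[OF assms this]
  note present = present_list[of "
    [(1,2,4,8), (2,4,8,15), (4,2,8,15), (5,1,2,13), (5,1,2,15), (5,1,6,9), (5,1,6,15), (5,1,9,15),
    (5,1,13,15), (5,2,4,10), (5,4,6,10), (5,4,6,12), (5,4,8,10), (5,4,10,12), (6,1,2,12), (6,1,2,13),
    (6,1,3,8), (6,1,4,10), (6,1,4,11), (6,1,4,14), (6,1,5,14), (6,2,3,8), (6,2,9,10), (6,2,10,11),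
    (6,2,12,13), (6,2,12,15), (6,4,5,14), (6,4,8,9), (6,4,8,13), (6,4,10,11), (6,4,11,14), (6,4,14,15),
    (6,7,8,10), (6,7,8,13), (6,7,11,14), (6,7,12,14), (6,8,9,13), (6,8,10,13), (6,9,10,11), (6,11,12,14),
    (6,11,14,15), (6,12,13,15), (7,2,14,15), (8,2,4,15), (9,1,3,12), (9,1,3,15), (9,1,4,7), (9,1,5,7),
    (9,1,5,10), (9,1,5,15), (9,1,10,15), (9,1,12,14), (9,1,12,15), (9,1,13,14), (9,4,5,7), (9,6,8,10),
    (9,6,8,12), (9,8,10,12), (10,1,2,12), (10,1,3,12), (10,2,3,12), (10,2,5,9), (10,2,5,12), (10,2,9,12),
    (10,4,5,8), (10,4,5,13), (10,4,6,11), (10,4,6,13), (10,4,8,13), (10,4,11,13), (10,6,8,9), (10,6,8,15),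
    (10,7,8,14), (10,7,11,14), (10,7,12,14), (10,7,14,15), (10,8,9,15), (10,11,12,14), (11,2,4,14),
    (12,1,8,15), (12,2,3,8), (12,2,3,11), (12,2,6,11), (12,2,6,13), (12,2,8,11), (12,2,11,13), (12,3,4,13),
    (12,3,4,14), (12,4,13,14), (12,7,8,14), (12,7,10,14), (12,7,13,14), (12,7,14,15), (12,8,14,15),
    (12,10,13,14), (13,2,4,14), (14,1,2,7), (14,1,2,9), (14,1,3,5), (14,1,3,6), (14,1,3,7), (14,1,3,8),
    (14,1,3,11), (14,1,5,6), (14,1,8,11), (14,2,3,4), (14,2,3,7), (14,2,3,8), (14,2,3,11), (14,2,4,7),
    (14,2,6,11), (14,2,6,13), (14,2,8,11), (14,2,11,13), (14,4,9,12), (14,4,12,13), (14,5,8,12), (14,5,12,13),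
    (14,6,11,15), (14,6,13,15), (14,8,12,13), (14,9,12,13), (14,11,13,15), (15,2,4,8)]"]
  note [simp] = insert_commute numeral_2_eq_2[symmetric]
  note at_most_two = at_most_two[simplified]
  note exchange = exchange[unfolded dependent4_def, simplified]
  note bad = bad[simplified]
  note pattern1 = pattern1[simplified]
  note pattern2 = pattern2[simplified]
  note present = present[simplified]
  show False using hyp[simplified] at_most_two exchange bad pattern1 pattern2 present by sat
qed

lemma no_exchange_pattern3_list:
  assumes ob: "obstructed C P" and xs: "list_all basis_tuple xs"
  shows "list_all (\<lambda>(a, b, c, d). \<not> ({a, b, c, d} \<in> C \<and> {xor (xor a b) (xor c d), b, c, d} \<in> C)) xs"
proof -
  have "\<not> ({a, b, c, d} \<in> C \<and> {xor (xor a b) (xor c d), b, c, d} \<in> C)" if basis: "basis4 a b c d" for a b c d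
  proof
    let ?M = "linear_extension a b c d"
    assume h: "{a, b, c, d} \<in> C \<and> {xor (xor a b) (xor c d), b, c, d} \<in> C"
    obtain C' P' where C': "obstructed C' P'" "\<And>Y. Y \<subseteq> {..<16} \<Longrightarrow> ?M ` Y \<in> C \<Longrightarrow> Y \<in> C'"
      using obstructed_pullback[OF ob linear_extension_linear_auto[OF basis]] by metis
    have "{1,2,4,8} \<in> C' \<and> {15,2,4,8} \<in> C'"
      using h by (intro conjI C'(2)) (simp_all add: linear_extension_def bit_iff_odd)
    then show False using no_exchange_pattern3_std[OF C'(1)] by blast
  qed
  then show ?thesis using xs unfolding list_all_iff by fastforce
qed

text \<open>If the sum 15 were a row, it could be exchanged for one of 1, 2, 4, 8, against the third
  pattern. Then \<open>bad\<close> forces 14, 7 and 9 to be rows. Now 9 = 1+8 replaces 1 or 8: in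
  the first case {9,2,4,8} has the row 7 as its sum, in the second {1,2,4,9} has the row 14, and the
  same argument excludes both.\<close>

lemma no_basis_std:
  assumes "obstructed C P"
  shows "\<not> ({1,2,4,8} \<in> C)"
proof
  interpret obstructed C P by fact
  assume hyp: "{1,2,4,8} \<in> C"
  have "list_all distinct5
    [(7,2,4,8,9), (9,1,2,4,8), (14,1,2,4,9), (15,1,2,4,8)]"
    by simp
  note exchange = exchange_list[OF this]
  \<comment> \<open>Every set in the first of these instances contains 14 or 15, in the second 7 or
    15, in the third 9 or 15.\<close>
  have "list_all basis_tuple
    [(10,13,6,8), (13,14,4,11), (13,14,5,10)]"
    by (simp add: basis4_def dependent4_def)
  note bad = bad_list[OF this]
  have "list_all basis_tuple
    [(1,2,4,8), (1,2,4,9), (2,1,4,8), (2,1,4,9), (2,4,8,9), (4,1,2,8), (4,1,2,9), (4,2,8,9), (7,2,4,8),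
    (7,2,4,9), (8,1,2,4), (9,1,2,4)]"
    by (simp add: basis4_def dependent4_def)
  note pattern3 = no_exchange_pattern3_list[OF assms this]
  note present = present_list[of "
    [(7,1,2,8), (7,1,3,8), (7,2,3,8), (9,1,2,6), (9,1,3,6), (9,2,3,6), (14,1,2,5), (14,1,2,7), (14,1,5,7),
    (15,1,3,4), (15,1,3,7), (15,1,4,7), (15,3,4,6), (15,3,5,7), (15,3,6,7), (15,3,8,9), (15,3,8,10),
    (15,3,9,11), (15,4,6,7), (15,5,6,7), (15,7,11,14), (15,7,12,14), (15,8,9,10), (15,8,9,11), (15,11,12,14)]"]
  note [simp] = insert_commute numeral_2_eq_2[symmetric]
  note exchange = exchange[unfolded dependent4_def, simplified]
  note bad = bad[simplified]
  note pattern3 = pattern3[simplified]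
  note present = present[simplified]
  show False using hyp[simplified] exchange bad pattern3 present by sat
qed

lemma sorted4:
  fixes X :: "nat set"
  assumes "card X = 4"
  obtains a b c d where "a < b" "b < c" "c < d" "X = {a, b, c, d}"
proof -
  have fin: "finite X" using assms by (metis card.infinite zero_neq_numeral)
  define l where "l = sorted_list_of_set X"
  have "length l = Suc (Suc (Suc (Suc 0)))" using assms fin by (simp add: l_def)
  then obtain a b c d where l: "l = [a, b, c, d]" unfolding length_Suc_conv length_0_conv by blast
  have "sorted_wrt (<) l" using fin by (simp add: l_def)
  then have "a < b" "b < c" "c < d" unfolding l by auto
  moreover have "X = {a, b, c, d}" using set_sorted_list_of_set[OF fin] l unfolding l_def by auto
  ultimately show ?thesis using that by blast
qed

lemma obstructed_empty:
  assumes ob: "obstructed C P"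
  shows "C = {}"
proof (rule ccontr)
  interpret obstructed C P by fact
  assume "C \<noteq> {}"
  then obtain X where X: "X \<in> C" by blast
  obtain a b c d where l: "a < b" "b < c" "c < d" "X = {a, b, c, d}" using sorted4[OF card4[OF X]] .
  then have basis: "basis4 a b c d" using independent4_basis4[of a b c d] independent[OF X] by auto
  obtain C' P' where C': "obstructed C' P'"
      "\<And>Y. Y \<subseteq> {..<16} \<Longrightarrow> linear_extension a b c d ` Y \<in> C \<Longrightarrow> Y \<in> C'"
    using obstructed_pullback[OF ob linear_extension_linear_auto[OF basis]] by metis
  have "linear_extension a b c d ` {1, 2, 4, 8} \<in> C"
    using X l(4) by (simp only: image_insert image_empty linear_extension_axes)
  then have "{1, 2, 4, 8} \<in> C'" by (intro C'(2)) auto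
  then show False using no_basis_std[OF C'(1)] by blast
qed

section \<open>The integral lift\<close>

text \<open>Negating one entry of the vector coded by 3 makes the exchange argument much shorter than it is for
  the plain lift with entries 0 and 1, which has five bases of determinant \<open>\<plusminus>3\<close>.\<close>

definition lift :: "nat \<Rightarrow> nat \<Rightarrow> int" where
  "lift v j = (if v = 3 \<and> j = 1 then -1 else if bit v j then 1 else 0)"

lemma even_lift: "even (lift v j) \<longleftrightarrow> \<not> bit v j"
  by (auto simp: lift_def bit_iff_odd)

text \<open>Laplace expansion along the first two rows, in products of complementary minors.\<close>

definition det4 :: "(nat \<Rightarrow> 'a::comm_ring_1) \<Rightarrow> (nat \<Rightarrow> 'a) \<Rightarrow> (nat \<Rightarrow> 'a) \<Rightarrow> (nat \<Rightarrow> 'a) \<Rightarrow> 'a" where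
  "det4 a b c d =
     (a 0 * b 1 - a 1 * b 0) * (c 2 * d 3 - c 3 * d 2) - (a 0 * b 2 - a 2 * b 0) * (c 1 * d 3 - c 3 * d 1) +
     (a 0 * b 3 - a 3 * b 0) * (c 1 * d 2 - c 2 * d 1) + (a 1 * b 2 - a 2 * b 1) * (c 0 * d 3 - c 3 * d 0) -
     (a 1 * b 3 - a 3 * b 1) * (c 0 * d 2 - c 2 * d 0) + (a 2 * b 3 - a 3 * b 2) * (c 0 * d 1 - c 1 * d 0)"

definition pair4 :: "(nat \<Rightarrow> 'a::comm_ring_1) \<Rightarrow> (nat \<Rightarrow> 'a) \<Rightarrow> 'a" where
  "pair4 a y = a 0 * y 0 + a 1 * y 1 + a 2 * y 2 + a 3 * y 3"

text \<open>The generalized cross product of three vectors: entry \<open>j\<close> is the cofactor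
  of entry \<open>j\<close> in an additional first row.\<close>

definition cofactors :: "(nat \<Rightarrow> 'a::comm_ring_1) \<Rightarrow> (nat \<Rightarrow> 'a) \<Rightarrow> (nat \<Rightarrow> 'a) \<Rightarrow> nat \<Rightarrow> 'a" where
  "cofactors b c d j =
    (if j = 0 then b 1 * (c 2 * d 3 - c 3 * d 2) - b 2 * (c 1 * d 3 - c 3 * d 1) + b 3 * (c 1 * d 2 - c 2 * d 1)
     else if j = 1 then - (b 0 * (c 2 * d 3 - c 3 * d 2) - b 2 * (c 0 * d 3 - c 3 * d 0) + b 3 * (c 0 * d 2 - c 2 * d 0))
     else if j = 2 then b 0 * (c 1 * d 3 - c 3 * d 1) - b 1 * (c 0 * d 3 - c 3 * d 0) + b 3 * (c 0 * d 1 - c 1 * d 0)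
     else - (b 0 * (c 1 * d 2 - c 2 * d 1) - b 1 * (c 0 * d 2 - c 2 * d 0) + b 2 * (c 0 * d 1 - c 1 * d 0)))"

lemma pair4_cofactors:
  "pair4 a (cofactors b c d) = det4 a b c d" "pair4 b (cofactors b c d) = 0"
  "pair4 c (cofactors b c d) = 0" "pair4 d (cofactors b c d) = 0"
  unfolding pair4_def cofactors_def det4_def by (simp_all add: algebra_simps)

lemma det4_swap:
  "det4 b a c d = - det4 a b c d" "det4 a c b d = - det4 a b c d" "det4 a b d c = - det4 a b c d"
  unfolding det4_def by (simp_all add: algebra_simps)

lemma pair4_lincomb:
  "pair4 a (\<lambda>j. s * u j + t * v j + p * w j + q * z j) = s * pair4 a u + t * pair4 a v + p * pair4 a w + q * pair4 a z"
  unfolding pair4_def by (simp add: algebra_simps)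

text \<open>Cramer's rule; a determinant of square 1 is its own inverse.\<close>

lemma det4_solve:
  fixes a b c d :: "nat \<Rightarrow> 'a::comm_ring_1"
  assumes D: "det4 a b c d * det4 a b c d = 1"
  shows "\<exists>y. pair4 a y = x1 \<and> pair4 b y = x2 \<and> pair4 c y = x3 \<and> pair4 d y = x4"
proof -
  let ?D = "det4 a b c d"
  \<comment> \<open>The signs alternate because each row in turn is moved to the first
    place.\<close>
  define y where "y = (\<lambda>j. (?D * x1) * cofactors b c d j + (- ?D * x2) * cofactors a c d j +
     (?D * x3) * cofactors a b d j + (- ?D * x4) * cofactors a b c j)"
  have b: "det4 b a c d = - ?D" by (rule det4_swap)
  have c: "det4 c a b d = ?D" using det4_swap(1)[of c a b d] det4_swap(2)[of a b c d] by simp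
  have d: "det4 d a b c = - ?D"
    using det4_swap(1)[of d a b c] det4_swap(2)[of a b d c] det4_swap(3)[of a b c d] by simp
  have "pair4 a y = x1 * (?D * ?D)" "pair4 b y = x2 * (?D * ?D)" "pair4 c y = x3 * (?D * ?D)" "pair4 d y = x4 * (?D * ?D)"
    unfolding y_def pair4_lincomb pair4_cofactors(2-4) unfolding pair4_cofactors(1) b c d
    by (simp_all add: algebra_simps)
  then show ?thesis unfolding D by auto
qed

lemma det4_kernel:
  fixes a b c d y :: "nat \<Rightarrow> 'a::comm_ring_1"
  assumes "pair4 a y = 0" "pair4 b y = 0" "pair4 c y = 0" "pair4 d y = 0" "j < 4"
  shows "det4 a b c d * y j = 0"
proof -
  have "det4 a b c d * y j =
      cofactors b c d j * pair4 a y - cofactors a c d j * pair4 b y + cofactors a b d j * pair4 c y - cofactors a b c j * pair4 d y"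
  proof -
    have "j = 0 \<or> j = 1 \<or> j = 2 \<or> j = 3" using assms(5) by auto
    then show ?thesis
      unfolding pair4_def cofactors_def det4_def by (elim disjE) (simp_all add: algebra_simps)
  qed
  then show ?thesis using assms by simp
qed

text \<open>The two consequences of determinant 1 or -1 that the torus argument uses: all integer
  values on the rows are attained by integer vectors, and the real kernel is trivial.\<close>

definition unimodular :: "nat set \<Rightarrow> bool" where
  "unimodular S \<longleftrightarrow> (\<forall>x. \<exists>c. \<forall>v\<in>S. pair4 (lift v) c = x v) \<and>
     (\<forall>c::nat \<Rightarrow> real. (\<forall>v\<in>S. pair4 (\<lambda>j. of_int (lift v j)) c = 0) \<longrightarrow> (\<forall>j<4. c j = 0))"

lemma unimodular_of_det:
  assumes "det4 (lift a) (lift b) (lift c) (lift d) \<in> {1, -1}"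
  shows "unimodular {a, b, c, d}"
proof -
  let ?r = "\<lambda>v j. real_of_int (lift v j)"
  have "det4 (lift a) (lift b) (lift c) (lift d) * det4 (lift a) (lift b) (lift c) (lift d) = 1"
    using assms by auto
  then have "\<exists>y. \<forall>v\<in>{a, b, c, d}. pair4 (lift v) y = x v" for x
    using det4_solve[of "lift a" "lift b" "lift c" "lift d" "x a" "x b" "x c" "x d"] by auto
  moreover have "det4 (?r a) (?r b) (?r c) (?r d) = of_int (det4 (lift a) (lift b) (lift c) (lift d))"
    unfolding det4_def by simp
  then have "det4 (?r a) (?r b) (?r c) (?r d) \<noteq> 0" using assms by auto
  then have "y j = 0" if "\<forall>v\<in>{a, b, c, d}. pair4 (?r v) y = 0" "j < 4" for y j
    using det4_kernel[of "?r a" y "?r b" "?r c" "?r d" j] that by auto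
  ultimately show ?thesis unfolding unimodular_def by blast
qed

section \<open>Evaluation of the determinants of the lift\<close>

definition above :: "nat \<Rightarrow> nat list" where "above a = [Suc a..<16]"

lemma above_simps:
  "above 0 = [1,2,3,4,5,6,7,8,9,10,11,12,13,14,15]" "above (Suc 0) = [2,3,4,5,6,7,8,9,10,11,12,13,14,15]"
  "above 2 = [3,4,5,6,7,8,9,10,11,12,13,14,15]" "above 3 = [4,5,6,7,8,9,10,11,12,13,14,15]"
  "above 4 = [5,6,7,8,9,10,11,12,13,14,15]" "above 5 = [6,7,8,9,10,11,12,13,14,15]"
  "above 6 = [7,8,9,10,11,12,13,14,15]" "above 7 = [8,9,10,11,12,13,14,15]" "above 8 = [9,10,11,12,13,14,15]"
  "above 9 = [10,11,12,13,14,15]" "above 10 = [11,12,13,14,15]" "above 11 = [12,13,14,15]" "above 12 = [13,14,15]"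
  "above 13 = [14,15]" "above 14 = [15]" "above 15 = []"
  unfolding above_def by code_simp+

lemma lift_table:
  "lift (Suc 0) 0 = 1" "lift (Suc 0) (Suc 0) = 0" "lift (Suc 0) 2 = 0" "lift (Suc 0) 3 = 0" "lift 2 0 = 0"
  "lift 2 (Suc 0) = 1" "lift 2 2 = 0" "lift 2 3 = 0" "lift 3 0 = 1" "lift 3 (Suc 0) = -1" "lift 3 2 = 0"
  "lift 3 3 = 0" "lift 4 0 = 0" "lift 4 (Suc 0) = 0" "lift 4 2 = 1" "lift 4 3 = 0" "lift 5 0 = 1"
  "lift 5 (Suc 0) = 0" "lift 5 2 = 1" "lift 5 3 = 0" "lift 6 0 = 0" "lift 6 (Suc 0) = 1" "lift 6 2 = 1"
  "lift 6 3 = 0" "lift 7 0 = 1" "lift 7 (Suc 0) = 1" "lift 7 2 = 1" "lift 7 3 = 0" "lift 8 0 = 0"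
  "lift 8 (Suc 0) = 0" "lift 8 2 = 0" "lift 8 3 = 1" "lift 9 0 = 1" "lift 9 (Suc 0) = 0" "lift 9 2 = 0"
  "lift 9 3 = 1" "lift 10 0 = 0" "lift 10 (Suc 0) = 1" "lift 10 2 = 0" "lift 10 3 = 1" "lift 11 0 = 1"
  "lift 11 (Suc 0) = 1" "lift 11 2 = 0" "lift 11 3 = 1" "lift 12 0 = 0" "lift 12 (Suc 0) = 0"
  "lift 12 2 = 1" "lift 12 3 = 1" "lift 13 0 = 1" "lift 13 (Suc 0) = 0" "lift 13 2 = 1" "lift 13 3 = 1"
  "lift 14 0 = 0" "lift 14 (Suc 0) = 1" "lift 14 2 = 1" "lift 14 3 = 1" "lift 15 0 = 1"
  "lift 15 (Suc 0) = 1" "lift 15 2 = 1" "lift 15 3 = 1"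
  by (simp_all add: lift_def bit_iff_odd)

text \<open>A check of all 1365 increasing quadruples of nonzero vectors, 840 of which are
  bases.\<close>

lemma det_table:
  "list_all (\<lambda>a. list_all (\<lambda>b. list_all (\<lambda>c. list_all (\<lambda>d. \<not> dependent4 a b c d \<longrightarrow>
     det4 (lift a) (lift b) (lift c) (lift d) \<in> {1, -1} \<or>
     (a, b, c, d) \<in> {(3,5,11,12), (3,6,11,12), (3,7,9,12), (3,7,10,12), (3,7,11,13), (3,7,11,14),
       (5,6,11,12), (7,9,10,12), (7,11,13,14)}) (above c)) (above b)) (above a)) (above 0)"
  by (simp add: above_simps dependent4_def det4_def lift_table)

lemma basis4_independent4:
  assumes "basis4 a b c d"
  shows "independent4 {a, b, c, d}" "card {a, b, c, d} = 4"
proof -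
  have "independent4 {1, 2, 4, 8}" unfolding independent4_def by simp
  then have "independent4 (linear_extension a b c d ` {1, 2, 4, 8})"
    by (rule independent4_image[OF linear_extension_linear_auto[OF assms]])
  then show "independent4 {a, b, c, d}" by (simp only: image_insert image_empty linear_extension_axes)
  show "card {a, b, c, d} = 4" using assms unfolding basis4_def by simp
qed

lemma spanning_set_contains_basis:
  assumes R: "R \<subseteq> {..<16}" and span: "\<And>w. w < 16 \<Longrightarrow> w \<noteq> 0 \<Longrightarrow> \<exists>v\<in>R. dot w v"
  obtains X where "X \<subseteq> R" "card X = 4" "independent4 X"
proof -
  have z: "\<not> dot w 0" for w by (simp add: dot_def)
  obtain w1 :: nat where "w1 < 16" "w1 \<noteq> 0" using annihilator_of_three[of 0 0 0] by blast
  then obtain a where a: "a \<in> R" "dot w1 a" using span by blast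
  obtain w2 where "w2 < 16" "w2 \<noteq> 0" and w2: "\<not> dot w2 a" using annihilator_of_three[of a 0 0] by blast
  then obtain b where b: "b \<in> R" "dot w2 b" using span by blast
  obtain w3 where "w3 < 16" "w3 \<noteq> 0" and w3: "\<not> dot w3 a" "\<not> dot w3 b"
    using annihilator_of_three[of a b 0] by blast
  then obtain c where c: "c \<in> R" "dot w3 c" using span by blast
  obtain w4 where "w4 < 16" "w4 \<noteq> 0" and w4: "\<not> dot w4 a" "\<not> dot w4 b" "\<not> dot w4 c"
    using annihilator_of_three[of a b c] by blast
  then obtain d where d: "d \<in> R" "dot w4 d" using span by blast
  have "a \<noteq> 0" "b \<noteq> 0" "c \<noteq> 0" "d \<noteq> 0" using a(2) b(2) c(2) d(2) z by metis+
  moreover have "a \<noteq> b" "a \<noteq> c" "a \<noteq> d" "b \<noteq> c" "b \<noteq> d" "c \<noteq> d"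
    using a b c d w2 w3 w4 by auto
  moreover have "xor a b \<noteq> c" using dot_xor_right[of w3 a b] w3 c by auto
  moreover have "xor a b \<noteq> d" using dot_xor_right[of w4 a b] w4 d by auto
  moreover have "xor a c \<noteq> d" using dot_xor_right[of w4 a c] w4 d by auto
  moreover have "xor b c \<noteq> d" using dot_xor_right[of w4 b c] w4 d by auto
  moreover have "xor a b \<noteq> xor c d" using dot_xor_right[of w4 a b] dot_xor_right[of w4 c d] w4 d by metis
  ultimately have "basis4 a b c d"
    using R a(1) b(1) c(1) d(1) unfolding basis4_def dependent4_def by auto
  then show ?thesis using that[of "{a, b, c, d}"] basis4_independent4 a(1) b(1) c(1) d(1) by auto
qed

lemma unimodular_of_independent:
  assumes X: "card X = 4" "independent4 X" "X \<notin> bad_sets"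
  shows "unimodular X"
proof -
  obtain a b c d where l: "a < b" "b < c" "c < d" "X = {a, b, c, d}" using sorted4[OF X(1)] .
  have sub: "X \<subseteq> {0<..<16}" using X unfolding independent4_def by blast
  have "basis4 a b c d" using independent4_basis4[of a b c d] X(2) l by auto
  then have nd: "\<not> dependent4 a b c d" unfolding basis4_def by blast
  have ab: "a \<in> set (above 0)" "b \<in> set (above a)" "c \<in> set (above b)" "d \<in> set (above c)"
    unfolding above_def using l sub by auto
  have "det4 (lift a) (lift b) (lift c) (lift d) \<in> {1, -1} \<or>
     (a, b, c, d) \<in> {(3,5,11,12), (3,6,11,12), (3,7,9,12), (3,7,10,12), (3,7,11,13), (3,7,11,14),
       (5,6,11,12), (7,9,10,12), (7,11,13,14)}"
    by (rule det_table[unfolded list_all_iff, THEN bspec, OF ab(1), THEN bspec, OF ab(2), THEN bspec, OF ab(3),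
          THEN bspec, OF ab(4), THEN mp, OF nd])
  moreover have "(a, b, c, d) \<notin> {(3,5,11,12), (3,6,11,12), (3,7,9,12), (3,7,10,12), (3,7,11,13), (3,7,11,14),
       (5,6,11,12), (7,9,10,12), (7,11,13,14)}"
    (is "_ \<notin> ?T")
  proof
    assume "(a, b, c, d) \<in> ?T"
    then have "(\<lambda>(a, b, c, d). {a, b, c, d}) (a, b, c, d) \<in> (\<lambda>(a, b, c, d). {a, b, c, d}) ` ?T" by (rule imageI)
    moreover have "bad_sets = (\<lambda>(a, b, c, d). {a, b, c, d}) ` ?T"
      by (simp only: bad_sets_def image_insert image_empty prod.case)
    ultimately show False using X(3) unfolding l(4) prod.case by argo
  qed
  ultimately have D: "det4 (lift a) (lift b) (lift c) (lift d) \<in> {1, -1}" by argo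
  show ?thesis unfolding l(4) by (rule unimodular_of_det[OF D])
qed

lemma lift_power: "j < 4 \<Longrightarrow> lift (2 ^ j) k = (if k = j then 1 else 0)"
proof -
  assume "j < 4"
  then have "(2::nat) ^ j \<noteq> 3" by (auto simp: numeral_eq_Suc less_Suc_eq)
  then show ?thesis by (auto simp: lift_def bit_exp_iff)
qed

lemma pair4_lift_power: "j < 4 \<Longrightarrow> pair4 (\<lambda>k. of_int (lift (2 ^ j) k)) c = c j"
  unfolding pair4_def lift_power by (auto simp: numeral_eq_Suc less_Suc_eq)

lemma pair4_eq_sum:
  assumes "r \<le> 4" "\<And>j. r \<le> j \<Longrightarrow> j < 4 \<Longrightarrow> c j = 0"
  shows "pair4 a c = (\<Sum>j<r. a j * c j)"
proof -
  have "pair4 a c = (\<Sum>j<4. a j * c j)" unfolding pair4_def by (simp add: eval_nat_numeral)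
  also have "\<dots> = (\<Sum>j<r. a j * c j)"
    using assms by (intro sum.mono_neutral_right) auto
  finally show ?thesis .
qed

lemma dot_commute: "dot w v = dot v w"
  unfolding dot_def by (simp only: conj_commute)

lemma dot_power:
  assumes "j < 4"
  shows "dot w (2 ^ j) = bit w j"
proof -
  have b: "bit (2 ^ j :: nat) k \<longleftrightarrow> k = j" for k by (auto simp: bit_exp_iff)
  have "j = 0 \<or> j = 1 \<or> j = 2 \<or> j = 3" using assms by auto
  then show ?thesis unfolding dot_def b by (elim disjE) simp_all
qed

lemma bit_less_power:
  fixes v :: nat
  assumes "v < 2 ^ r" "bit v j"
  shows "j < r"
proof (rule ccontr)
  assume "\<not> j < r"
  then have "(2::nat) ^ r \<le> 2 ^ j" by (intro power_increasing) auto
  moreover have "2 ^ j \<le> v" using assms(2) by (metis bit_iff_odd div_less even_zero not_le)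
  ultimately show False using assms(1) by linarith
qed

lemma dot_take_bit:
  assumes "v < 2 ^ r"
  shows "dot (take_bit r w) v = dot w v"
proof -
  have "bit (take_bit r w) j \<and> bit v j \<longleftrightarrow> bit w j \<and> bit v j" for j
    using bit_less_power[OF assms] by (auto simp: bit_take_bit_iff)
  then show ?thesis unfolding dot_def by simp
qed

lemma unimodular_solve: "unimodular S \<Longrightarrow> \<exists>c. \<forall>v\<in>S. pair4 (lift v) c = x v"
  unfolding unimodular_def by blast

lemma unimodular_kernel:
  fixes c :: "nat \<Rightarrow> real"
  assumes "unimodular S" "\<And>v. v \<in> S \<Longrightarrow> pair4 (\<lambda>j. of_int (lift v j)) c = 0" "j < 4"
  shows "c j = 0"
  using assms unfolding unimodular_def by blast

section \<open>Sign groups and subtori\<close>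

text \<open>The matrix with rows \<open>code i\<close> applied to \<open>w\<close>, that is, the
  combination of its columns with coefficients \<open>w\<close>, written multiplicatively.\<close>

definition signs :: "('m::finite \<Rightarrow> nat) \<Rightarrow> nat \<Rightarrow> real^'m" where
  "signs code w = (\<chi> i. if dot w (code i) then -1 else 1)"

lemma signs_nth: "signs code w $ i = (if dot w (code i) then -1 else 1)"
  by (simp add: signs_def)

lemma signs_0: "signs code 0 = 1"
  by (simp add: vec_eq_iff signs_nth dot_def)

lemma signs_xor: "signs code (xor w w') = signs code w * signs code w'"
  by (simp add: vec_eq_iff signs_nth dot_xor_left)

lemma signs_take_bit: "(\<And>i. code i < 2 ^ r) \<Longrightarrow> signs code (take_bit r w) = signs code w"
  by (simp add: vec_eq_iff signs_nth dot_take_bit)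

lemma xor_take_bit_Suc:
  fixes w :: nat
  assumes "w < 2 ^ Suc r"
  shows "w = xor (take_bit r w) (if bit w r then 2 ^ r else 0)"
proof (rule bit_eqI)
  fix j
  have "bit w j \<Longrightarrow> j < Suc r" using bit_less_power[OF assms] .
  then show "bit w j = bit (xor (take_bit r w) (if bit w r then 2 ^ r else 0)) j"
    by (auto simp: bit_xor_iff bit_take_bit_iff bit_exp_iff less_Suc_eq)
qed

text \<open>The vectors \<open>signs code (2 ^ j)\<close> are the columns; they are multiplied in
  one bit of \<open>w\<close> at a time.\<close>

lemma generate_signs:
  assumes "k \<le> r" "w < 2 ^ k"
  shows "signs code w \<in> generate sign_group ((\<lambda>j. signs code (2 ^ j)) ` {..<r})"
  using assms
proof (induction k arbitrary: w)
  case 0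
  then show ?case using generate.one[of sign_group] by (simp add: signs_0 sign_group_def)
next
  case (Suc k)
  have 1: "signs code (take_bit k w) \<in> generate sign_group ((\<lambda>j. signs code (2 ^ j)) ` {..<r})"
    using Suc by simp
  show ?case
  proof (cases "bit w k")
    case True
    then have "w = xor (take_bit k w) (2 ^ k)" using xor_take_bit_Suc[OF Suc.prems(2)] by simp
    then have "signs code w = signs code (take_bit k w) \<otimes>\<^bsub>sign_group\<^esub> signs code (2 ^ k)"
      using signs_xor[of code "take_bit k w" "2 ^ k"] by (simp add: sign_group_def)
    moreover have "signs code (2 ^ k) \<in> generate sign_group ((\<lambda>j. signs code (2 ^ j)) ` {..<r})"
      using Suc.prems by (intro generate.incl) auto
    ultimately show ?thesis using generate.eng[OF 1] by metis
  next
    case False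
    then have "w = take_bit k w" using xor_take_bit_Suc[OF Suc.prems(2)] by simp
    then show ?thesis using 1 by simp
  qed
qed

lemma cis_2pi_eq_1: "cis (2 * pi * x) = 1 \<Longrightarrow> x \<in> \<int>"
proof -
  assume "cis (2 * pi * x) = 1"
  then have "cos (2 * pi * x) = 1" by (metis cis.sel(1) one_complex.sel(1))
  then obtain n :: int where "2 * pi * x = of_int n * 2 * pi" using cos_one_2pi_int by blast
  then have "x = of_int n" by simp
  then show ?thesis by simp
qed

text \<open>Padding the rows by the vectors \<open>2 ^ j\<close> with \<open>r \<le> j < 4\<close> treats all ranks \<open>r \<le> 4\<close> alike.\<close>

lemma lifted_subtorus:
  fixes K F :: "'m::finite set set" and code :: "'m \<Rightarrow> nat"
  assumes F: "\<And>\<sigma>. \<sigma> \<in> K \<Longrightarrow> \<exists>\<rho>\<in>F. \<sigma> \<subseteq> \<rho>" "F \<noteq> {}"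
    and r: "r \<le> 4" "\<And>i. code i < 2 ^ r"
    and G: "subgroup G sign_group" "G = signs code ` {..<2 ^ r}"
    and uni: "\<And>\<rho>. \<rho> \<in> F \<Longrightarrow> \<exists>X \<subseteq> code ` (- \<rho>) \<union> {2 ^ j |j. r \<le> j \<and> j < 4}. unimodular X"
  shows "\<exists>H. subtorus H \<and> acts_freely_on H (moment_angle_complex K) \<and> induces H G"
proof -
  define b :: "nat \<Rightarrow> int^'m" where "b j = (\<chi> i. lift (code i) j)" for j
  define B where "B = b ` {..<r}"
  \<comment> \<open>The entries of \<open>c\<close> from \<open>r\<close> on vanish, so the padding
    vectors pair to zero with \<open>c\<close> and the whole unimodular set is annihilated.\<close>
  have kernel: "c j = 0" if \<rho>: "\<rho> \<in> F" and c: "\<And>j. r \<le> j \<Longrightarrow> j < 4 \<Longrightarrow> c j = 0"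
      and z: "\<And>i. i \<notin> \<rho> \<Longrightarrow> pair4 (\<lambda>j. of_int (lift (code i) j)) c = 0" and j: "j < 4"
    for \<rho> and c :: "nat \<Rightarrow> real" and j
  proof -
    obtain X where X: "X \<subseteq> code ` (- \<rho>) \<union> {2 ^ j |j. r \<le> j \<and> j < 4}" "unimodular X"
      using uni[OF \<rho>] by blast
    have "pair4 (\<lambda>j. of_int (lift v j)) c = 0" if "v \<in> X" for v
    proof -
      from that X(1) consider i where "i \<notin> \<rho>" "v = code i" | k where "r \<le> k" "k < 4" "v = 2 ^ k" by auto
      then show ?thesis using z c pair4_lift_power[of _ c] by cases auto
    qed
    then show ?thesis using unimodular_kernel[OF X(2), of c j] j by blast
  qed
  have integral: "c j \<in> \<int>" if \<rho>: "\<rho> \<in> F" and c: "\<And>j. r \<le> j \<Longrightarrow> j < 4 \<Longrightarrow> c j = 0"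
      and z: "\<And>i. i \<notin> \<rho> \<Longrightarrow> pair4 (\<lambda>j. of_int (lift (code i) j)) c \<in> \<int>" and j: "j < 4"
    for \<rho> and c :: "nat \<Rightarrow> real" and j
  proof -
    obtain X where X: "X \<subseteq> code ` (- \<rho>) \<union> {2 ^ j |j. r \<le> j \<and> j < 4}" "unimodular X"
      using uni[OF \<rho>] by blast
    have int: "pair4 (\<lambda>j. of_int (lift v j)) c \<in> \<int>" if "v \<in> X" for v
    proof -
      from that X(1) consider i where "i \<notin> \<rho>" "v = code i" | k where "r \<le> k" "k < 4" "v = 2 ^ k" by auto
      then show ?thesis using z c pair4_lift_power[of _ c] by cases auto
    qed
    \<comment> \<open>The values of \<open>c\<close> on \<open>X\<close> are integers, hence the
      values of some integer vector \<open>e\<close>; the difference lies in the real kernel, so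
      \<open>c\<close> equals \<open>e\<close> in the relevant entries.\<close>
    obtain e :: "nat \<Rightarrow> int" where e: "\<forall>v\<in>X. pair4 (lift v) e = \<lfloor>pair4 (\<lambda>j. of_int (lift v j)) c\<rfloor>"
      using unimodular_solve[OF X(2), of "\<lambda>v. \<lfloor>pair4 (\<lambda>j. of_int (lift v j)) c\<rfloor>"] by blast
    have "pair4 (\<lambda>j. of_int (lift v j)) (\<lambda>j. c j - of_int (e j)) = 0" if "v \<in> X" for v
    proof -
      have "pair4 (\<lambda>j. of_int (lift v j)) (\<lambda>j. c j - of_int (e j)) =
          pair4 (\<lambda>j. of_int (lift v j)) c - of_int (pair4 (lift v) e)"
        unfolding pair4_def by (simp add: algebra_simps)
      also have "of_int (pair4 (lift v) e) = pair4 (\<lambda>j. of_int (lift v j)) c"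
        using e int[OF that] that by auto
      finally show ?thesis by simp
    qed
    then have "c j - of_int (e j) = 0" by (rule unimodular_kernel[OF X(2) _ j])
    then have "c j = of_int (e j)" by simp
    then show ?thesis by simp
  qed
  obtain \<rho>0 where \<rho>0: "\<rho>0 \<in> F" using F(2) by blast
  \<comment> \<open>\<open>B\<close> is a set and would lose repeated columns. Two equal columns
    would give the kernel vector with entries 1 and -1.\<close>
  have b_inj: "inj_on b {..<r}"
  proof (rule inj_onI)
    fix j k assume jk: "j \<in> {..<r}" "k \<in> {..<r}" "b j = b k"
    show "j = k"
    proof (rule ccontr)
      assume ne: "j \<noteq> k"
      define c :: "nat \<Rightarrow> real" where "c l = (if l = j then 1 else if l = k then -1 else 0)" for l
      have eq: "lift (code i) j = lift (code i) k" for i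
        using jk(3) unfolding b_def by (metis vec_lambda_beta)
      have "pair4 (\<lambda>l. of_int (lift (code i) l)) c = 0" for i
      proof -
        have "pair4 (\<lambda>l. of_int (lift (code i) l)) c = (\<Sum>l<r. of_int (lift (code i) l) * c l)"
          using jk r(1) by (intro pair4_eq_sum) (auto simp: c_def)
        also have "\<dots> = (\<Sum>l\<in>{j, k}. of_int (lift (code i) l) * c l)"
          using jk by (intro sum.mono_neutral_right) (auto simp: c_def)
        also have "\<dots> = 0" using ne eq[of i] by (simp add: c_def)
        finally show ?thesis .
      qed
      then have "c j = 0" using kernel[OF \<rho>0, of c j] jk r(1) by (auto simp: c_def)
      then show False by (simp add: c_def)
    qed
  qed
  have sumB: "(\<Sum>x\<in>B. f x) = (\<Sum>j<r. f (b j))" for f :: "int^'m \<Rightarrow> 'a::comm_monoid_add"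
    unfolding B_def by (simp add: sum.reindex[OF b_inj])
  have comb: "(\<Sum>x\<in>B. u x *s x) $ i = (\<Sum>j<r. lift (code i) j * u (b j))" for u i
    unfolding sumB by (simp add: b_def mult.commute)
  have finB: "finite B" unfolding B_def by simp
  have u0: "u (b j) = 0" if u: "\<And>i. i \<notin> \<rho>0 \<Longrightarrow> (\<Sum>j<r. lift (code i) j * u (b j)) = 0" and j: "j < r" for u :: "int^'m \<Rightarrow> int" and j
  proof -
    define c :: "nat \<Rightarrow> real" where "c j = (if j < r then of_int (u (b j)) else 0)" for j
    have "pair4 (\<lambda>l. of_int (lift (code i) l)) c = of_int (\<Sum>j<r. lift (code i) j * u (b j))" for i
      using r(1) by (subst pair4_eq_sum[of r]) (auto simp: c_def)
    then have z: "pair4 (\<lambda>l. of_int (lift (code i) l)) c = 0" if "i \<notin> \<rho>0" for i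
      by (simp only: u[OF that] of_int_0)
    have "c j = 0" by (rule kernel[OF \<rho>0 _ z]) (use j r(1) in \<open>auto simp: c_def\<close>)
    then show ?thesis using j by (simp add: c_def)
  qed
  have "zvec.independent B"
  proof -
    have "u x = 0" if "(\<Sum>x\<in>B. u x *s x) = 0" "x \<in> B" for u x
    proof -
      have "(\<Sum>j<r. lift (code i) j * u (b j)) = 0" for i
        using that(1) comb[of u i] by simp
      then show ?thesis using u0[of u] that(2) unfolding B_def by auto
    qed
    then show ?thesis unfolding zvec.dependent_finite[OF finB] by blast
  qed
  moreover have "\<exists>M. zvec.subspace M \<and> zvec.span B \<inter> M = {0} \<and>
      {x + y | x y. x \<in> zvec.span B \<and> y \<in> M} = UNIV"
  proof -
    obtain X where X: "X \<subseteq> code ` (- \<rho>0) \<union> {2 ^ j |j. r \<le> j \<and> j < 4}" "unimodular X"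
      using uni[OF \<rho>0] by blast
    define \<iota> where "\<iota> v = (SOME i. i \<notin> \<rho>0 \<and> code i = v)" for v
    have \<iota>: "\<iota> v \<notin> \<rho>0 \<and> code (\<iota> v) = v" if "v \<in> code ` (- \<rho>0)" for v
      unfolding \<iota>_def by (rule someI_ex) (use that in auto)
    \<comment> \<open>One index for each row in \<open>X\<close> that occurs. Restriction to these
      indices is an isomorphism on the span of \<open>B\<close>, so the vectors vanishing on
      \<open>I\<close> form a complement.\<close>
    define I where "I = \<iota> ` (X \<inter> code ` (- \<rho>0))"
    define M where "M = {y::int^'m. \<forall>i\<in>I. y $ i = 0}"
    \<comment> \<open>All other candidates for \<open>X\<close> have bit \<open>j\<close> equal to
      0, so without this vector the \<open>j\<close>-th unit vector would lie in the kernel.\<close>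
    have pow_in: "2 ^ j \<in> X" if j: "r \<le> j" "j < 4" for j
    proof (rule ccontr)
      assume nin: "2 ^ j \<notin> X"
      define c :: "nat \<Rightarrow> real" where "c l = (if l = j then 1 else 0)" for l
      have "pair4 (\<lambda>l. of_int (lift v l)) c = 0" if "v \<in> X" for v
      proof -
        have "\<not> bit v j"
        proof -
          from that X(1) consider i where "v = code i" | k where "k < 4" "v = 2 ^ k" by auto
          then show ?thesis
          proof cases
            case 1
            then show ?thesis using bit_less_power[of v r j] r(2) j by auto
          next
            case 2
            then show ?thesis using nin that by (auto simp: bit_exp_iff)
          qed
        qed
        then have "lift v j = 0" unfolding lift_def by (auto simp: bit_iff_odd)
        moreover have "pair4 (\<lambda>l. of_int (lift v l)) c = (\<Sum>l<4. of_int (lift v l) * c l)"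
          by (rule pair4_eq_sum) auto
        moreover have "(\<Sum>l<4. of_int (lift v l) * c l) = (\<Sum>l\<in>{j}. of_int (lift v l) * c l)"
          using j by (intro sum.mono_neutral_right) (auto simp: c_def)
        ultimately show ?thesis by simp
      qed
      then have "c j = 0" using unimodular_kernel[OF X(2), of c j] j by blast
      then show False by (simp add: c_def)
    qed
    have sub: "zvec.subspace M"
      unfolding M_def zvec.subspace_def by auto
    have ker0: "pair4 (\<lambda>l. of_int (lift v l)) c = 0"
      if c: "\<And>j. r \<le> j \<Longrightarrow> j < 4 \<Longrightarrow> c j = 0" and z: "\<And>i. i \<in> I \<Longrightarrow> pair4 (\<lambda>l. of_int (lift (code i) l)) c = 0" and v: "v \<in> X"
      for c :: "nat \<Rightarrow> real" and v
    proof (cases "v \<in> code ` (- \<rho>0)")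
      case True
      then have "\<iota> v \<in> I" "code (\<iota> v) = v" unfolding I_def using v \<iota> by auto
      then show ?thesis using z by metis
    next
      case False
      then obtain k where "r \<le> k" "k < 4" "v = 2 ^ k" using v X(1) by auto
      then show ?thesis using c pair4_lift_power[of k c] by simp
    qed
    have "x = 0" if x: "x \<in> zvec.span B" "x \<in> M" for x
    proof -
      obtain u where u: "x = (\<Sum>v\<in>B. u v *s v)"
        using x(1) unfolding zvec.span_finite[OF finB] by blast
      define c :: "nat \<Rightarrow> real" where "c j = (if j < r then of_int (u (b j)) else 0)" for j
      have pc: "pair4 (\<lambda>l. of_int (lift (code i) l)) c = of_int (x $ i)" for i
      proof -
        have "pair4 (\<lambda>l. of_int (lift (code i) l)) c = (\<Sum>j<r. of_int (lift (code i) j) * c j)"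
          using r(1) by (intro pair4_eq_sum) (auto simp: c_def)
        also have "\<dots> = of_int (\<Sum>j<r. lift (code i) j * u (b j))" by (simp add: c_def)
        finally show ?thesis unfolding u comb .
      qed
      have "pair4 (\<lambda>l. of_int (lift v l)) c = 0" if "v \<in> X" for v
      proof (rule ker0[OF _ _ that])
        show "c j = 0" if "r \<le> j" for j using that by (simp add: c_def)
        show "pair4 (\<lambda>l. of_int (lift (code i) l)) c = 0" if "i \<in> I" for i
          unfolding pc using x(2) that by (simp add: M_def)
      qed
      then have c0: "\<forall>j<4. c j = 0" using unimodular_kernel[OF X(2), of c] by blast
      have "of_int (x $ i) = (0::real)" for i
        unfolding pc[symmetric] pair4_def using c0 by simp
      then show ?thesis by (simp add: vec_eq_iff)
    qed
    then have cap: "zvec.span B \<inter> M = {0}"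
      using zvec.span_zero zvec.subspace_0[OF sub] by blast
    have "\<exists>x y. z = x + y \<and> x \<in> zvec.span B \<and> y \<in> M" for z
    proof -
      \<comment> \<open>Prescribes the entries of \<open>z\<close> on the chosen rows and 0 on the
        padding vectors; the latter makes the solution use only the first \<open>r\<close>
        columns.\<close>
      define t where "t v = (if v \<in> code ` (- \<rho>0) then z $ \<iota> v else 0)" for v
      obtain c :: "nat \<Rightarrow> int" where c: "\<forall>v\<in>X. pair4 (lift v) c = t v"
        using unimodular_solve[OF X(2), of t] by blast
      have cr: "c j = 0" if j: "r \<le> j" "j < 4" for j
      proof -
        have "(2::nat) ^ j \<notin> code ` (- \<rho>0)"
        proof
          assume "(2::nat) ^ j \<in> code ` (- \<rho>0)"
          then obtain i where "code i = 2 ^ j" by auto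
          then show False using r(2)[of i] j(1) by (metis not_le power_increasing one_le_numeral)
        qed
        then have "pair4 (lift (2 ^ j)) c = 0" using c pow_in[OF j] by (simp add: t_def)
        then show ?thesis using pair4_lift_power[OF j(2), of c] by simp
      qed
      define x where "x = (\<Sum>j<r. c j *s b j)"
      have xs: "x \<in> zvec.span B"
        unfolding x_def B_def by (intro zvec.span_sum zvec.span_scale zvec.span_base) auto
      have xi: "x $ i = pair4 (lift (code i)) c" for i
        unfolding x_def using r(1) cr by (subst pair4_eq_sum[of r]) (auto simp: b_def mult.commute)
      have "z - x \<in> M"
        unfolding M_def I_def using xi c \<iota> by (auto simp: t_def)
      then show ?thesis using xs by (metis add_diff_cancel_left' diff_add_cancel add.commute)
    qed
    then have "{x + y | x y. x \<in> zvec.span B \<and> y \<in> M} = UNIV" by blast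
    then show ?thesis using sub cap by blast
  qed
  ultimately have dsb: "direct_summand_basis B"
    unfolding direct_summand_basis_def using finB by blast
  \<comment> \<open>The entry -1 of the lift is odd, so its sign disappears mod 2.\<close>
  have "mod2_reduction (b j) = signs code (2 ^ j)" if "j < r" for j
    using that r(1) by (auto simp: vec_eq_iff mod2_reduction_def b_def even_lift signs_nth dot_commute[of "2 ^ j"] dot_power)
  then have im: "mod2_reduction ` B = (\<lambda>j. signs code (2 ^ j)) ` {..<r}"
    unfolding B_def image_image by (intro image_cong) auto
  have "(\<lambda>j. signs code (2 ^ j)) ` {..<r} \<subseteq> G"
    unfolding G(2) by (auto intro!: imageI)
  then have "generate sign_group (mod2_reduction ` B) \<subseteq> G"
    unfolding im using group.generate_subgroup_incl[OF group_sign_group _ G(1)] by blast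
  moreover have "G \<subseteq> generate sign_group (mod2_reduction ` B)"
    unfolding im G(2) using generate_signs[of r r] by auto
  ultimately have gen: "G = generate sign_group (mod2_reduction ` B)" by blast
  have "acts_freely_on (subtorus_of B) (moment_angle_complex K)"
    unfolding acts_freely_on_def
  proof (intro ballI impI)
    fix g x assume g: "g \<in> subtorus_of B" and x: "x \<in> moment_angle_complex K" and eq: "g * x = x"
    obtain \<phi> where \<phi>: "g = (\<chi> i. cis (2 * pi * (\<Sum>b\<in>B. real_of_int (b $ i) * \<phi> b)))"
      using g unfolding subtorus_of_def by blast
    define c where "c j = (if j < r then \<phi> (b j) else 0)" for j
    have gi: "g $ i = cis (2 * pi * pair4 (\<lambda>l. of_int (lift (code i) l)) c)" for i
    proof -
      have "(\<Sum>b\<in>B. real_of_int (b $ i) * \<phi> b) = pair4 (\<lambda>l. of_int (lift (code i) l)) c"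
        unfolding sumB using r(1) by (subst pair4_eq_sum[of r]) (auto simp: c_def b_def)
      then show ?thesis unfolding \<phi> by simp
    qed
    obtain \<sigma> where \<sigma>: "\<sigma> \<in> K" "\<And>i. i \<notin> \<sigma> \<Longrightarrow> x $ i \<in> sphere 0 1"
      using x unfolding moment_angle_complex_def polyhedral_product_def by auto
    obtain \<rho> where \<rho>: "\<rho> \<in> F" "\<sigma> \<subseteq> \<rho>" using F(1)[OF \<sigma>(1)] by blast
    \<comment> \<open>Outside the face the entries of \<open>x\<close> are nonzero, so
      \<open>g\<close> is 1 there and its exponents are integers. By \<open>integral\<close> the
      parameters are integers, so \<open>g\<close> is 1 in every entry.\<close>
    have "pair4 (\<lambda>l. of_int (lift (code i) l)) c \<in> \<int>" if "i \<notin> \<rho>" for i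
    proof -
      have "x $ i \<noteq> 0" using \<sigma>(2)[of i] \<rho> that by force
      moreover have "g $ i * x $ i = x $ i" using eq by (metis vector_mult_component)
      ultimately have "g $ i = 1" by simp
      then show ?thesis using cis_2pi_eq_1 gi by metis
    qed
    then have "c j \<in> \<int>" if "j < 4" for j using integral[OF \<rho>(1), of c j] that by (auto simp: c_def)
    then have "pair4 (\<lambda>l. of_int (lift (code i) l)) c \<in> \<int>" for i
      unfolding pair4_def by (intro Ints_add Ints_mult) auto
    then have "g $ i = 1" for i unfolding gi by (metis Ints_cases cis_multiple_2pi)
    then show "g = 1" by (simp add: vec_eq_iff)
  qed
  moreover have "subtorus (subtorus_of B)" unfolding subtorus_def using dsb by blast
  moreover have "induces (subtorus_of B) G" unfolding induces_def using dsb gen by blast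
  ultimately show ?thesis by blast
qed

section \<open>Freely acting groups of signs\<close>

lemma sign_group_mem:
  assumes "subgroup G sign_group"
  shows "1 \<in> G" "g \<in> G \<Longrightarrow> h \<in> G \<Longrightarrow> g * h \<in> G" "g \<in> G \<Longrightarrow> g $ i = 1 \<or> g $ i = -1"
    "g \<in> G \<Longrightarrow> g * g = 1"
proof -
  show "1 \<in> G" using subgroup.one_closed[OF assms] by (simp add: sign_group_def)
  show "g * h \<in> G" if "g \<in> G" "h \<in> G" for g h
    using subgroup.m_closed[OF assms that] by (simp add: sign_group_def)
  show s: "g $ i = 1 \<or> g $ i = -1" if "g \<in> G" for g i
    using subgroup.subset[OF assms] that by (auto simp: sign_group_def)
  show "g * g = 1" if "g \<in> G" for g
  proof -
    have "g $ i * g $ i = 1" for i using s[OF that, of i] by auto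
    then show ?thesis by (simp add: vec_eq_iff)
  qed
qed

text \<open>The point with entry 0 on \<open>\<sigma>\<close> and 1 elsewhere is fixed by every sign
  vector that is trivial off \<open>\<sigma>\<close>.\<close>

lemma free_sign_nontrivial_off_face:
  fixes K :: "'m::finite set set"
  assumes G: "subgroup G sign_group" and free: "acts_freely_on G (real_moment_angle_complex K)"
    and \<sigma>: "\<sigma> \<in> K" and g: "g \<in> G" "g \<noteq> 1"
  obtains i where "i \<notin> \<sigma>" "g $ i = -1"
proof -
  define x :: "real^'m" where "x = (\<chi> i. if i \<in> \<sigma> then 0 else 1)"
  have "x \<in> real_moment_angle_complex K"
    unfolding real_moment_angle_complex_def polyhedral_product_def x_def using \<sigma> by auto
  then have "g * x \<noteq> x" using free g unfolding acts_freely_on_def by blast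
  then obtain i where "g $ i * x $ i \<noteq> x $ i" by (auto simp: vec_eq_iff)
  then have "i \<notin> \<sigma>" "g $ i \<noteq> 1" unfolding x_def by (auto split: if_splits)
  then show ?thesis using that sign_group_mem(3)[OF G g(1), of i] by blast
qed

text \<open>Restricting signs to the complement of a face is injective on \<open>G\<close>, since
  elements with equal restrictions have a product that is trivial off the face.\<close>

lemma card_free_sign_group:
  fixes K :: "'m::finite set set"
  assumes G: "subgroup G sign_group" and free: "acts_freely_on G (real_moment_angle_complex K)"
    and \<sigma>: "\<sigma> \<in> K"
  shows "finite G" "card G \<le> 2 ^ card (- \<sigma>)"
proof -
  let ?f = "\<lambda>g. {i \<in> - \<sigma>. g $ i = -1}"
  have inj: "inj_on ?f G"
  proof (rule inj_onI)
    fix g h assume gh: "g \<in> G" "h \<in> G" "?f g = ?f h"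
    have "g * h = 1"
    proof (rule ccontr)
      assume "g * h \<noteq> 1"
      then obtain i where i: "i \<notin> \<sigma>" "(g * h) $ i = -1"
        using free_sign_nontrivial_off_face[OF G free \<sigma>] sign_group_mem(2)[OF G gh(1,2)] by metis
      have "g $ i = -1 \<longleftrightarrow> h $ i = -1" using gh(3) i(1) by blast
      then have "g $ i = h $ i"
        using sign_group_mem(3)[OF G gh(1), of i] sign_group_mem(3)[OF G gh(2), of i] by auto
      then show False using i(2) sign_group_mem(3)[OF G gh(1), of i] by auto
    qed
    then have "g * (h * h) = h" by (simp flip: mult.assoc)
    then show "g = h" using sign_group_mem(4)[OF G gh(2)] by simp
  qed
  have sub: "?f ` G \<subseteq> Pow (- \<sigma>)" by auto
  show "finite G" using inj_on_finite[OF inj sub] by simp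
  have "card G \<le> card (Pow (- \<sigma>))" using card_inj_on_le[OF inj sub] by simp
  then show "card G \<le> 2 ^ card (- \<sigma>)" by (simp add: card_Pow)
qed

lemma signs_mult_self: "signs code w * signs code w = 1"
  by (simp add: vec_eq_iff signs_nth)

text \<open>A basis of \<open>G\<close> as a vector space over Z/2, stored by rows. It is found as
  an independent family of maximal size, which is bounded by four since \<open>G\<close> has at most
  16 elements.\<close>

lemma exists_code:
  fixes G :: "(real^'m::finite) set"
  assumes G: "subgroup G sign_group" and small: "finite G" "card G \<le> 16"
  obtains r and code :: "'m \<Rightarrow> nat" where "r \<le> 4" "\<And>i. code i < 2 ^ r" "inj_on (signs code) {..<2 ^ r}"
    "G = signs code ` {..<2 ^ r}"
proof -
  define Q where "Q k \<longleftrightarrow> k \<le> 4 \<and> (\<exists>code :: 'm \<Rightarrow> nat. (\<forall>i. code i < 2 ^ k) \<and> inj_on (signs code) {..<2 ^ k} \<and>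
    signs code ` {..<2 ^ k} \<subseteq> G)" for k
  have "Q 0"
  proof -
    have "signs (\<lambda>_. 0) ` {..<2 ^ 0} \<subseteq> G" using sign_group_mem(1)[OF G] by (simp add: signs_0 lessThan_Suc)
    then show ?thesis unfolding Q_def by (intro conjI exI[of _ "\<lambda>_. 0"]) (auto simp: lessThan_Suc)
  qed
  moreover have bound: "k \<le> 4" if "Q k" for k using that unfolding Q_def by blast
  moreover define r where "r = (GREATEST k. Q k)"
  ultimately have r: "Q r" "\<And>k. Q k \<Longrightarrow> k \<le> r"
    using GreatestI_nat[of Q 0 4] Greatest_le_nat[of Q _ 4] by auto
  obtain code :: "'m \<Rightarrow> nat" where c: "r \<le> 4" "\<And>i. code i < 2 ^ r" "inj_on (signs code) {..<2 ^ r}"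
      "signs code ` {..<2 ^ r} \<subseteq> G"
    using r(1) unfolding Q_def by blast
  have "G \<subseteq> signs code ` {..<2 ^ r}"
  proof (rule ccontr)
    assume "\<not> ?thesis"
    then obtain h where h: "h \<in> G" "h \<notin> signs code ` {..<2 ^ r}" by blast
    have "r < 4"
    proof (rule ccontr)
      assume "\<not> r < 4"
      then have "r = 4" using c(1) by simp
      then have "card (signs code ` {..<2 ^ r}) = 16" using c(3) by (simp add: card_image)
      moreover have "insert h (signs code ` {..<2 ^ r}) \<subseteq> G" using h c(4) by blast
      then have "card (insert h (signs code ` {..<2 ^ r})) \<le> card G" using small(1) by (rule card_mono[rotated])
      ultimately show False using h(2) small(2) by simp
    qed
    \<comment> \<open>Appends \<open>h\<close> as column \<open>r\<close>: bit \<open>r\<close> of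
      row \<open>i\<close> records whether \<open>h\<close> is -1 there.\<close>
    define code' where "code' i = xor (code i) (if h $ i = -1 then 2 ^ r else 0)" for i
    have lt: "code' i < 2 ^ Suc r" for i
    proof -
      have "take_bit (Suc r) (code i) = code i"
        using c(2)[of i] by (simp add: take_bit_nat_eq_self_iff)
      moreover have "take_bit (Suc r) ((if h $ i = -1 then 2 ^ r else 0) :: nat) = (if h $ i = -1 then 2 ^ r else 0)"
        by (simp add: take_bit_nat_eq_self_iff)
      ultimately have "take_bit (Suc r) (code' i) = code' i" unfolding code'_def take_bit_xor by simp
      then show ?thesis by (simp only: take_bit_nat_eq_self_iff)
    qed
    have sg: "signs code' w = signs code w * (if bit w r then h else 1)" for w
    proof -
      have "signs code' w $ i = signs code w $ i * (if bit w r then h $ i else 1)" for i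
        using sign_group_mem(3)[OF G h(1), of i] dot_power[OF \<open>r < 4\<close>, of w]
        unfolding signs_nth code'_def dot_xor_right by (auto simp: dot_def)
      then show ?thesis by (simp add: vec_eq_iff)
    qed
    have low: "signs code w \<in> signs code ` {..<2 ^ r}" for w
      using signs_take_bit[of code r w] c(2) by (metis imageI lessThan_iff take_bit_nat_less_exp)
    have "inj_on (signs code') {..<2 ^ Suc r}"
    proof (rule inj_onI)
      fix w w' :: nat assume w: "w \<in> {..<2 ^ Suc r}" "w' \<in> {..<2 ^ Suc r}" "signs code' w = signs code' w'"
      \<comment> \<open>Different top bits would express \<open>h\<close> through the old
        columns.\<close>
      have same: "bit w r = bit w' r"
      proof (rule ccontr)
        assume ne: "bit w r \<noteq> bit w' r"
        have "h = signs code (xor w w')"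
        proof -
          have "h * h = 1" using sign_group_mem(4)[OF G h(1)] .
          have "signs code w * h = signs code w' \<or> signs code w = signs code w' * h"
            using w(3) ne unfolding sg by (auto split: if_splits)
          then have "signs code w * signs code w * h = signs code w * signs code w' \<or>
              signs code w' * signs code w = signs code w' * signs code w' * h"
            by (metis mult.assoc)
          then show ?thesis by (simp add: signs_mult_self signs_xor mult.commute eq_commute)
        qed
        then show False using h(2) low by metis
      qed
      have "signs code w = signs code w'"
      proof (cases "bit w r")
        case True
        then have "signs code w * h * h = signs code w' * h * h" using w(3) same unfolding sg by simp
        then show ?thesis using sign_group_mem(4)[OF G h(1)] by (simp add: mult.assoc)
      next
        case False
        then show ?thesis using w(3) same unfolding sg by simp
      qed
      then have "signs code (take_bit r w) = signs code (take_bit r w')" by (simp only: signs_take_bit[OF c(2)])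
      then have "take_bit r w = take_bit r w'"
        using inj_onD[OF c(3)] by (simp add: take_bit_nat_less_exp)
      moreover have "w < 2 ^ Suc r" "w' < 2 ^ Suc r" using w by auto
      ultimately show "w = w'" using xor_take_bit_Suc[of w r] xor_take_bit_Suc[of w' r] same by simp
    qed
    moreover have "signs code w \<in> G" for w using low c(4) by blast
    then have "signs code' ` {..<2 ^ Suc r} \<subseteq> G"
      using h(1) sign_group_mem(2)[OF G] unfolding sg by auto
    ultimately have "Q (Suc r)" unfolding Q_def using lt \<open>r < 4\<close> by auto
    then show False using r(2) by fastforce
  qed
  then show ?thesis using that c by blast
qed

section \<open>Rank four: complements of facets\<close>

lemma card_complement: "card (- c) = CARD('m) - card c" for c :: "'m::finite set"
  by (simp add: Compl_eq_Diff_UNIV card_Diff_subset)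

lemma two_elements_of_pair:
  assumes "card L = 2" "x \<in> L"
  obtains y where "y \<in> L" "y \<noteq> x" "L = {x, y}"
  using assms by (metis card_2_iff insert_iff singletonD insert_commute)

text \<open>Since \<open>k\<close> is the dimension of the sphere, \<open>card_m\<close> says that
  there are exactly \<open>n + 4\<close> vertices; \<open>spanning\<close> is freeness expressed by
  rows.\<close>

locale free_code = complex_euclidean K k for K :: "'m::finite set set" and k :: nat +
  fixes code :: "'m \<Rightarrow> nat"
  assumes vertices: "\<And>v. {v} \<in> K"
    and card_m: "CARD('m) = k + 5"
    and code16: "\<And>i. code i < 16"
    and spanning: "\<And>\<sigma> w. \<sigma> \<in> K \<Longrightarrow> w < 16 \<Longrightarrow> w \<noteq> 0 \<Longrightarrow> \<exists>i. i \<notin> \<sigma> \<and> dot w (code i)"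
begin

definition cofacet :: "'m set \<Rightarrow> bool" where
  "cofacet c \<longleftrightarrow> - c \<in> K \<and> card c = 4"

lemma card_Compl_K: "card (- c) = k + 5 - card c" for c :: "'m set"
  using card_m by (simp add: card_complement)

lemma card_cofacet: "card (- \<sigma>) = 4 \<longleftrightarrow> card \<sigma> = k + 1" for \<sigma> :: "'m set"
  using card_m card_mono[of UNIV \<sigma>] by (auto simp: card_complement)

text \<open>Four rows that span a space of dimension four are distinct and form a basis.\<close>

lemma code_cofacet:
  assumes "cofacet c"
  shows "inj_on code c" "card (code ` c) = 4" "independent4 (code ` c)"
proof -
  have "\<exists>v\<in>code ` c. dot w v" if "w < 16" "w \<noteq> 0" for w
    using spanning[of "- c" w] assms that unfolding cofacet_def by auto
  then obtain X where X: "X \<subseteq> code ` c" "card X = 4" "independent4 X"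
    using spanning_set_contains_basis[of "code ` c"] code16 by (metis image_subset_iff lessThan_iff)
  have fin: "finite c" by simp
  have "card (code ` c) \<le> 4" using card_image_le[OF fin, of code] assms unfolding cofacet_def by simp
  then have "X = code ` c" using X by (intro card_seteq) auto
  then show "card (code ` c) = 4" "independent4 (code ` c)" using X by auto
  then show "inj_on code c" using assms eq_card_imp_inj_on[OF fin, of code] unfolding cofacet_def by simp
qed

text \<open>The complement of \<open>T\<close> is a ridge, and the facets containing it correspond
  to the elements removed from \<open>T\<close>.\<close>

lemma cofacet_exchange:
  assumes "card T = 5" "x \<in> T" "cofacet (T - {x})"
  shows "card {y \<in> T. cofacet (T - {y})} = 2"
proof -
  have "- (T - {x}) \<in> K" using assms unfolding cofacet_def by blast
  moreover have "- T \<subseteq> - (T - {x})" by blast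
  ultimately have "- T \<in> K" using complex unfolding abstract_complex_def by blast
  moreover have "card (- T) = k" using assms(1) card_Compl_K[of T] by simp
  ultimately have "card {v. v \<notin> - T \<and> insert v (- T) \<in> K} = 2" using card_ridge vertices by blast
  moreover have "{v. v \<notin> - T \<and> insert v (- T) \<in> K} = {y \<in> T. cofacet (T - {y})}"
  proof -
    have "insert v (- T) = - (T - {v})" for v by blast
    moreover have "card (T - {v}) = 4" if "v \<in> T" for v using assms(1) that by simp
    ultimately show ?thesis unfolding cofacet_def by auto
  qed
  ultimately show ?thesis by simp
qed

text \<open>Of the five sets obtained by omitting an element from \<open>insert j c\<close>, exactly
  two are cofacets. One omits \<open>j\<close>; the other must omit \<open>i\<close>, as a cofacet
  cannot contain two equal rows.\<close>

lemma cofacet_swap: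
  assumes c: "cofacet c" and i: "i \<in> c" and j: "j \<notin> c" and eq: "code i = code j"
  shows "cofacet (insert j (c - {i}))"
proof -
  let ?T = "insert j c"
  have T: "card ?T = 5" "?T - {j} = c" using c j unfolding cofacet_def by auto
  then have "card {y \<in> ?T. cofacet (?T - {y})} = 2" "j \<in> {y \<in> ?T. cofacet (?T - {y})}"
    using cofacet_exchange[of ?T j] c by auto
  then obtain y where y: "y \<in> ?T" "cofacet (?T - {y})" "y \<noteq> j"
    using two_elements_of_pair by (metis (mono_tags, lifting) mem_Collect_eq)
  have "y = i"
  proof (rule ccontr)
    assume "y \<noteq> i"
    then have "i \<in> ?T - {y}" "j \<in> ?T - {y}" using i y by auto
    then have "i = j" using code_cofacet(1)[OF y(2)] eq by (meson inj_onD)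
    then show False using i j by blast
  qed
  moreover have "?T - {i} = insert j (c - {i})" using i j by blast
  ultimately show ?thesis using y(2) by simp
qed

text \<open>Swaps move \<open>c\<close> to \<open>c'\<close> one vertex at a time, so being a
  cofacet depends only on the set of rows.\<close>

lemma cofacet_same_code:
  assumes "cofacet c" "card c' = 4" "inj_on code c'" "code ` c' = code ` c"
  shows "cofacet c'"
  using assms(1,4)
proof (induction "card (c' - c)" arbitrary: c rule: less_induct)
  case less
  show ?case
  proof (cases "c' \<subseteq> c")
    case True
    then have "c' = c" using less.prems(1) assms(2) unfolding cofacet_def by (intro card_subset_eq) auto
    then show ?thesis using less.prems by simp
  next
    case False
    then obtain j where j: "j \<in> c'" "j \<notin> c" by blast
    then obtain i where i: "i \<in> c" "code i = code j" using less.prems(2) by (metis imageE imageI)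
    have "i \<notin> c'" using assms(3) i j by (metis inj_onD)
    let ?d = "insert j (c - {i})"
    have "cofacet ?d" using cofacet_swap[OF less.prems(1) i(1) j(2) i(2)] .
    moreover have "code ` c = insert (code i) (code ` (c - {i}))" using i(1) by blast
    then have "code ` c' = code ` ?d" using less.prems(2) i(2) by simp
    moreover have "c' - ?d = (c' - c) - {j}" using \<open>i \<notin> c'\<close> by blast
    then have "card (c' - ?d) < card (c' - c)" using j by (metis DiffI card_Diff1_less finite)
    ultimately show ?thesis using less.hyps by blast
  qed
qed

lemma obstructed_cofacets:
  assumes "\<And>M. linear_auto M \<Longrightarrow> \<exists>X\<in>bad_sets. \<exists>c. cofacet c \<and> M ` X = code ` c"
  shows "obstructed {code ` c |c. cofacet c} (range code)"
proof
  fix X assume "X \<in> {code ` c |c. cofacet c}"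
  then obtain c where c: "cofacet c" "X = code ` c" by blast
  show "X \<subseteq> range code" using c by blast
  show "card X = 4" "independent4 X" using code_cofacet[OF c(1)] c(2) by auto
next
  show "range code \<subseteq> {..<16}" using code16 by auto
  show "\<exists>X\<in>bad_sets. M ` X \<in> {code ` c |c. cofacet c}" if "linear_auto M" for M
    using assms[OF that] by blast
next
  fix Q assume Q: "Q \<subseteq> range code" "card Q = 5"
  \<comment> \<open>One representative vertex for each row turns five rows into five vertices. By
    \<open>cofacet_same_code\<close> the choice does not affect which subsets are cofacets.\<close>
  define s where "s = inv_into UNIV code"
  have s: "code (s v) = v" if "v \<in> Q" for v
    unfolding s_def using that Q(1) by (auto intro: f_inv_into_f)
  then have inj: "inj_on s Q" by (metis inj_onI)
  define T where "T = s ` Q"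
  have T: "card T = 5" unfolding T_def using card_image[OF inj] Q(2) by simp
  have code_T: "code ` s ` R = R" if "R \<subseteq> Q" for R
    unfolding image_image using s that by (force simp: image_iff)
  have om: "Q - {v} \<in> {code ` c |c. cofacet c} \<longleftrightarrow> cofacet (T - {s v})" if v: "v \<in> Q" for v
  proof -
    have eq: "T - {s v} = s ` (Q - {v})" unfolding T_def using inj_on_image_set_diff[OF inj, of Q "{v}"] v by auto
    have cd: "code ` (T - {s v}) = Q - {v}" unfolding eq by (rule code_T) blast
    show ?thesis
    proof
      assume "Q - {v} \<in> {code ` c |c. cofacet c}"
      then obtain c where c: "cofacet c" "Q - {v} = code ` c" by blast
      have "inj_on code (T - {s v})"
        unfolding T_def using s by (auto intro!: inj_onI)
      moreover have "card (T - {s v}) = 4" using T v T_def by (simp add: card_Diff_singleton)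
      ultimately show "cofacet (T - {s v})" using cofacet_same_code[OF c(1)] c(2) cd by metis
    next
      assume "cofacet (T - {s v})"
      then show "Q - {v} \<in> {code ` c |c. cofacet c}" using cd by blast
    qed
  qed
  have set: "{y \<in> T. cofacet (T - {y})} = s ` {v \<in> Q. Q - {v} \<in> {code ` c |c. cofacet c}}"
    unfolding T_def using om T_def by blast
  have cards: "card {y \<in> T. cofacet (T - {y})} = card {v \<in> Q. Q - {v} \<in> {code ` c |c. cofacet c}}"
    unfolding set by (intro card_image inj_on_subset[OF inj]) blast
  have "card {y \<in> T. cofacet (T - {y})} \<in> {0, 2}"
  proof (cases "{y \<in> T. cofacet (T - {y})} = {}")
    case True
    then show ?thesis by (metis card.empty insertI1)
  next
    case False
    then obtain x where "x \<in> T" "cofacet (T - {x})" by blast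
    then show ?thesis using cofacet_exchange[OF T] by blast
  qed
  then show "card {v \<in> Q. Q - {v} \<in> {code ` c |c. cofacet c}} \<in> {0, 2}" using cards by simp
qed

text \<open>Otherwise the cofacets would form an obstructed family, which has to be empty, although
  \<open>K\<close> has a facet.\<close>

lemma exists_linear_auto:
  obtains M where "linear_auto M" "\<And>X c. X \<in> bad_sets \<Longrightarrow> cofacet c \<Longrightarrow> M ` X \<noteq> code ` c"
proof (rule ccontr)
  assume "\<not> thesis"
  then have "\<exists>X\<in>bad_sets. \<exists>c. cofacet c \<and> M ` X = code ` c" if "linear_auto M" for M
    using that \<open>\<And>M. \<lbrakk>linear_auto M; \<And>X c. \<lbrakk>X \<in> bad_sets; cofacet c\<rbrakk> \<Longrightarrow> M ` X \<noteq> code ` c\<rbrakk> \<Longrightarrow> thesis\<close> by blast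
  then have "{code ` c |c. cofacet c} = {}" using obstructed_empty obstructed_cofacets by blast
  moreover obtain v :: 'm where "{v} \<in> K" using vertices by blast
  then obtain \<rho> where "\<rho> \<in> K" "card \<rho> = k + 1" using face_le_facet[of "{v}" v] by blast
  then have "cofacet (- \<rho>)" unfolding cofacet_def using card_cofacet by simp
  ultimately show False by blast
qed

end

theorem theorem1p2:
  fixes K :: "'m::finite set set" and n :: nat
  assumes "pl_sphere K"
    and "complex_dim K = int n - 1"
    and "vertex_set K = UNIV"
    and "CARD('m) \<le> n + 4"
  shows "\<forall>G. subgroup G sign_group \<longrightarrow> acts_freely_on G (real_moment_angle_complex K) \<longrightarrow>
           (\<exists>H. subtorus H \<and> acts_freely_on H (moment_angle_complex K) \<and> induces H G)"
proof (intro allI impI)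
  fix G assume G: "subgroup G sign_group" and free: "acts_freely_on G (real_moment_angle_complex K)"
  obtain d and \<Delta> :: "(real^'m) set" and f g where \<Delta>: "abstract_complex K" "int d simplex \<Delta>"
      "homeomorphism (geometric_realization K) (rel_frontier \<Delta>) f g"
    using assms(1) unfolding pl_sphere_def pl_homeomorphic_def by blast
  \<comment> \<open>The dimension of the boundary sphere of the simplex; it turns out to be
    \<open>n - 1\<close>.\<close>
  define k where "k = d - 1"
  interpret punctured_euclidean "geometric_realization K" k
    unfolding k_def by (rule punctured_euclidean_rel_frontier_simplex[OF \<Delta>(2,3)])
  interpret complex_euclidean K k by unfold_locales (rule \<Delta>(1))
  have ver: "{v} \<in> K" for v using assms(3) unfolding vertex_set_def by blast
  define F where "F = {\<rho> \<in> K. card \<rho> = k + 1}"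
  have facet: "\<exists>\<rho>\<in>F. \<sigma> \<subseteq> \<rho>" if "\<sigma> \<in> K" for \<sigma>
    unfolding F_def using face_le_facet[OF that ver] by blast
  obtain \<rho>0 where \<rho>0: "\<rho>0 \<in> F" using facet ver by blast
  have "Max (card ` K) = k + 1"
  proof (rule Max_eqI)
    show "finite (card ` K)" by simp
    show "x \<le> k + 1" if "x \<in> card ` K" for x using that card_face_le by auto
    show "k + 1 \<in> card ` K" using \<rho>0 unfolding F_def by force
  qed
  then have n: "n = k + 1" using assms(2) unfolding complex_dim_def by simp
  have cardF: "card (- \<rho>) = CARD('m) - (k + 1)" "card (- \<rho>) \<le> 4" if "\<rho> \<in> F" for \<rho>
    using that assms(4) n unfolding F_def by (auto simp: card_complement)
  have "(2::nat) ^ card (- \<rho>0) \<le> 2 ^ 4" by (rule power_increasing) (use cardF(2)[OF \<rho>0] in auto)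
  moreover have "\<rho>0 \<in> K" using \<rho>0 F_def by blast
  ultimately have small: "finite G" "card G \<le> 16" using card_free_sign_group[OF G free] by fastforce+
  obtain r and code :: "'m \<Rightarrow> nat" where r: "r \<le> 4" and code: "\<And>i. code i < 2 ^ r"
    and inj: "inj_on (signs code) {..<2 ^ r}" and GE: "G = signs code ` {..<2 ^ r}"
    using exists_code[OF G small] by blast
  have span0: "\<exists>i. i \<notin> \<sigma> \<and> dot w (code i)" if \<sigma>: "\<sigma> \<in> K" and w: "w < 2 ^ r" "w \<noteq> 0" for \<sigma> w
  proof -
    have "signs code w \<noteq> signs code 0" using inj_onD[OF inj, of w 0] w by auto
    then have "signs code w \<noteq> 1" by (simp add: signs_0)
    moreover have "signs code w \<in> G" using GE w by blast
    ultimately obtain i where "i \<notin> \<sigma>" "signs code w $ i = -1"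
      using free_sign_nontrivial_off_face[OF G free \<sigma>] by blast
    then show ?thesis by (auto simp: signs_nth split: if_splits)
  qed
  show "\<exists>H. subtorus H \<and> acts_freely_on H (moment_angle_complex K) \<and> induces H G"
  proof (cases "r = 4")
    case False
    then have r3: "r < 4" using r by simp
    then have "(2::nat) ^ r \<le> 2 ^ 3" by (intro power_increasing) auto
    then have code8: "code i < 8" for i using code[of i] by simp
    show ?thesis
    proof (rule lifted_subtorus[where F = F and code = code and r = r])
      fix \<rho> assume \<rho>: "\<rho> \<in> F"
      let ?P = "{2 ^ j |j. r \<le> j \<and> j < 4} :: nat set"
      let ?R = "code ` (- \<rho>) \<union> ?P"
      have P: "?P \<subseteq> {1, 2, 4, 8}" by (auto simp: numeral_eq_Suc less_Suc_eq)
      have "?R \<subseteq> {..<16}" using P code8 by (auto intro: less_trans[of _ 8])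
      moreover have "\<exists>v\<in>?R. dot w v" if w: "w < 16" "w \<noteq> 0" for w
      \<comment> \<open>If the low bits of \<open>w\<close> vanish, a padding vector detects a high
        bit; otherwise a row outside the facet detects the low part.\<close>
      proof (cases "take_bit r w = 0")
        case True
        have "\<exists>j. bit w j" using w(2) bit_eq_iff[of w 0] by auto
        then obtain j where j: "bit w j" by blast
        then have "r \<le> j" using True by (metis bit_take_bit_iff bit_0_eq bot_apply bot_bool_def not_le)
        moreover have "j < 4" using bit_less_power[of w 4 j] w(1) j by simp
        ultimately show ?thesis using dot_power[of j w] j by blast
      next
        case False
        then obtain i where "i \<notin> \<rho>" "dot (take_bit r w) (code i)"
          using span0[of \<rho> "take_bit r w"] \<rho> unfolding F_def by auto
        then show ?thesis using dot_take_bit[OF code] by blast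
      qed
      ultimately obtain X where X: "X \<subseteq> ?R" "card X = 4" "independent4 X"
        by (rule spanning_set_contains_basis)
      \<comment> \<open>Here the determinants reduce to order at most three. In terms of the table:
        each bad set has an element at least 9, but rows are below 8 and the padding consists of
        powers of two up to 8.\<close>
      have "X \<notin> bad_sets"
      proof
        assume "X \<in> bad_sets"
        then obtain v where v: "v \<in> X" "v \<ge> 9" unfolding bad_sets_def by fastforce
        have "v \<noteq> code i" for i using code8[of i] v(2) by simp
        then have "v \<notin> code ` (- \<rho>)" by blast
        then have "v \<in> {1, 2, 4, 8}" using v(1) X(1) P by blast
        then show False using v(2) by auto
      qed
      then show "\<exists>X\<subseteq>?R. unimodular X" using X unimodular_of_independent by blast
    qed (use facet \<rho>0 r code G GE in auto)
  next
    case True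
    have card16: "card G = 16" using GE inj True by (simp add: card_image)
    \<comment> \<open>A free group of order 16 needs four vertices outside a facet, and the bound on
      the number of vertices allows no more.\<close>
    have m: "CARD('m) = k + 5"
    proof -
      have "(2::nat) ^ 4 \<le> 2 ^ card (- \<rho>0)" using card_free_sign_group(2)[OF G free \<open>\<rho>0 \<in> K\<close>] card16 by simp
      then have "4 \<le> card (- \<rho>0)" by (rule power_le_imp_le_exp[rotated]) simp
      then show ?thesis using cardF[OF \<rho>0] by simp
    qed
    have code16: "code i < 16" for i using code[of i] True by simp
    interpret free_code K k code
      by unfold_locales (use ver m code16 span0 True in auto)
    obtain M where M: "linear_auto M" "\<And>X c. X \<in> bad_sets \<Longrightarrow> cofacet c \<Longrightarrow> M ` X \<noteq> code ` c"
      using exists_linear_auto by blast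
    define N where "N = inv_into {..<16} M"
    have N: "linear_auto N" and NM: "\<And>x. x < 16 \<Longrightarrow> M (N x) = x" "\<And>x. x < 16 \<Longrightarrow> N (M x) = x"
      unfolding N_def using linear_auto_inv[OF M(1)] by auto
    \<comment> \<open>A change of basis of \<open>G\<close>: the rows change by the inverse of
      \<open>M\<close>, while the transposes of \<open>N\<close> and \<open>M\<close> show that the
      columns still span \<open>G\<close>.\<close>
    define code' where "code' i = N (code i)" for i
    have code'16: "code' i < 16" for i unfolding code'_def using linear_autoD(1)[OF N code16] .
    have "\<exists>w'<16. signs code' w = signs code w'" if w: "w < 16" for w
    proof -
      obtain w' where w': "w' < 16" "\<And>v. v < 16 \<Longrightarrow> dot w (N v) \<longleftrightarrow> dot w' v"
        using dot_linear_auto[OF N w] by blast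
      have "dot w (code' i) \<longleftrightarrow> dot w' (code i)" for i unfolding code'_def by (rule w'(2)[OF code16])
      then show ?thesis using w'(1) unfolding signs_def by auto
    qed
    then have "signs code' ` {..<16} \<subseteq> signs code ` {..<16}" by auto
    moreover have "\<exists>w'<16. signs code w = signs code' w'" if w: "w < 16" for w
    proof -
      obtain w' where w': "w' < 16" "\<And>v. v < 16 \<Longrightarrow> dot w (M v) \<longleftrightarrow> dot w' v"
        using dot_linear_auto[OF M(1) w] by blast
      have "dot w (code i) \<longleftrightarrow> dot w' (code' i)" for i
        using w'(2)[OF code'16] NM(1)[OF code16] unfolding code'_def by simp
      then show ?thesis using w'(1) unfolding signs_def by auto
    qed
    then have "signs code ` {..<16} \<subseteq> signs code' ` {..<16}" by auto
    ultimately have GE': "G = signs code' ` {..<2 ^ 4}" using GE True by auto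
    show ?thesis
    proof (rule lifted_subtorus[where F = F and code = code' and r = 4])
      fix \<rho> assume \<rho>: "\<rho> \<in> F"
      have cof: "cofacet (- \<rho>)" unfolding cofacet_def using \<rho> card_cofacet unfolding F_def by auto
      let ?X = "code' ` (- \<rho>)"
      have X: "?X = N ` code ` (- \<rho>)" unfolding code'_def by auto
      have "independent4 ?X" unfolding X by (rule independent4_image[OF N code_cofacet(3)[OF cof]])
      moreover have "card ?X = 4"
      proof -
        have "inj_on N (code ` (- \<rho>))"
          using linear_autoD(3)[OF N] code16 by (auto intro!: inj_onI)
        then show ?thesis unfolding X using card_image code_cofacet(2)[OF cof] by metis
      qed
      \<comment> \<open>\<open>M\<close> carries \<open>?X\<close> back to the old rows of a
        cofacet, which by the choice of \<open>M\<close> are not the image of a bad set.\<close>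
      moreover have "?X \<notin> bad_sets"
      proof
        assume "?X \<in> bad_sets"
        moreover have "M ` ?X = code ` (- \<rho>)"
          unfolding X image_image using NM(1)[OF code16] by simp
        ultimately show False using M(2) cof by blast
      qed
      ultimately have "unimodular ?X" by (intro unimodular_of_independent)
      then show "\<exists>X\<subseteq>?X \<union> {2 ^ j |j. 4 \<le> j \<and> j < 4}. unimodular X" by blast
    qed (use facet \<rho>0 code'16 G GE' in auto)
  qed
qed

end
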